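(* For $n\ge 2$ let $\xi_n=\tau_n/\log n$, where $\tau_n$ is the time between consecutive burnouts at site $n$ in the forest fire model on $\mathbb{Z}_+$ with ignition only at $0$. Then, as $n\to\infty$, $\xi_n$ converges in distribution to a random variable $\xi$ with mean $\mathbb{E}\,\xi=e^{\gamma}$ and moment generating function $$\mathbb{E}\,e^{s\xi}=1+s\,e^{\gamma}\exp\left(\sum_{m=1}^{\infty}\frac{s^m}{m\cdot m!}\right),\qquad s\in\mathbb{R},$$ where $\gamma$ is the Euler constant. (For $s>0$ the right-hand side equals $1+\exp\{\mathrm{Ei}(s)\}$.)
   Context: Forest fire model on $\mathbb{Z}_+=\{0,1,2,\dots\}$ with ignition only at $0$: each site $x$ has state $\eta_x(t)\in\{0,1\}$ at time $t\ge 0$ (0 = vacant, 1 = occupied), with $\eta_x(0)=0$ for all $x$. Each vacant site becomes occupied at rate $1$, independently for different sites (i.e. independent rate-1 Poisson arrival processes are attached to the sites, and an arrival at a vacant site makes it occupied; an arrival at an occupied site has no effect). An occupied site stays occupied until it is burnt. Whenever site $0$ becomes occupied, the whole connected cluster of occupied sites containing $0$ (including $0$ itself) is instantaneously burnt, i.e. all its sites become vacant. For $i\ge1$ let $T_n(i)$ be the time when site $n$ is burnt for the $i$-th time, $T_n(0)=0$, and $\tau_n(i)=T_n(i)-T_n(i-1)$. For fixed $n$ the variables $\tau_n(i)$, $i\ge1$, are i.i.d.; $\tau_n$ denotes a random variable with their common distribution. $\mathrm{Ei}(s)=\int_{-\infty}^s \frac{e^x}{x}\,dx$ is the exponential integral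 (Cauchy principal value), which for $s>0$ equals $\gamma+\log s+\sum_{m\ge1}\frac{s^m}{m\cdot m!}$; $\gamma=0.577\ldots$ is the Euler constant. *)

theory Defs
  imports "HOL-Probability.Probability"
begin

(* A configuration c :: nat => bool records the state of every site of Z_+;
   c x means that x is occupied. *)

(* The connected cluster of occupied sites containing 0: in the nearest-neighbour graph
   on Z_+ it consists of the x with {0..x} fully occupied, and it is empty if 0 is vacant. *)
definition cluster0 :: "(nat \<Rightarrow> bool) \<Rightarrow> nat set" where
  "cluster0 c = {x. \<forall>y\<le>x. c y}"

definition burn :: "(nat \<Rightarrow> bool) \<Rightarrow> nat \<Rightarrow> bool" where
  "burn c = (\<lambda>x. c x \<and> x \<notin> cluster0 c)"

(* An arrival at y occupies y (no effect if y is already occupied); if this makes 0 occupied,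
   its cluster is burnt in the same instant. As no path has 0 occupied just before an arrival,
   burn changes nothing when y > 0. *)
definition arrival_update :: "nat \<Rightarrow> (nat \<Rightarrow> bool) \<Rightarrow> nat \<Rightarrow> bool" where
  "arrival_update y c = burn (c(y := True))"

(* The left limit h(t-), provided that it exists. *)
definition left_state :: "(real \<Rightarrow> nat \<Rightarrow> bool) \<Rightarrow> real \<Rightarrow> nat \<Rightarrow> bool" where
  "left_state h t x \<longleftrightarrow> (\<forall>\<^sub>F s in at_left t. h s x)"

(* h is the path of configurations driven by the arrival times A y at the sites y.
   Limits are sitewise, since infinitely many sites change in every time interval.
   The arrival times at different sites are almost surely distinct, so what is required
   at a simultaneous arrival is immaterial. *)
definition forest_fire_path :: "(nat \<Rightarrow> real set) \<Rightarrow> (real \<Rightarrow> nat \<Rightarrow> bool) \<Rightarrow> bool" where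
  "forest_fire_path A h \<longleftrightarrow>
     (\<forall>x. \<not> h 0 x) \<and>
     (\<forall>t\<ge>0. \<forall>x. \<forall>\<^sub>F s in at_right t. h s x = h t x) \<and>
     (\<forall>t>0. \<forall>x. \<forall>\<^sub>F s in at_left t. h s x = left_state h t x) \<and>
     (\<forall>t>0. (\<forall>y. t \<notin> A y) \<longrightarrow> h t = left_state h t) \<and>
     (\<forall>t>0. \<forall>y. t \<in> A y \<longrightarrow> h t = arrival_update y (left_state h t))"

(* The times at which site n is burnt: 0 becomes occupied and n belongs to its cluster. *)
definition burn_times :: "(nat \<Rightarrow> real set) \<Rightarrow> (real \<Rightarrow> nat \<Rightarrow> bool) \<Rightarrow> nat \<Rightarrow> real set" where
  "burn_times A h n =
     {t. 0 < t \<and> t \<in> A 0 \<and> \<not> left_state h t 0 \<and> n \<in> cluster0 ((left_state h t)(0 := True))}"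

(* Enumerates a locally finite set of positive times in increasing order. *)
primrec nth_time :: "real set \<Rightarrow> nat \<Rightarrow> real" where
  "nth_time B 0 = 0"
| "nth_time B (Suc i) = Inf {t \<in> B. nth_time B i < t}"

(* E y k is the k-th waiting time (k = 0, 1, ...) of the arrival process at site y. *)
definition arrival_times :: "(nat \<Rightarrow> nat \<Rightarrow> 'a \<Rightarrow> real) \<Rightarrow> 'a \<Rightarrow> nat \<Rightarrow> real set" where
  "arrival_times E \<omega> y = range (\<lambda>k. \<Sum>j\<le>k. E y j \<omega>)"

(* T_n(i) and tau_n(i) *)
definition burnout_time ::
    "(nat \<Rightarrow> nat \<Rightarrow> 'a \<Rightarrow> real) \<Rightarrow> ('a \<Rightarrow> real \<Rightarrow> nat \<Rightarrow> bool) \<Rightarrow> nat \<Rightarrow> nat \<Rightarrow> 'a \<Rightarrow> real" where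
  "burnout_time E \<eta> n i \<omega> = nth_time (burn_times (arrival_times E \<omega>) (\<eta> \<omega>) n) i"

definition burnout_gap ::
    "(nat \<Rightarrow> nat \<Rightarrow> 'a \<Rightarrow> real) \<Rightarrow> ('a \<Rightarrow> real \<Rightarrow> nat \<Rightarrow> bool) \<Rightarrow> nat \<Rightarrow> nat \<Rightarrow> 'a \<Rightarrow> real" where
  "burnout_gap E \<eta> n i \<omega> = burnout_time E \<eta> n i \<omega> - burnout_time E \<eta> n (i - 1) \<omega>"

(* Independent rate-1 Poisson processes are given by their i.i.d. Exp(1) waiting times.
   The dynamics is only required almost surely; on the exceptional null set \<eta> is arbitrary,
   which is why measurability of the times T_n(i) is a separate requirement. *)
locale forest_fire = prob_space M
  for M :: "'a measure" +
  fixes E :: "nat \<Rightarrow> nat \<Rightarrow> 'a \<Rightarrow> real"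
    and \<eta> :: "'a \<Rightarrow> real \<Rightarrow> nat \<Rightarrow> bool"
  assumes waiting_times_indep: "indep_vars (\<lambda>_. borel) (\<lambda>(y, k). E y k) UNIV"
    and waiting_times_exponential: "\<And>y k. distributed M lborel (E y k) (exponential_density 1)"
    and dynamics: "AE \<omega> in M. forest_fire_path (arrival_times E \<omega>) (\<eta> \<omega>)"
    and burnout_time_measurable: "\<And>n i. burnout_time E \<eta> n i \<in> borel_measurable M"

(* The exponential integral as a Cauchy principal value at the pole 0. *)
definition Ei :: "real \<Rightarrow> real" where
  "Ei s = Lim (at_right 0) (\<lambda>\<epsilon>. LINT x:{..s} - {-\<epsilon><..<\<epsilon>}|lborel. exp x / x)"

end

theory Submission
  imports Defs
begin

text \<open>A fire that reaches site \<open>n\<close> leaves \<open>Suc n\<close> vacant, whether or not it was occupied. Hence the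
  next fire at \<open>n\<close> reaches \<open>Suc n\<close> exactly if \<open>Suc n\<close> had an arrival since: the fires at
  \<open>Suc n\<close> arise from those at \<open>n\<close> by keeping the points that close an interval which contains an
  arrival of an independent Poisson process (\<open>burn_times_thinned\<close>). By memorylessness, if the gaps
  at \<open>n\<close> are i.i.d., then so are those at \<open>Suc n\<close> (\<open>thin_gaps_law\<close>): a gap at \<open>Suc n\<close> is the
  first partial sum of gaps at \<open>n\<close> beyond an independent exponential time. This gives
  \<open>\<phi>\<^bsub>n+1\<^esub>(s) - 1 = (\<phi>\<^bsub>n\<^esub>(s) - 1) / (1 - \<phi>\<^bsub>n\<^esub>(s - 1))\<close> for the moment generating functions and \<open>s < 1\<close>
  (\<open>thin_law_mgf\<close>).

  The recursion has the explicit solution \<open>\<phi>\<^bsub>n\<^esub>(s) = 1 + s / (1 - s) * exp (K\<^bsub>n\<^esub>(s))\<close>, where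
  \<open>K\<^bsub>n\<^esub>(s)\<close> is the integral over \<open>u > 0\<close> of \<open>exp (s u) q (1 - q^n) / u\<close> with \<open>q = 1 - exp (-u)\<close>
  (\<open>gap_law_mgf\<close>, \<open>log_mgf_integral\<close>). After the substitution \<open>u = v ln n\<close> the factor \<open>q^n\<close> is
  \<open>(1 - n powr (-v))^n\<close>, which tends to \<open>0\<close> for \<open>v < 1\<close> and to \<open>1\<close> for \<open>v > 1\<close>. By dominated
  convergence \<open>K\<^bsub>n\<^esub>(s / ln n) - ln (1 + ln n)\<close> tends to the integral of \<open>(exp (s v) - 1) / v\<close> over
  \<open>{0<..<1}\<close>, which is the power series of the theorem, plus the integral of
  \<open>(1\<^bsub>v<1\<^esub> - exp (-v)) / v\<close> over \<open>v > 0\<close>, which is the Euler constant (\<open>log_mgf_limit\<close>,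
  \<open>euler_integral\<close>).

  So the moment generating functions of the scaled gaps converge on the whole real line. For
  distributions on the half line this yields a weak limit with the limiting moment generating
  function (\<open>mgf_convergence\<close>): exponential moments give tightness, truncation carries them to
  weak limits, and the values at the negative integers determine the limit, because polynomials in
  \<open>exp (-x)\<close> are dense in the continuous functions of \<open>exp (-x)\<close>.\<close>

section \<open>Thinning of point sets listed by their gaps\<close>

text \<open>A point set on the half line is handled through the stream of its gaps.\<close>

definition psum :: "real stream \<Rightarrow> nat \<Rightarrow> real" where
  "psum X k = (\<Sum>i<k. X !! i)"

lemma psum_0 [simp]: "psum X 0 = 0"
  by (simp add: psum_def)

lemma psum_Stream_Suc [simp]: "psum (x ## X) (Suc k) = x + psum X k"
  unfolding psum_def by (subst sum.lessThan_Suc_shift) simp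

lemma psum_sdrop: "psum (sdrop m X) k = psum X (m + k) - psum X m"
  unfolding psum_def by (induction k) (simp_all add: sdrop_snth)

lemma psum_Suc: "psum X (Suc k) = psum X k + X !! k"
  by (simp add: psum_def)

lemma psum_strict_mono:
  assumes "\<And>j. 0 < X !! j" "i < k"
  shows "psum X i < psum X k"
  using assms(2) by (induction rule: less_Suc_induct) (auto simp: psum_Suc assms(1))

lemma psum_mono:
  assumes "\<And>j. 0 < X !! j" "i \<le> k"
  shows "psum X i \<le> psum X k"
  using psum_strict_mono[of X i k] assms by (cases "i = k") auto

text \<open>If arrivals have waiting times \<open>E\<close>, then \<open>residual s E\<close> lists the waiting times seen by an
  observer who starts at time \<open>s\<close>.\<close>
definition residual :: "real \<Rightarrow> real stream \<Rightarrow> real stream" where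
  "residual s E = (let k = LEAST k. s < psum E (Suc k) in (psum E (Suc k) - s) ## sdrop (Suc k) E)"

text \<open>Let \<open>X\<close> be the gaps of the points to be thinned and \<open>E\<close> the waiting times of the arrivals,
  both seen from a common base time. The first point that is kept is the first one with an arrival
  before it; after that point both streams are looked at afresh.\<close>
definition first_hit :: "real stream \<times> real stream \<Rightarrow> nat" where
  "first_hit p = (LEAST j. shd (snd p) \<le> psum (fst p) (Suc j))"

definition thin_gap :: "real stream \<times> real stream \<Rightarrow> real" where
  "thin_gap p = psum (fst p) (Suc (first_hit p))"

definition thin_step :: "real stream \<times> real stream \<Rightarrow> real stream \<times> real stream" where
  "thin_step p = (sdrop (Suc (first_hit p)) (fst p), residual (thin_gap p) (snd p))"

definition thin_gaps :: "real stream \<times> real stream \<Rightarrow> real stream" where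
  "thin_gaps p = smap thin_gap (siterate thin_step p)"

definition renewing :: "real stream \<Rightarrow> bool" where
  "renewing X \<longleftrightarrow> (\<forall>j. 0 < X !! j) \<and> (\<forall>c. \<exists>k. c < psum X k)"

text \<open>Points are listed after a base time \<open>r\<close>, because the thinning below restarts
  at each point that it keeps.\<close>
definition has_gaps :: "real set \<Rightarrow> real \<Rightarrow> real stream \<Rightarrow> bool" where
  "has_gaps B r X \<longleftrightarrow> renewing X \<and>
     B \<inter> {r<..} = range (\<lambda>j. r + psum X (Suc j))"

definition thinned :: "real set \<Rightarrow> real set \<Rightarrow> real set" where
  "thinned A B = {t \<in> B. \<exists>u\<in>A. u < t \<and> (\<forall>v\<in>B. v < t \<longrightarrow> v < u)}"

lemma has_gaps_sdrop:
  assumes "has_gaps B r X"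
  shows "has_gaps B (r + psum X m) (sdrop m X)"
proof -
  have pos: "\<And>j. 0 < X !! j" and unb: "\<And>c. \<exists>k. c < psum X k"
    and B: "B \<inter> {r<..} = range (\<lambda>j. r + psum X (Suc j))"
    using assms by (auto simp: has_gaps_def renewing_def)
  have "\<exists>k. c < psum (sdrop m X) k" for c
  proof -
    obtain k where "c + psum X m < psum X k" using unb by blast
    moreover have "psum X k \<le> psum X (m + k)" by (rule psum_mono[OF pos]) simp
    ultimately show ?thesis by (intro exI[of _ k]) (simp add: psum_sdrop)
  qed
  moreover have "B \<inter> {r + psum X m<..} = range (\<lambda>j. r + psum X m + psum (sdrop m X) (Suc j))"
  proof (rule set_eqI)
    fix t
    have m0: "0 \<le> psum X m" using psum_mono[OF pos, of 0 m] by simp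
    have "t \<in> B \<inter> {r + psum X m<..} \<longleftrightarrow> t \<in> B \<inter> {r<..} \<and> r + psum X m < t"
      using m0 by auto
    also have "\<dots> \<longleftrightarrow> (\<exists>j. t = r + psum X (Suc j) \<and> psum X m < psum X (Suc j))"
      unfolding B by auto
    also have "\<dots> \<longleftrightarrow> (\<exists>j. t = r + psum X (Suc j) \<and> m \<le> j)"
      using psum_strict_mono[OF pos] psum_mono[OF pos]
      by (metis less_Suc_eq_le not_le)
    also have "\<dots> \<longleftrightarrow> (\<exists>j. t = r + psum X (Suc (m + j)))"
      by (metis le_add1 le_Suc_ex)
    finally show "t \<in> B \<inter> {r + psum X m<..} \<longleftrightarrow>
        t \<in> range (\<lambda>j. r + psum X m + psum (sdrop m X) (Suc j))"
      by (auto simp: psum_sdrop)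
  qed
  ultimately show ?thesis
    using pos by (auto simp: has_gaps_def renewing_def sdrop_snth)
qed

lemma has_gaps_residual:
  assumes E: "has_gaps A r E" and s: "0 \<le> s"
  shows "has_gaps A (r + s) (residual s E)"
proof -
  have pos: "\<And>j. 0 < E !! j" and unb: "\<And>c. \<exists>k. c < psum E k"
    and A: "A \<inter> {r<..} = range (\<lambda>j. r + psum E (Suc j))"
    using E by (auto simp: has_gaps_def renewing_def)
  define k where "k = (LEAST k. s < psum E (Suc k))"
  have "\<exists>k. s < psum E (Suc k)"
    using unb[of s] psum_strict_mono[OF pos] by (meson lessI less_trans)
  then have k: "s < psum E (Suc k)"
    unfolding k_def by (rule LeastI_ex)
  have before: "psum E (Suc j) \<le> s" if "j < k" for j
    using not_less_Least[of j "\<lambda>k. s < psum E (Suc k)"] that by (auto simp: k_def)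
  have res: "residual s E = (psum E (Suc k) - s) ## sdrop (Suc k) E"
    by (simp add: residual_def k_def[symmetric])
  have sum: "psum (residual s E) (Suc j) = psum E (Suc (k + j)) - s" for j
    by (simp add: res psum_sdrop del: sdrop.simps)
  have "0 < residual s E !! j" for j
  proof (cases j)
    case 0
    then show ?thesis using k by (simp add: res)
  next
    case (Suc i)
    have "residual s E !! j = E !! (Suc k + i)"
      unfolding res Suc by (simp add: sdrop_snth del: sdrop.simps)
    then show ?thesis using pos by metis
  qed
  moreover have "\<exists>j. c < psum (residual s E) j" for c
  proof -
    obtain j where "c + s < psum E j" using unb by blast
    moreover have "psum E j \<le> psum E (Suc (k + j))" by (rule psum_mono[OF pos]) simp
    ultimately show ?thesis by (intro exI[of _ "Suc j"]) (simp add: sum)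
  qed
  moreover have "A \<inter> {r + s<..} = range (\<lambda>j. r + s + psum (residual s E) (Suc j))"
  proof (rule set_eqI)
    fix t
    have "t \<in> A \<inter> {r + s<..} \<longleftrightarrow> t \<in> A \<inter> {r<..} \<and> r + s < t"
      using s by auto
    also have "\<dots> \<longleftrightarrow> (\<exists>j. t = r + psum E (Suc j) \<and> s < psum E (Suc j))"
      unfolding A by auto
    also have "\<dots> \<longleftrightarrow> (\<exists>j. t = r + psum E (Suc j) \<and> k \<le> j)"
      using before k psum_mono[OF pos, of "Suc k"]
      by (metis Suc_le_mono less_le_trans not_le)
    also have "\<dots> \<longleftrightarrow> (\<exists>j. t = r + psum E (Suc (k + j)))"
      by (metis le_add1 le_Suc_ex)
    finally show "t \<in> A \<inter> {r + s<..} \<longleftrightarrow> t \<in> range (\<lambda>j. r + s + psum (residual s E) (Suc j))"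
      by (auto simp: sum)
  qed
  ultimately show ?thesis
    by (auto simp: has_gaps_def renewing_def)
qed

text \<open>The base time is a point of \<open>B\<close> or \<open>0\<close>, so an arrival after it lies in a later interval of
  \<open>B\<close>. All intervals that end before the first arrival are empty of arrivals, and the first one
  that ends after it contains it. Disjointness excludes that both coincide.\<close>
lemma thin_step_gaps:
  assumes X: "has_gaps B r X" and E: "has_gaps A r E"
    and r: "r = 0 \<or> r \<in> B" "A \<subseteq> {0<..}" "B \<subseteq> {0<..}" and disj: "A \<inter> B = {}"
  defines "g \<equiv> thin_gap (X, E)"
  shows "0 < g" "thinned A B \<inter> {r<..r + g} = {r + g}" "r + g \<in> B"
    "has_gaps B (r + g) (fst (thin_step (X, E)))" "has_gaps A (r + g) (snd (thin_step (X, E)))"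
    "\<exists>m\<ge>1. fst (thin_step (X, E)) = sdrop m X \<and> g = psum X m"
proof -
  define J where "J = first_hit (X, E)"
  have pos: "\<And>j. 0 < X !! j" and unb: "\<And>c. \<exists>k. c < psum X k"
    and B: "B \<inter> {r<..} = range (\<lambda>j. r + psum X (Suc j))"
    using X by (auto simp: has_gaps_def renewing_def)
  have posE: "\<And>j. 0 < E !! j" and A: "A \<inter> {r<..} = range (\<lambda>j. r + psum E (Suc j))"
    using E by (auto simp: has_gaps_def renewing_def)
  have g: "g = psum X (Suc J)"
    by (simp add: g_def thin_gap_def J_def)
  have "\<exists>j. shd E \<le> psum X (Suc j)"
    using unb[of "shd E"] psum_strict_mono[OF pos] by (meson lessI less_imp_le less_trans)
  then have J: "shd E \<le> psum X (Suc J)"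
    unfolding J_def first_hit_def by simp (rule LeastI_ex)
  have before: "psum X (Suc j) < shd E" if "j < J" for j
    using not_less_Least[of j "\<lambda>j. shd E \<le> psum X (Suc j)"] that
    by (auto simp: J_def first_hit_def)
  show g0: "0 < g"
    using psum_strict_mono[OF pos, of 0 "Suc J"] by (simp add: g)
  have rg: "r + psum X (Suc j) \<in> B" for j
    using B by blast
  then show "r + g \<in> B"
    by (simp add: g)
  show "has_gaps B (r + g) (fst (thin_step (X, E)))"
    using has_gaps_sdrop[OF X, of "Suc J"] by (simp add: thin_step_def g J_def)
  show "has_gaps A (r + g) (snd (thin_step (X, E)))"
    using has_gaps_residual[OF E, of g] g0 by (simp add: thin_step_def g_def)
  show "\<exists>m\<ge>1. fst (thin_step (X, E)) = sdrop m X \<and> g = psum X m"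
    by (intro exI[of _ "Suc J"]) (simp add: thin_step_def g J_def del: sdrop.simps)
  have shd: "psum E (Suc 0) = shd E"
    by (simp add: psum_def)
  have Afirst: "r + shd E \<in> A" "\<And>u. u \<in> A \<Longrightarrow> r < u \<Longrightarrow> r + shd E \<le> u"
  proof -
    show "r + shd E \<in> A"
      using A shd by (metis IntD1 rangeI)
    fix u assume "u \<in> A" "r < u"
    then obtain j where "u = r + psum E (Suc j)" using A by blast
    then show "r + shd E \<le> u"
      using psum_mono[OF posE, of "Suc 0" "Suc j"] shd by simp
  qed
  have r0: "0 \<le> r" using r by auto
  have "t \<in> thinned A B \<longleftrightarrow> t = r + g" if t: "r < t" "t \<le> r + g" for t
  proof
    assume tt: "t \<in> thinned A B"
    then obtain u where u: "u \<in> A" "u < t" "\<And>v. v \<in> B \<Longrightarrow> v < t \<Longrightarrow> v < u" and tB: "t \<in> B"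
      by (auto simp: thinned_def)
    have "r < u"
      using u(3)[of r] r t u(1) by auto
    then have "r + shd E < t"
      using Afirst(2) u by fastforce
    moreover obtain j where j: "t = r + psum X (Suc j)"
      using tB t B by blast
    ultimately have "\<not> j < J"
      using before[of j] by auto
    then have "psum X (Suc J) \<le> psum X (Suc j)"
      by (intro psum_mono[OF pos]) simp
    then show "t = r + g"
      using t j g by simp
  next
    assume t: "t = r + g"
    have "r + shd E \<noteq> r + g"
      using Afirst(1) \<open>r + g \<in> B\<close> disj by auto
    then have "r + shd E < t"
      using J t g by simp
    moreover have "v < r + shd E" if v: "v \<in> B" "v < t" for v
    proof (cases "r < v")
      case True
      then obtain j where j: "v = r + psum X (Suc j)"
        using v B by blast
      then have "j < J"
        using v t g psum_mono[OF pos, of "Suc J" "Suc j"] by (auto simp: not_less intro: leI)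
      then show ?thesis
        using before j by simp
    next
      case False
      then show ?thesis using posE[of 0] by simp
    qed
    ultimately show "t \<in> thinned A B"
      unfolding thinned_def using Afirst(1) t \<open>r + g \<in> B\<close>
      by (intro CollectI conjI bexI[of _ "r + shd E"]) auto
  qed
  then show "thinned A B \<inter> {r<..r + g} = {r + g}"
    using g0 by auto
qed

lemma thin_gaps_Stream: "thin_gaps p = thin_gap p ## thin_gaps (thin_step p)"
  by (subst thin_gaps_def, subst siterate.ctr) (simp add: thin_gaps_def)

text \<open>Each step drops at least one gap of \<open>X\<close>; hence the points that are kept are still unbounded,
  and every point of the thinned set is met after finitely many steps.\<close>
lemma thin_gaps_has_gaps:
  assumes X: "has_gaps B 0 X" and E: "has_gaps A 0 E"
    and sub: "A \<subseteq> {0<..}" "B \<subseteq> {0<..}" and disj: "A \<inter> B = {}"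
  shows "has_gaps (thinned A B) 0 (thin_gaps (X, E))"
proof -
  define st where "st k = (thin_step ^^ k) (X, E)" for k
  define r where "r k = psum (thin_gaps (X, E)) k" for k
  have snth: "thin_gaps (X, E) !! k = thin_gap (st k)" for k
    by (simp add: thin_gaps_def st_def)
  have r_Suc: "r (Suc k) = r k + thin_gap (st k)" for k
    by (simp add: r_def psum_Suc snth)
  have st_Suc: "st (Suc k) = thin_step (st k)" for k
    by (simp add: st_def)
  have pos: "\<And>j. 0 < X !! j" and unb: "\<And>c. \<exists>k. c < psum X k"
    using X by (auto simp: has_gaps_def renewing_def)
  have inv: "has_gaps B (r k) (fst (st k)) \<and> has_gaps A (r k) (snd (st k)) \<and>
      (r k = 0 \<or> r k \<in> B) \<and> (\<exists>m\<ge>k. fst (st k) = sdrop m X \<and> r k = psum X m)" for k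
  proof (induction k)
    case 0
    have "fst (st 0) = sdrop 0 X \<and> r 0 = psum X 0" by (simp add: st_def r_def)
    then show ?case using X E by (intro conjI exI[of _ 0]) (simp_all add: st_def r_def)
  next
    case (Suc k)
    then obtain m where m: "k \<le> m" "fst (st k) = sdrop m X" "r k = psum X m" by auto
    note step = thin_step_gaps[of B "r k" "fst (st k)" A "snd (st k)", simplified,
        folded st_Suc r_Suc]
    from step(6) Suc sub disj obtain m' where m': "m' \<ge> 1"
      "fst (st (Suc k)) = sdrop m' (fst (st k))" "thin_gap (st k) = psum (fst (st k)) m'"
      by auto
    have "m + m' \<ge> Suc k" "fst (st (Suc k)) = sdrop (m + m') X" "r (Suc k) = psum X (m + m')"
      using m m' by (auto simp: psum_sdrop r_Suc)
    then show ?case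
      using step(3-5) Suc sub disj by blast
  qed
  have step: "0 < thin_gap (st k)" "thinned A B \<inter> {r k<..r (Suc k)} = {r (Suc k)}" for k
    using thin_step_gaps(1,2)[of B "r k" "fst (st k)" A "snd (st k)"] inv[of k] sub disj
    by (auto simp: r_Suc)
  have unb': "\<exists>k. c < r k" for c
  proof -
    obtain k where k: "c < psum X k" using unb by blast
    obtain m where "k \<le> m" "r k = psum X m" using inv[of k] by blast
    then show ?thesis using k psum_mono[OF pos, of k m] by (intro exI[of _ k]) simp
  qed
  have "thinned A B \<inter> {0<..} = range (\<lambda>j. r (Suc j))"
  proof (intro set_eqI iffI)
    fix t assume t: "t \<in> thinned A B \<inter> {0<..}"
    define k where "k = (LEAST k. t \<le> r k)"
    have "\<exists>k. t \<le> r k"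
      using unb'[of t] by (blast intro: less_imp_le)
    then have k: "t \<le> r k"
      unfolding k_def by (rule LeastI_ex)
    moreover have "k \<noteq> 0"
      using k t by (cases k) (auto simp: r_def)
    then obtain j where j: "k = Suc j" by (cases k) auto
    have "r j < t"
      using not_less_Least[of j "\<lambda>k. t \<le> r k"] j by (auto simp: k_def)
    then have "t \<in> thinned A B \<inter> {r j<..r (Suc j)}"
      using k j t by simp
    then have "t = r (Suc j)"
      unfolding step(2) by simp
    then show "t \<in> range (\<lambda>j. r (Suc j))" by blast
  next
    fix t assume "t \<in> range (\<lambda>j. r (Suc j))"
    then obtain j where j: "t = r (Suc j)" by blast
    then have t: "t \<in> thinned A B" using step(2)[of j] by blast
    then have "t \<in> B" by (simp add: thinned_def)
    then show "t \<in> thinned A B \<inter> {0<..}" using sub t by auto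
  qed
  then show ?thesis
    using step(1) unb' by (auto simp: has_gaps_def renewing_def snth r_def)
qed

lemma nth_time_has_gaps:
  assumes "has_gaps B 0 X"
  shows "nth_time B i = psum X i"
proof (induction i)
  case (Suc i)
  have pos: "\<And>j. 0 < X !! j" and B: "B \<inter> {0<..} = range (\<lambda>j. psum X (Suc j))"
    using assms by (auto simp: has_gaps_def renewing_def)
  have i0: "0 \<le> psum X i" using psum_mono[OF pos, of 0 i] by simp
  have "Inf {t \<in> B. psum X i < t} = psum X (Suc i)"
  proof (rule cInf_eq_minimum)
    have "psum X (Suc i) \<in> B" using B by blast
    then show "psum X (Suc i) \<in> {t \<in> B. psum X i < t}"
      using pos[of i] by (simp add: psum_Suc)
    fix t assume t: "t \<in> {t \<in> B. psum X i < t}"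
    then have "t \<in> B \<inter> {0<..}" using i0 by auto
    then obtain j where j: "t = psum X (Suc j)" using B by auto
    then have "i < Suc j"
      using t psum_mono[OF pos, of "Suc j" i] by (auto simp: not_less intro: leI)
    then show "psum X (Suc i) \<le> t"
      using j by (auto intro!: psum_mono[OF pos])
  qed
  then show ?case by (simp add: Suc)
qed simp

section \<open>The paths of the forest fire\<close>

context
  fixes A :: "nat \<Rightarrow> real set" and h :: "real \<Rightarrow> nat \<Rightarrow> bool"
  assumes path: "forest_fire_path A h"
begin

lemma initially_vacant: "\<not> h 0 x"
  and right_cont: "t \<ge> 0 \<Longrightarrow> \<forall>\<^sub>F s in at_right t. h s x = h t x"
  and left_lim: "t > 0 \<Longrightarrow> \<forall>\<^sub>F s in at_left t. h s x = left_state h t x"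
  and no_arrival: "t > 0 \<Longrightarrow> (\<And>y. t \<notin> A y) \<Longrightarrow> h t = left_state h t"
  and arrival: "t > 0 \<Longrightarrow> t \<in> A y \<Longrightarrow> h t = arrival_update y (left_state h t)"
  using path by (auto simp: forest_fire_path_def)

lemma left_state_eqI:
  assumes "a < t" "t > 0" "\<And>s. a \<le> s \<Longrightarrow> s < t \<Longrightarrow> h s x = b"
  shows "left_state h t x = b"
proof -
  have "\<forall>\<^sub>F s in at_left t. h s x = b"
    unfolding eventually_at_left[OF \<open>a < t\<close>] using assms by (auto intro!: exI[of _ a])
  then have "\<forall>\<^sub>F s in at_left t. left_state h t x = b"
    using left_lim[OF \<open>t > 0\<close>, of x] by eventually_elim auto
  then show ?thesis
    by (simp add: eventually_const)
qed

text \<open>A site can leave the state \<open>b\<close> only through a jump, since its path is right continuous.\<close>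
lemma state_persists:
  assumes "0 \<le> a" "a \<le> t" "h a x = b"
    and jump: "\<And>v. a < v \<Longrightarrow> v \<le> t \<Longrightarrow> left_state h v x = b \<Longrightarrow> h v x = b"
  shows "h t x = b"
proof (rule ccontr)
  assume neq: "h t x \<noteq> b"
  define S where "S = {v. a \<le> v \<and> v \<le> t \<and> h v x \<noteq> b}"
  define w where "w = Inf S"
  have S: "t \<in> S" "bdd_below S" using assms neq by (auto simp: S_def)
  have w: "a \<le> w" "w \<le> t"
    using S by (auto simp: w_def S_def intro!: cInf_greatest cInf_lower)
  have before: "h v x = b" if "a \<le> v" "v < w" for v
    using that w S cInf_lower[of v S] by (force simp: S_def w_def)
  have hw: "h w x = b"
  proof (cases "a = w")
    case False
    then have "a < w" using w by simp
    then show ?thesis using jump[of w] left_state_eqI[of a w x b] before w assms by auto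
  qed (use assms in auto)
  then have "w < t" using neq w by (cases "w = t") auto
  have "\<forall>\<^sub>F s in at_right w. h s x = b"
    using right_cont[of w x] w assms hw by simp
  then obtain c where c: "w < c" "\<And>s. w < s \<Longrightarrow> s < c \<Longrightarrow> h s x = b"
    by (auto simp: eventually_at_right[OF \<open>w < t\<close>])
  have "c \<le> w"
    unfolding w_def
  proof (rule cInf_greatest)
    show "S \<noteq> {}" using S by auto
    fix v assume v: "v \<in> S"
    then have "w \<le> v" using S by (auto simp: w_def intro: cInf_lower)
    moreover have "h v x \<noteq> b" using v by (simp add: S_def)
    ultimately show "c \<le> v"
      using c(2)[of v] hw by (cases "v = w") (auto simp: not_less[symmetric])
  qed
  then show False using c by simp
qed

text \<open>An arrival at \<open>0\<close> burns \<open>0\<close> in the same instant, and other arrivals do not occupy it.\<close>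
lemma site0_vacant: "0 \<le> t \<Longrightarrow> \<not> h t 0"
proof -
  assume t: "0 \<le> t"
  have "h t 0 = False"
  proof (rule state_persists[of 0])
    fix v :: real assume v: "0 < v" "left_state h v 0 = False"
    show "h v 0 = False"
    proof (cases "\<exists>y. v \<in> A y")
      case True
      then show ?thesis
        using arrival[OF v(1)] by (auto simp: arrival_update_def burn_def cluster0_def)
    next
      case False
      then show ?thesis using no_arrival[OF v(1)] v by metis
    qed
  qed (use t initially_vacant in auto)
  then show ?thesis by simp
qed

lemma left_state0: "0 < t \<Longrightarrow> \<not> left_state h t 0"
  using left_state_eqI[of 0 t 0 False] site0_vacant by auto

context
  assumes disj: "\<And>y z. y \<noteq> z \<Longrightarrow> A y \<inter> A z = {}" and pos: "\<And>y. A y \<subseteq> {0<..}"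
begin

lemma burn_times_alt: "burn_times A h n = {t \<in> A 0. \<forall>y\<in>{1..n}. left_state h t y}"
proof -
  have "t \<in> burn_times A h n \<longleftrightarrow> t \<in> A 0 \<and> (\<forall>y\<in>{1..n}. left_state h t y)" for t
  proof (cases "t \<in> A 0")
    case True
    then have "0 < t" using pos by auto
    moreover have "n \<in> cluster0 ((left_state h t)(0 := True)) \<longleftrightarrow> (\<forall>y\<in>{1..n}. left_state h t y)"
      by (auto simp: cluster0_def Suc_le_eq)
    ultimately show ?thesis using True left_state0 by (auto simp: burn_times_def)
  qed (auto simp: burn_times_def)
  then show ?thesis by blast
qed

lemma burn_times_0: "burn_times A h 0 = A 0"
  by (auto simp: burn_times_alt)

lemma burn_times_Suc:
  "burn_times A h (Suc n) = {t \<in> burn_times A h n. left_state h t (Suc n)}"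
proof -
  have "{1..Suc n} = insert (Suc n) {1..n}" by auto
  then show ?thesis by (auto simp: burn_times_alt)
qed

lemma state_at_ignition:
  assumes "t \<in> A 0"
  shows "h t x \<longleftrightarrow> left_state h t x \<and> t \<notin> burn_times A h x"
proof -
  have t: "0 < t" using assms pos by auto
  have "x \<in> cluster0 ((left_state h t)(0 := True)) \<longleftrightarrow> t \<in> burn_times A h x"
    using assms t left_state0[OF t] by (simp add: burn_times_def)
  then show ?thesis
    using arrival[OF t assms] left_state0[OF t]
    by (cases "x = 0") (auto simp: arrival_update_def burn_def burn_times_0 assms)
qed

lemma state_no_ignition:
  assumes "0 < t" "t \<notin> A 0"
  shows "h t x \<longleftrightarrow> left_state h t x \<or> t \<in> A x"
proof (cases "\<exists>y. t \<in> A y")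
  case True
  then obtain y where y: "t \<in> A y" by blast
  then have "y \<noteq> 0" using assms by metis
  then have "cluster0 ((left_state h t)(y := True)) = {}"
    using left_state0[OF assms(1)] by (auto simp: cluster0_def intro!: exI[of _ 0])
  then have "h t x \<longleftrightarrow> x = y \<or> left_state h t x"
    using arrival[OF assms(1) y] by (auto simp: arrival_update_def burn_def)
  moreover have "t \<in> A x \<longleftrightarrow> x = y" using disj y by (metis disjoint_iff)
  ultimately show ?thesis by auto
next
  case False
  then show ?thesis using no_arrival[OF assms(1)] by auto
qed

text \<open>A fire that reaches \<open>n\<close> leaves \<open>Suc n\<close> vacant, whether it was occupied or not. So at the
  next fire at \<open>n\<close> it is occupied exactly if it had an arrival since.\<close>
lemma occupied_iff_arrival_since:
  assumes r: "r = 0 \<or> r \<in> burn_times A h n" and t: "r < t" "t \<in> burn_times A h n"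
    and none: "burn_times A h n \<inter> {r<..<t} = {}"
  shows "left_state h t (Suc n) \<longleftrightarrow> (\<exists>u\<in>A (Suc n). r < u \<and> u < t)"
proof -
  have r0: "0 \<le> r"
    using r pos[of 0] by (auto simp: burn_times_alt)
  have vac: "\<not> h r (Suc n)"
  proof (cases "r = 0")
    case False
    then have "r \<in> burn_times A h n" using r by simp
    moreover from this have "r \<in> A 0" by (simp add: burn_times_alt)
    ultimately show ?thesis
      using state_at_ignition[of r "Suc n"] by (simp add: burn_times_Suc)
  qed (use initially_vacant in auto)
  have jump: "h v (Suc n) \<longleftrightarrow> left_state h v (Suc n) \<or> v \<in> A (Suc n)" if v: "r < v" "v < t" for v
  proof (cases "v \<in> A 0")
    case True
    then have "v \<notin> burn_times A h (Suc n)" using none v by (auto simp: burn_times_Suc)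
    moreover have "v \<notin> A (Suc n)" using True disj[of 0 "Suc n"] by auto
    ultimately show ?thesis using state_at_ignition[OF True] by auto
  next
    case False
    then show ?thesis using state_no_ignition[of v "Suc n"] v r0 by auto
  qed
  show ?thesis
  proof (cases "\<exists>u\<in>A (Suc n). r < u \<and> u < t")
    case True
    then obtain u where u: "u \<in> A (Suc n)" "r < u" "u < t" by blast
    have "h s (Suc n) = True" if "u \<le> s" "s < t" for s
    proof (cases "s = u")
      case True
      then show ?thesis using jump u by simp
    next
      case False
      show ?thesis
        by (rule state_persists[of u]) (use u r0 jump that in auto)
    qed
    then have "left_state h t (Suc n) = True"
      using u r0 by (intro left_state_eqI[of u]) auto
    then show ?thesis using True by simp
  next
    case False
    have "h s (Suc n) = False" if "r \<le> s" "s < t" for s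
      by (rule state_persists[of r]) (use r0 vac jump that False in auto)
    then have "left_state h t (Suc n) = False"
      using t r0 by (intro left_state_eqI[of r]) auto
    then show ?thesis using False by simp
  qed
qed

lemma burn_times_thinned:
  assumes X: "has_gaps (burn_times A h n) 0 X"
  shows "burn_times A h (Suc n) = thinned (A (Suc n)) (burn_times A h n)"
proof -
  let ?B = "burn_times A h n"
  have posX: "\<And>j. 0 < X !! j" and B: "?B \<inter> {0<..} = range (\<lambda>j. psum X (Suc j))"
    using X by (auto simp: has_gaps_def renewing_def)
  have B0: "?B \<subseteq> {0<..}" using pos by (auto simp: burn_times_alt)
  have "left_state h t (Suc n) \<longleftrightarrow> (\<exists>u\<in>A (Suc n). u < t \<and> (\<forall>v\<in>?B. v < t \<longrightarrow> v < u))"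
    if t: "t \<in> ?B" for t
  proof -
    have "t \<in> ?B \<inter> {0<..}" using t B0 by auto
    then obtain j where j: "t = psum X (Suc j)" using B by auto
    let ?r = "psum X j"
    have r: "?r = 0 \<or> ?r \<in> ?B"
      using B by (cases j) auto
    have rt: "?r < t" using j posX[of j] by (simp add: psum_Suc)
    have le: "v \<le> ?r" if v: "v \<in> ?B" "v < t" for v
    proof -
      obtain i where i: "v = psum X (Suc i)" using v B B0 by blast
      then have "Suc i \<le> j"
        using v j psum_mono[OF posX, of "Suc j" "Suc i"] by (auto simp: not_less intro: leI)
      then show ?thesis using i psum_mono[OF posX] by simp
    qed
    then have "left_state h t (Suc n) \<longleftrightarrow> (\<exists>u\<in>A (Suc n). ?r < u \<and> u < t)"
      using r rt t by (intro occupied_iff_arrival_since) fastforce+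
    also have "\<dots> \<longleftrightarrow> (\<exists>u\<in>A (Suc n). u < t \<and> (\<forall>v\<in>?B. v < t \<longrightarrow> v < u))"
      using le r rt pos by fastforce
    finally show ?thesis .
  qed
  then show ?thesis by (auto simp: burn_times_Suc thinned_def)
qed

lemma burn_times_has_gaps_Suc:
  assumes "has_gaps (burn_times A h n) 0 X" "has_gaps (A (Suc n)) 0 E"
  shows "has_gaps (burn_times A h (Suc n)) 0 (thin_gaps (X, E))"
proof -
  have "A (Suc n) \<inter> burn_times A h n = {}"
    using disj[of 0 "Suc n"] by (auto simp: burn_times_alt)
  moreover have "burn_times A h n \<subseteq> {0<..}"
    using pos by (auto simp: burn_times_alt)
  ultimately show ?thesis
    using assms pos burn_times_thinned[OF assms(1)] by (auto intro!: thin_gaps_has_gaps)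
qed

end
end

section \<open>Memorylessness of exponential waiting times\<close>

definition expM :: "real measure" where
  "expM = density lborel (exponential_density 1)"

lemma sets_expM [measurable_cong, simp]: "sets expM = sets borel"
  by (simp add: expM_def)

lemma space_expM [simp]: "space expM = UNIV"
  by (simp add: expM_def)

lemma prob_space_expM: "prob_space expM"
  unfolding expM_def by (rule prob_space_exponential_density) simp

lemma AE_expM_pos: "AE x in expM. 0 < x"
proof -
  have "AE x in lborel. x \<noteq> (0::real)"
    by (rule AE_lborel_singleton)
  then show ?thesis
    unfolding expM_def by (subst AE_density) (auto simp: exponential_density_def elim!: eventually_mono)
qed

lemma nn_integral_expM:
  assumes [measurable]: "F \<in> borel_measurable borel"
  shows "(\<integral>\<^sup>+x. F x \<partial>expM) = (\<integral>\<^sup>+x. ennreal (exponential_density 1 x) * F x \<partial>lborel)"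
  unfolding expM_def by (subst nn_integral_density) auto

text \<open>Memorylessness: a shift by \<open>s\<close> multiplies the exponential density by \<open>exp (-s)\<close>, and the
  boundary point \<open>s\<close> is a null set.\<close>
lemma expM_shift:
  assumes [measurable]: "F \<in> borel_measurable borel" and s: "0 \<le> s"
  shows "(\<integral>\<^sup>+x. indicator {s<..} x * F (x - s) \<partial>expM) = ennreal (exp (-s)) * (\<integral>\<^sup>+x. F x \<partial>expM)"
proof -
  have "(\<integral>\<^sup>+x. indicator {s<..} x * F (x - s) \<partial>expM) =
      (\<integral>\<^sup>+x. ennreal (exponential_density 1 x) * (indicator {s<..} x * F (x - s)) \<partial>lborel)"
    by (rule nn_integral_expM) measurable
  also have "\<dots> = (\<integral>\<^sup>+x. ennreal (exponential_density 1 (s + x)) * (indicator {s<..} (s + x) * F x) \<partial>lborel)"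
    by (subst nn_integral_real_affine[where c=1 and t=s]) simp_all
  also have "\<dots> = (\<integral>\<^sup>+x. ennreal (exp (-s)) * (ennreal (exponential_density 1 x) * F x) \<partial>lborel)"
  proof (rule nn_integral_cong_AE)
    have "AE x in lborel. x \<noteq> (0::real)"
      by (rule AE_lborel_singleton)
    then show "AE x in lborel. ennreal (exponential_density 1 (s + x)) * (indicator {s<..} (s + x) * F x) =
        ennreal (exp (-s)) * (ennreal (exponential_density 1 x) * F x)"
    proof eventually_elim
      case (elim x)
      show ?case
      proof (cases "x < 0")
        case False
        then have "exponential_density 1 (s + x) = exp (-s) * exponential_density 1 x"
          using s by (simp add: exponential_density_def exp_add[symmetric])
        then show ?thesis
          using False elim by (simp add: ennreal_mult mult.assoc)
      qed (simp add: exponential_density_def)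
    qed
  qed
  also have "\<dots> = ennreal (exp (-s)) * (\<integral>\<^sup>+x. F x \<partial>expM)"
    by (subst nn_integral_cmult) (simp_all add: nn_integral_expM)
  finally show ?thesis .
qed

lemma expM_le:
  assumes "0 \<le> s"
  shows "(\<integral>\<^sup>+x. indicator {..s} x \<partial>expM) = ennreal (1 - exp (-s))"
  using emeasure_erlang_density[of 1 0 s] assms
  by (simp add: expM_def erlang_CDF_0)

lemma measurable_psum [measurable]: "(\<lambda>X. psum X k) \<in> borel_measurable (stream_space borel)"
  unfolding psum_def by measurable

lemma measurable_first_hit [measurable]:
  "first_hit \<in> measurable (stream_space borel \<Otimes>\<^sub>M stream_space borel) (count_space UNIV)"
  unfolding first_hit_def by measurable

lemma measurable_thin_gap [measurable]:
  "thin_gap \<in> borel_measurable (stream_space borel \<Otimes>\<^sub>M stream_space borel)"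
  unfolding thin_gap_def
  by (rule measurable_compose_countable[where g=first_hit and f="\<lambda>j p. psum (fst p) (Suc j)"]) measurable

lemma measurable_residual [measurable]:
  "(\<lambda>p. residual (fst p) (snd p)) \<in> measurable (borel \<Otimes>\<^sub>M stream_space borel) (stream_space borel)"
proof -
  have eq: "(\<lambda>p. residual (fst p) (snd p)) =
      (\<lambda>p. (\<lambda>k p. (psum (snd p) (Suc k) - fst p) ## sdrop (Suc k) (snd p)) (LEAST k. fst p < psum (snd p) (Suc k)) p)"
    by (simp add: residual_def Let_def fun_eq_iff)
  show ?thesis
    unfolding eq by (rule measurable_compose_countable) measurable
qed

lemma measurable_thin_step [measurable]:
  "thin_step \<in> measurable (stream_space borel \<Otimes>\<^sub>M stream_space borel) (stream_space borel \<Otimes>\<^sub>M stream_space borel)"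
proof -
  have "(\<lambda>p. sdrop (Suc (first_hit p)) (fst p)) \<in>
      measurable (stream_space borel \<Otimes>\<^sub>M stream_space (borel :: real measure)) (stream_space borel)"
    by (rule measurable_compose_countable[where g=first_hit and f="\<lambda>j p. sdrop (Suc j) (fst p)"]) measurable
  moreover have "(\<lambda>p. residual (thin_gap p) (snd p)) \<in>
      measurable (stream_space borel \<Otimes>\<^sub>M stream_space borel) (stream_space borel)"
    using measurable_compose[OF _ measurable_residual, of "\<lambda>p. (thin_gap p, snd p)"] by simp
  ultimately show ?thesis
    unfolding thin_step_def by measurable
qed

text \<open>If \<open>a < 1\<close> is the mean of \<open>exp (-x)\<close>, then \<open>exp (- psum X k)\<close> has mean \<open>a ^ k\<close>. By Markov's
  inequality bounded partial sums have probability \<open>0\<close>.\<close>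
lemma AE_renewing:
  assumes P: "prob_space \<mu>" and [measurable_cong]: "sets \<mu> = sets borel" and pos: "AE x in \<mu>. 0 < x"
  shows "AE X in stream_space \<mu>. renewing X"
proof -
  interpret prob_space \<mu> by fact
  interpret S: prob_space "stream_space \<mu>" by (rule prob_space_stream_space)
  define a where "a = (\<integral>x. exp (-x) \<partial>\<mu>)"
  have int: "integrable \<mu> (\<lambda>x. exp (-x))"
    using pos by (intro integrable_const_bound[where B=1]) auto
  have "a < (\<integral>x. 1 \<partial>\<mu>)"
    unfolding a_def using int pos by (intro integral_less_AE_space) (auto simp: emeasure_space_1)
  then have a1: "a < 1" by (simp add: prob_space)
  have a0: "0 \<le> a" unfolding a_def by (intro integral_nonneg_AE) simp
  have na: "(\<integral>\<^sup>+x. ennreal (exp (-x)) \<partial>\<mu>) = ennreal a"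
    unfolding a_def using int by (intro nn_integral_eq_integral) auto
  have power: "(\<integral>\<^sup>+X. ennreal (exp (- psum X k)) \<partial>stream_space \<mu>) = ennreal (a ^ k)" for k
  proof (induction k)
    case 0
    then show ?case by (simp add: S.emeasure_space_1)
  next
    case (Suc k)
    have "(\<integral>\<^sup>+X. ennreal (exp (- psum X (Suc k))) \<partial>stream_space \<mu>) =
       (\<integral>\<^sup>+x. \<integral>\<^sup>+X. ennreal (exp (-x)) * ennreal (exp (- psum X k)) \<partial>stream_space \<mu> \<partial>\<mu>)"
      by (subst nn_integral_stream_space) (auto simp: exp_diff exp_minus divide_simps ennreal_mult[symmetric] intro!: nn_integral_cong)
    also have "\<dots> = ennreal (a ^ Suc k)"
      using a0 by (simp add: nn_integral_cmult nn_integral_multc Suc na ennreal_mult)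
    finally show ?case .
  qed
  have "AE X in stream_space \<mu>. \<exists>k. real c < psum X k" for c :: nat
  proof -
    have "S.prob {X \<in> space (stream_space \<mu>). \<forall>k. psum X k \<le> c} \<le> exp c * a ^ k" for k
    proof -
      have "emeasure (stream_space \<mu>) {X \<in> space (stream_space \<mu>). \<forall>k. psum X k \<le> c}
         \<le> (\<integral>\<^sup>+X. ennreal (exp c) * ennreal (exp (- psum X k)) \<partial>stream_space \<mu>)"
        by (subst nn_integral_indicator[symmetric], measurable, intro nn_integral_mono)
           (auto simp: indicator_def ennreal_mult[symmetric] exp_add[symmetric] simp del: ennreal_1 simp flip: ennreal_1)
      also have "\<dots> = ennreal (exp c * a ^ k)"
        using a0 by (simp add: nn_integral_cmult power ennreal_mult)
      finally show ?thesis
        using a0 by (simp add: S.emeasure_eq_measure)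
    qed
    moreover have "(\<lambda>k. exp c * a ^ k) \<longlonglongrightarrow> exp c * 0"
      using a0 a1 by (intro tendsto_mult tendsto_const LIMSEQ_realpow_zero)
    ultimately have "S.prob {X \<in> space (stream_space \<mu>). \<forall>k. psum X k \<le> c} \<le> 0"
      by (intro LIMSEQ_le_const[of "\<lambda>k. exp c * a ^ k"]) auto
    then have "S.prob {X \<in> space (stream_space \<mu>). \<forall>k. psum X k \<le> c} = 0"
      using measure_nonneg[of "stream_space \<mu>"] by (simp add: order.antisym)
    then have "AE X in stream_space \<mu>. \<not> (\<forall>k. psum X k \<le> c)"
      by (subst (asm) S.prob_eq_0) auto
    then show ?thesis
      by eventually_elim (auto simp: not_le)
  qed
  then have "AE X in stream_space \<mu>. \<forall>c::nat. \<exists>k. real c < psum X k"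
    by (simp add: AE_all_countable)
  moreover have "AE X in stream_space \<mu>. stream_all (\<lambda>x. 0 < x) X"
    by (rule AE_stream_all[OF _ pos]) measurable
  ultimately show ?thesis
  proof eventually_elim
    case (elim X)
    have "\<exists>k. c < psum X k" for c
      using elim(1) reals_Archimedean2[of c] by (meson less_trans)
    then show ?case using elim(2) by (simp add: renewing_def stream_all_def)
  qed
qed

lemma residual_first: "s < shd E \<Longrightarrow> residual s E = (shd E - s) ## stl E"
proof -
  assume "s < shd E"
  then have "(LEAST k. s < psum E (Suc k)) = 0"
    by (intro Least_equality) (auto simp: psum_def)
  then show ?thesis by (simp add: residual_def psum_def)
qed

text \<open>This restarts a thinning step after its first gap \<open>x\<close> has passed without an arrival.\<close>
lemma residual_residual:
  assumes "x < shd E"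
  shows "residual (x + s) E = residual s (residual x E)"
proof -
  have sum: "psum (residual x E) (Suc k) = psum E (Suc k) - x" for k
    using psum_Stream_Suc[of "shd E" "stl E" k] assms by (simp add: residual_first)
  have drop: "sdrop (Suc k) (residual x E) = sdrop (Suc k) E" for k
    using assms by (simp add: residual_first)
  have least: "(LEAST k. s < psum (residual x E) (Suc k)) = (LEAST k. x + s < psum E (Suc k))"
    unfolding sum by (simp add: less_diff_eq add.commute)
  show ?thesis
    unfolding residual_def[of s] residual_def[of "x + s"] Let_def least
    unfolding sum drop by simp
qed

lemma measurable_residual_raw [measurable (raw)]:
  assumes [measurable]: "f \<in> borel_measurable N" "g \<in> measurable N (stream_space borel)"
  shows "(\<lambda>x. residual (f x) (g x)) \<in> measurable N (stream_space borel)"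
  using measurable_compose[OF _ measurable_residual, of "\<lambda>x. (f x, g x)" N] by simp

lemma space_stream_borel [simp]: "space (stream_space (borel :: real measure)) = UNIV"
  by (simp add: space_stream_space)

text \<open>The first arrival after \<open>s\<close> has a random index \<open>k\<close>. The events \<open>crossing s E k\<close> separate its
  values, and on each of them the residual stream has the explicit form \<open>restart k s E\<close>.\<close>
definition crossing :: "real \<Rightarrow> real stream \<Rightarrow> nat \<Rightarrow> bool" where
  "crossing s E k \<longleftrightarrow> s < psum E (Suc k) \<and> (\<forall>i<k. \<not> s < psum E (Suc i))"

definition restart :: "nat \<Rightarrow> real \<Rightarrow> real stream \<Rightarrow> real stream" where
  "restart k s E = (psum E (Suc k) - s) ## sdrop (Suc k) E"

abbreviation expS :: "real stream measure" where
  "expS \<equiv> stream_space expM"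

interpretation expM: prob_space expM
  by (rule prob_space_expM)

interpretation expS: prob_space expS
  by (rule expM.prob_space_stream_space)

lemma measurable_crossing [measurable (raw)]:
  assumes [measurable]: "f \<in> borel_measurable N" "g \<in> measurable N (stream_space borel)"
  shows "Measurable.pred N (\<lambda>x. crossing (f x) (g x) k)"
  unfolding crossing_def by measurable

lemma measurable_restart [measurable (raw)]:
  assumes [measurable]: "f \<in> borel_measurable N" "g \<in> measurable N (stream_space borel)"
  shows "(\<lambda>x. restart k (f x) (g x)) \<in> measurable N (stream_space borel)"
  unfolding restart_def by measurable

lemma crossing_0: "crossing s (x ## E) 0 \<longleftrightarrow> s < x"
  by (simp add: crossing_def)

lemma crossing_Suc: "crossing s (x ## E) (Suc k) \<longleftrightarrow> x \<le> s \<and> crossing (s - x) E k"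
  unfolding crossing_def by (auto simp: less_Suc_eq_0_disj not_less algebra_simps)

lemma restart_0: "restart 0 s (x ## E) = (x - s) ## E"
  by (simp add: restart_def)

lemma restart_Suc: "restart (Suc k) s (x ## E) = restart k (s - x) E"
  by (simp add: restart_def)

lemma residual_crossing:
  assumes "crossing s E k"
  shows "residual s E = restart k s E"
proof -
  have "(LEAST k. s < psum E (Suc k)) = k"
    using assms by (intro Least_equality) (auto simp: crossing_def not_less[symmetric])
  then show ?thesis by (simp add: residual_def restart_def)
qed

lemma crossing_ex1:
  assumes "renewing E"
  shows "\<exists>!k. crossing s E k"
proof -
  obtain k where k: "s < psum E k" using assms by (auto simp: renewing_def)
  have "psum E k \<le> psum E (Suc k)"
    using assms by (intro psum_mono) (auto simp: renewing_def)
  then have ex: "\<exists>k. s < psum E (Suc k)" using k by (intro exI[of _ k]) simp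
  show ?thesis
  proof (rule ex1I)
    show "crossing s E (LEAST k. s < psum E (Suc k))"
      unfolding crossing_def using LeastI_ex[OF ex] not_less_Least by blast
    fix k assume k: "crossing s E k"
    show "k = (LEAST k. s < psum E (Suc k))"
      by (rule sym, rule Least_equality) (use k in \<open>auto simp: crossing_def not_less[symmetric]\<close>)
  qed
qed

definition crossing_integral :: "nat \<Rightarrow> real \<Rightarrow> (real stream \<Rightarrow> ennreal) \<Rightarrow> ennreal" where
  "crossing_integral k s h = (\<integral>\<^sup>+E. (if crossing s E k then h (restart k s E) else 0) \<partial>expS)"

lemma crossing_integral_0:
  assumes [measurable]: "h \<in> borel_measurable (stream_space borel)" and s: "0 \<le> s"
  shows "crossing_integral 0 s h = ennreal (exp (-s)) * (\<integral>\<^sup>+E. h E \<partial>expS)"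
proof -
  have "crossing_integral 0 s h =
      (\<integral>\<^sup>+x. \<integral>\<^sup>+E. (if s < x then h ((x - s) ## E) else 0) \<partial>expS \<partial>expM)"
    unfolding crossing_integral_def
    by (subst expM.nn_integral_stream_space) (simp_all add: crossing_0 restart_0 cong: if_cong)
  also have "\<dots> = (\<integral>\<^sup>+x. indicator {s<..} x * (\<integral>\<^sup>+E. h ((x - s) ## E) \<partial>expS) \<partial>expM)"
    by (intro nn_integral_cong) (auto simp: indicator_def)
  also have "\<dots> = ennreal (exp (-s)) * (\<integral>\<^sup>+x. \<integral>\<^sup>+E. h (x ## E) \<partial>expS \<partial>expM)"
    by (rule expM_shift[OF _ s]) measurable
  finally show ?thesis
    by (subst expM.nn_integral_stream_space) simp_all
qed

lemma crossing_integral_Suc: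
  assumes [measurable]: "h \<in> borel_measurable (stream_space borel)"
  shows "crossing_integral (Suc k) s h =
    (\<integral>\<^sup>+x. (if x \<le> s then crossing_integral k (s - x) h else 0) \<partial>expM)"
  unfolding crossing_integral_def
  by (subst expM.nn_integral_stream_space)
     (auto simp: crossing_Suc restart_Suc intro!: nn_integral_cong)

lemma measurable_crossing_integral [measurable]:
  assumes [measurable]: "h \<in> borel_measurable (stream_space borel)"
  shows "(\<lambda>s. crossing_integral k s h) \<in> borel_measurable borel"
  unfolding crossing_integral_def by measurable

text \<open>The residual stream is independent of the index \<open>k\<close> and has the law of \<open>E\<close>: for \<open>k = 0\<close> by
  memorylessness, and the first waiting time reduces \<open>Suc k\<close> to \<open>k\<close> with a smaller \<open>s\<close>.\<close>
lemma crossing_integral_factor: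
  assumes [measurable]: "h \<in> borel_measurable (stream_space borel)" and "0 \<le> s"
  shows "crossing_integral k s h = crossing_integral k s (\<lambda>_. 1) * (\<integral>\<^sup>+E. h E \<partial>expS)"
  using assms(2)
proof (induction k arbitrary: s)
  case 0
  then show ?case by (simp add: crossing_integral_0 expS.emeasure_space_1)
next
  case (Suc k)
  have "crossing_integral (Suc k) s h =
      (\<integral>\<^sup>+x. (if x \<le> s then crossing_integral k (s - x) (\<lambda>_. 1) else 0) * (\<integral>\<^sup>+E. h E \<partial>expS) \<partial>expM)"
    by (subst crossing_integral_Suc, simp, intro nn_integral_cong) (simp add: Suc.IH)
  also have "\<dots> = crossing_integral (Suc k) s (\<lambda>_. 1) * (\<integral>\<^sup>+E. h E \<partial>expS)"
    by (subst nn_integral_multc) (simp_all add: crossing_integral_Suc)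
  finally show ?case .
qed

text \<open>A Poisson process observed from time \<open>s\<close> is a Poisson process that is independent of
  whether an arrival occurred up to time \<open>s\<close>. The two cases are separate lemmas.\<close>
lemma residual_law_first:
  assumes [measurable]: "h \<in> borel_measurable (stream_space borel)" and s: "0 \<le> s"
  shows "(\<integral>\<^sup>+E. (if s < shd E then h (residual s E) else 0) \<partial>expS) =
    ennreal (exp (-s)) * (\<integral>\<^sup>+E. h E \<partial>expS)"
proof -
  have "crossing s E 0 \<longleftrightarrow> s < shd E" for E
    using crossing_0[of s "shd E" "stl E"] by simp
  then have "(\<integral>\<^sup>+E. (if s < shd E then h (residual s E) else 0) \<partial>expS) = crossing_integral 0 s h"
    unfolding crossing_integral_def by (intro nn_integral_cong) (auto simp: residual_crossing[of s _ 0])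
  then show ?thesis using s by (simp add: crossing_integral_0)
qed

lemma residual_law_later:
  assumes [measurable]: "h \<in> borel_measurable (stream_space borel)" and s: "0 \<le> s"
  shows "(\<integral>\<^sup>+E. (if shd E \<le> s then h (residual s E) else 0) \<partial>expS) =
    ennreal (1 - exp (-s)) * (\<integral>\<^sup>+E. h E \<partial>expS)"
proof -
  have sum: "(\<integral>\<^sup>+E. (if shd E \<le> s then h (residual s E) else 0) \<partial>expS) = (\<Sum>k. crossing_integral (Suc k) s h)"
    if [measurable]: "h \<in> borel_measurable (stream_space borel)" for h
  proof -
    have "(\<integral>\<^sup>+E. (if shd E \<le> s then h (residual s E) else 0) \<partial>expS) =
        (\<integral>\<^sup>+E. (\<Sum>k. (if crossing s E (Suc k) then h (restart (Suc k) s E) else 0)) \<partial>expS)"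
    proof (rule nn_integral_cong_AE)
      have "AE E in expS. renewing E"
        by (rule AE_renewing[OF prob_space_expM _ AE_expM_pos]) simp
      then show "AE E in expS. (if shd E \<le> s then h (residual s E) else 0) =
          (\<Sum>k. (if crossing s E (Suc k) then h (restart (Suc k) s E) else 0))"
      proof eventually_elim
        case (elim E)
        obtain k0 where k0: "crossing s E k0" "\<And>k. crossing s E k \<Longrightarrow> k = k0"
          using crossing_ex1[OF elim] by blast
        have shd: "shd E \<le> s \<longleftrightarrow> k0 \<noteq> 0"
        proof (cases k0)
          case 0
          then show ?thesis using k0(1) crossing_0[of s "shd E" "stl E"] by simp
        next
          case (Suc k)
          then show ?thesis using k0(1) crossing_Suc[of s "shd E" "stl E" k] by simp
        qed
        have "(\<Sum>k. (if crossing s E (Suc k) then h (restart (Suc k) s E) else 0)) =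
            (\<Sum>k\<in>{k. Suc k = k0}. (if crossing s E (Suc k) then h (restart (Suc k) s E) else 0))"
          using k0(2) by (intro suminf_finite) (auto intro!: finite_subset[of _ "{k0 - 1}"])
        also have "\<dots> = (if shd E \<le> s then h (residual s E) else 0)"
        proof (cases k0)
          case 0
          then show ?thesis using shd by simp
        next
          case (Suc k)
          then have "{k. Suc k = k0} = {k}" by auto
          then show ?thesis using shd k0(1) Suc by (simp add: residual_crossing)
        qed
        finally show ?case by simp
      qed
    qed
    also have "\<dots> = (\<Sum>k. crossing_integral (Suc k) s h)"
      unfolding crossing_integral_def by (subst nn_integral_suminf) simp_all
    finally show ?thesis .
  qed
  have "(\<integral>\<^sup>+E. (if shd E \<le> s then h (residual s E) else 0) \<partial>expS) =
      (\<Sum>k. crossing_integral (Suc k) s (\<lambda>_. 1)) * (\<integral>\<^sup>+E. h E \<partial>expS)"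
    by (subst sum, simp, subst crossing_integral_factor) (simp_all add: s)
  also have "(\<Sum>k. crossing_integral (Suc k) s (\<lambda>_. 1)) = (\<integral>\<^sup>+E. (if shd E \<le> s then 1 else 0) \<partial>expS)"
    by (subst sum[symmetric]) simp_all
  also have "\<dots> = (\<integral>\<^sup>+x. indicator {..s} x \<partial>expM)"
    by (subst expM.nn_integral_stream_space, simp, intro nn_integral_cong)
       (auto simp: expS.emeasure_space_1)
  also have "\<dots> = ennreal (1 - exp (-s))"
    by (rule expM_le[OF s])
  finally show ?thesis .
qed

section \<open>The law of a thinned renewal process\<close>

text \<open>\<open>hit X E j\<close> says that the first arrival falls into the interval of number \<open>j\<close>, so that the
  first \<open>Suc j\<close> gaps of \<open>X\<close> merge into one.\<close>
definition hit :: "real stream \<Rightarrow> real stream \<Rightarrow> nat \<Rightarrow> bool" where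
  "hit X E j \<longleftrightarrow> shd E \<le> psum X (Suc j) \<and> (\<forall>i<j. \<not> shd E \<le> psum X (Suc i))"

lemma measurable_hit [measurable (raw)]:
  assumes [measurable]: "f \<in> measurable N (stream_space borel)" "g \<in> measurable N (stream_space borel)"
  shows "Measurable.pred N (\<lambda>x. hit (f x) (g x) j)"
  unfolding hit_def by measurable

lemma hit_0: "hit (x ## X) E 0 \<longleftrightarrow> shd E \<le> x"
  by (simp add: hit_def)

lemma hit_Suc: "hit (x ## X) E (Suc j) \<longleftrightarrow> x < shd E \<and> hit X (residual x E) j"
  by (cases "x < shd E") (auto simp: hit_def residual_first less_Suc_eq_0_disj not_le algebra_simps)

lemma first_hit_eq: "hit X E j \<Longrightarrow> first_hit (X, E) = j"
  unfolding first_hit_def hit_def by (intro Least_equality) (auto simp: not_less[symmetric])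

lemma hit_ex1:
  assumes "renewing X"
  shows "\<exists>!j. hit X E j"
proof -
  obtain k where k: "shd E < psum X k" using assms by (auto simp: renewing_def)
  have "psum X k \<le> psum X (Suc k)"
    using assms by (intro psum_mono) (auto simp: renewing_def)
  then have ex: "\<exists>j. shd E \<le> psum X (Suc j)" using k by (intro exI[of _ k]) simp
  have "hit X E (LEAST j. shd E \<le> psum X (Suc j))"
    unfolding hit_def using LeastI_ex[OF ex] not_less_Least by blast
  then show ?thesis
    using first_hit_eq by (metis)
qed

locale renewal_law = prob_space \<mu> for \<mu> :: "real measure" +
  assumes sets_mu [measurable_cong, simp]: "sets \<mu> = sets borel" and pos: "AE x in \<mu>. 0 < x"
begin

abbreviation "gapS \<equiv> stream_space \<mu>"

sublocale gapS: prob_space gapS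
  by (rule prob_space_stream_space)

definition pair_law :: "(real stream \<times> real stream) measure" where
  "pair_law = gapS \<Otimes>\<^sub>M expS"

definition thin_law :: "real measure" where
  "thin_law = distr pair_law borel thin_gap"

lemma sets_pair_law [measurable_cong, simp]: "sets pair_law = sets (stream_space borel \<Otimes>\<^sub>M stream_space borel)"
  unfolding pair_law_def by (intro sets_pair_measure_cong sets_stream_space_cong) simp_all

sublocale pair: prob_space pair_law
proof -
  interpret pair_prob_space gapS expS ..
  show "prob_space pair_law" unfolding pair_law_def by unfold_locales
qed

lemma nn_integral_pair_law:
  assumes [measurable]: "f \<in> borel_measurable (stream_space borel \<Otimes>\<^sub>M stream_space borel)"
  shows "(\<integral>\<^sup>+p. f p \<partial>pair_law) = (\<integral>\<^sup>+X. \<integral>\<^sup>+E. f (X, E) \<partial>expS \<partial>gapS)"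
proof -
  have "f \<in> borel_measurable (gapS \<Otimes>\<^sub>M expS)"
    by measurable
  then show ?thesis
    unfolding pair_law_def by (rule expS.nn_integral_fst[symmetric])
qed

text \<open>The part of the expectation of \<open>f\<close>, applied to the first gap of the thinned process and to
  the streams after it, that comes from the event \<open>hit X E j\<close>.\<close>
definition hit_integral :: "nat \<Rightarrow> (real \<times> real stream \<times> real stream \<Rightarrow> ennreal) \<Rightarrow> ennreal" where
  "hit_integral j f = (\<integral>\<^sup>+X. \<integral>\<^sup>+E. (if hit X E j
     then f (psum X (Suc j), sdrop (Suc j) X, residual (psum X (Suc j)) E) else 0) \<partial>expS \<partial>gapS)"

abbreviation "gap_space \<equiv> borel \<Otimes>\<^sub>M (stream_space borel \<Otimes>\<^sub>M stream_space borel)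
  :: (real \<times> real stream \<times> real stream) measure"

lemma hit_integral_0:
  assumes [measurable]: "f \<in> borel_measurable gap_space"
  shows "hit_integral 0 f = (\<integral>\<^sup>+x. ennreal (1 - exp (-x)) * (\<integral>\<^sup>+X. \<integral>\<^sup>+E. f (x, X, E) \<partial>expS \<partial>gapS) \<partial>\<mu>)"
proof -
  have "hit_integral 0 f =
      (\<integral>\<^sup>+x. \<integral>\<^sup>+X. \<integral>\<^sup>+E. (if shd E \<le> x then f (x, X, residual x E) else 0) \<partial>expS \<partial>gapS \<partial>\<mu>)"
    unfolding hit_integral_def
    by (subst nn_integral_stream_space) (simp_all add: hit_0 psum_def[of _ 0] cong: if_cong)
  also have "\<dots> = (\<integral>\<^sup>+x. ennreal (1 - exp (-x)) * (\<integral>\<^sup>+X. \<integral>\<^sup>+E. f (x, X, E) \<partial>expS \<partial>gapS) \<partial>\<mu>)"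
  proof (rule nn_integral_cong_AE)
    show "AE x in \<mu>. (\<integral>\<^sup>+X. \<integral>\<^sup>+E. (if shd E \<le> x then f (x, X, residual x E) else 0) \<partial>expS \<partial>gapS) =
        ennreal (1 - exp (-x)) * (\<integral>\<^sup>+X. \<integral>\<^sup>+E. f (x, X, E) \<partial>expS \<partial>gapS)"
      using pos
    proof eventually_elim
      case (elim x)
      then have "(\<integral>\<^sup>+E. (if shd E \<le> x then f (x, X, residual x E) else 0) \<partial>expS) =
          ennreal (1 - exp (-x)) * (\<integral>\<^sup>+E. f (x, X, E) \<partial>expS)" for X
        by (intro residual_law_later) auto
      then show ?case
        by (simp add: nn_integral_cmult)
    qed
  qed
  finally show ?thesis .
qed

lemma hit_integral_Suc:
  assumes [measurable]: "f \<in> borel_measurable gap_space"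
  shows "hit_integral (Suc j) f =
    (\<integral>\<^sup>+x. ennreal (exp (-x)) * hit_integral j (\<lambda>(g, p). f (x + g, p)) \<partial>\<mu>)"
proof -
  have "hit_integral (Suc j) f =
      (\<integral>\<^sup>+x. \<integral>\<^sup>+X. \<integral>\<^sup>+E. (if x < shd E \<and> hit X (residual x E) j
       then f (x + psum X (Suc j), sdrop (Suc j) X, residual (x + psum X (Suc j)) E) else 0) \<partial>expS \<partial>gapS \<partial>\<mu>)"
    unfolding hit_integral_def
    by (subst nn_integral_stream_space) (simp_all add: hit_Suc cong: if_cong)
  also have "\<dots> = (\<integral>\<^sup>+x. ennreal (exp (-x)) * hit_integral j (\<lambda>(g, p). f (x + g, p)) \<partial>\<mu>)"
  proof (rule nn_integral_cong_AE)
    show "AE x in \<mu>. (\<integral>\<^sup>+X. \<integral>\<^sup>+E. (if x < shd E \<and> hit X (residual x E) j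
       then f (x + psum X (Suc j), sdrop (Suc j) X, residual (x + psum X (Suc j)) E) else 0) \<partial>expS \<partial>gapS) =
       ennreal (exp (-x)) * hit_integral j (\<lambda>(g, p). f (x + g, p))"
      using pos
    proof eventually_elim
      case (elim x)
      have "(\<integral>\<^sup>+E. (if x < shd E \<and> hit X (residual x E) j
         then f (x + psum X (Suc j), sdrop (Suc j) X, residual (x + psum X (Suc j)) E) else 0) \<partial>expS) =
         (\<integral>\<^sup>+E. (if x < shd E then (\<lambda>E. if hit X E j
         then f (x + psum X (Suc j), sdrop (Suc j) X, residual (psum X (Suc j)) E) else 0) (residual x E) else 0) \<partial>expS)" for X
        by (intro nn_integral_cong) (auto simp: residual_residual)
      also have "\<dots> X = ennreal (exp (-x)) * (\<integral>\<^sup>+E. (if hit X E j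
         then f (x + psum X (Suc j), sdrop (Suc j) X, residual (psum X (Suc j)) E) else 0) \<partial>expS)" for X
        using elim by (intro residual_law_first) simp_all
      finally show ?case
        by (simp add: nn_integral_cmult hit_integral_def cong: if_cong)
    qed
  qed
  finally show ?thesis .
qed

text \<open>The streams after the first gap can be replaced by fresh independent ones. Conditioning on the
  first gap of \<open>X\<close> reduces \<open>Suc j\<close> to \<open>j\<close> for a shifted \<open>f\<close>, and averaging commutes with the
  shift.\<close>
lemma hit_integral_average:
  assumes "f \<in> borel_measurable gap_space"
  shows "hit_integral j f = hit_integral j (\<lambda>(g, _). \<integral>\<^sup>+X. \<integral>\<^sup>+E. f (g, X, E) \<partial>expS \<partial>gapS)"
  using assms
proof (induction j arbitrary: f)
  case 0
  note [measurable] = 0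
  show ?case
    by (simp add: hit_integral_0 gapS.emeasure_space_1 expS.emeasure_space_1)
next
  case (Suc j)
  note [measurable] = Suc.prems
  have "hit_integral j (\<lambda>(g, p). f (x + g, p)) =
      hit_integral j (\<lambda>(g, _). \<integral>\<^sup>+X. \<integral>\<^sup>+E. f (x + g, X, E) \<partial>expS \<partial>gapS)" for x
    by (subst Suc.IH) (simp_all add: split_beta')
  then show ?case
    by (simp add: hit_integral_Suc split_beta')
qed

lemma nn_integral_thin:
  assumes [measurable]: "f \<in> borel_measurable gap_space"
  shows "(\<integral>\<^sup>+p. f (thin_gap p, thin_step p) \<partial>pair_law) = (\<Sum>j. hit_integral j f)"
proof -
  have "(\<integral>\<^sup>+p. f (thin_gap p, thin_step p) \<partial>pair_law) =
      (\<integral>\<^sup>+X. \<integral>\<^sup>+E. f (thin_gap (X, E), thin_step (X, E)) \<partial>expS \<partial>gapS)"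
    by (rule nn_integral_pair_law) measurable
  also have "\<dots> = (\<integral>\<^sup>+X. \<integral>\<^sup>+E. (\<Sum>j. (if hit X E j
     then f (psum X (Suc j), sdrop (Suc j) X, residual (psum X (Suc j)) E) else 0)) \<partial>expS \<partial>gapS)"
  proof (rule nn_integral_cong_AE)
    have "AE X in gapS. renewing X"
      by (rule AE_renewing[OF _ _ pos]) (simp_all add: prob_space_axioms)
    then show "AE X in gapS. (\<integral>\<^sup>+E. f (thin_gap (X, E), thin_step (X, E)) \<partial>expS) =
      (\<integral>\<^sup>+E. (\<Sum>j. (if hit X E j
       then f (psum X (Suc j), sdrop (Suc j) X, residual (psum X (Suc j)) E) else 0)) \<partial>expS)"
    proof eventually_elim
      case (elim X)
      have "f (thin_gap (X, E), thin_step (X, E)) = (\<Sum>j. (if hit X E j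
       then f (psum X (Suc j), sdrop (Suc j) X, residual (psum X (Suc j)) E) else 0))" for E
      proof -
        obtain j0 where j0: "hit X E j0" "\<And>j. hit X E j \<Longrightarrow> j = j0"
          using hit_ex1[OF elim] by blast
        have "(\<Sum>j. (if hit X E j then f (psum X (Suc j), sdrop (Suc j) X, residual (psum X (Suc j)) E) else 0)) =
            (\<Sum>j\<in>{j0}. (if hit X E j then f (psum X (Suc j), sdrop (Suc j) X, residual (psum X (Suc j)) E) else 0))"
          using j0(2) by (intro suminf_finite) auto
        then show ?thesis
          using j0(1) by (simp add: thin_gap_def thin_step_def first_hit_eq)
      qed
      then show ?case by simp
    qed
  qed
  also have "\<dots> = (\<Sum>j. hit_integral j f)"
  proof -
    have "(\<integral>\<^sup>+E. (\<Sum>j. (if hit X E j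
       then f (psum X (Suc j), sdrop (Suc j) X, residual (psum X (Suc j)) E) else 0)) \<partial>expS) =
      (\<Sum>j. \<integral>\<^sup>+E. (if hit X E j
       then f (psum X (Suc j), sdrop (Suc j) X, residual (psum X (Suc j)) E) else 0) \<partial>expS)" for X
      by (rule nn_integral_suminf) simp
    then show ?thesis
      unfolding hit_integral_def by (simp only:) (rule nn_integral_suminf, simp)
  qed
  finally show ?thesis .
qed

text \<open>Sum over \<open>j\<close> in \<open>hit_integral_average\<close>. For products \<open>f\<close> this says that the first gap is
  independent of the streams after it and that these have their original law.\<close>
lemma thin_independent:
  assumes [measurable]: "f \<in> borel_measurable gap_space"
  shows "(\<integral>\<^sup>+p. f (thin_gap p, thin_step p) \<partial>pair_law) =
    (\<integral>\<^sup>+p. (\<integral>\<^sup>+q. f (thin_gap p, q) \<partial>pair_law) \<partial>pair_law)"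
proof -
  have "(\<integral>\<^sup>+p. f (thin_gap p, thin_step p) \<partial>pair_law) =
      (\<Sum>j. hit_integral j (\<lambda>(g, _). \<integral>\<^sup>+X. \<integral>\<^sup>+E. f (g, X, E) \<partial>expS \<partial>gapS))"
    by (simp add: nn_integral_thin hit_integral_average[of f])
  also have "\<dots> = (\<integral>\<^sup>+p. (\<integral>\<^sup>+X. \<integral>\<^sup>+E. f (thin_gap p, X, E) \<partial>expS \<partial>gapS) \<partial>pair_law)"
    by (subst nn_integral_thin[symmetric]) (simp_all add: split_beta')
  also have "\<dots> = (\<integral>\<^sup>+p. (\<integral>\<^sup>+q. f (thin_gap p, q) \<partial>pair_law) \<partial>pair_law)"
    by (simp add: nn_integral_pair_law[of "\<lambda>q. f (_, q)"])
  finally show ?thesis .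
qed

lemma measurable_thin_gaps [measurable]:
  "thin_gaps \<in> measurable (stream_space borel \<Otimes>\<^sub>M stream_space borel) (stream_space borel)"
proof (rule measurable_stream_space2)
  fix n
  have [measurable]: "(thin_step ^^ n) \<in> measurable (stream_space borel \<Otimes>\<^sub>M stream_space borel)
      (stream_space borel \<Otimes>\<^sub>M stream_space borel)"
    by (induction n) (simp_all add: measurable_comp[OF _ measurable_thin_step])
  have "(\<lambda>p. thin_gaps p !! n) = thin_gap \<circ> (thin_step ^^ n)"
    by (simp add: thin_gaps_def fun_eq_iff)
  then show "(\<lambda>p. thin_gaps p !! n) \<in> borel_measurable (stream_space borel \<Otimes>\<^sub>M stream_space borel)"
    by (simp add: measurable_comp[OF _ measurable_thin_gap])
qed

lemma thin_law_prob: "prob_space thin_law"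
  unfolding thin_law_def by (rule pair.prob_space_distr) measurable

lemma sets_thin_law [measurable_cong, simp]: "sets thin_law = sets borel"
  by (simp add: thin_law_def)

text \<open>The gaps of the thinned process are i.i.d.: both laws agree on cylinder sets, since
  splitting off the first gap factorises the probability of a cylinder on either side.\<close>
lemma thin_gaps_law: "distr pair_law (stream_space borel) thin_gaps = stream_space thin_law"
proof (rule stream_space_eq_scylinder[where G="sets borel" and C="{UNIV}" and S=borel])
  interpret thin: prob_space thin_law by (rule thin_law_prob)
  show "prob_space (distr pair_law (stream_space borel) thin_gaps)"
    by (rule pair.prob_space_distr) measurable
  show "prob_space (stream_space thin_law)"
    by (rule thin.prob_space_stream_space)
  show "sets (stream_space thin_law) = sets (stream_space borel)"
    by (rule sets_stream_space_cong) simp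
  have cyl [measurable]: "scylinder UNIV xs \<in> sets (stream_space borel)" if "xs \<in> lists (sets borel)" for xs :: "real set list"
    using sets_scylinder[of xs borel] that by auto
  have "emeasure (distr pair_law (stream_space borel) thin_gaps) (scylinder UNIV xs) =
      emeasure (stream_space thin_law) (scylinder UNIV xs)" if "xs \<in> lists (sets borel)" for xs
    using that
  proof (induction xs rule: list.induct)
    case Nil
    have "emeasure (distr pair_law (stream_space borel) thin_gaps) UNIV = 1"
      using prob_space.emeasure_space_1[OF \<open>prob_space (distr pair_law (stream_space borel) thin_gaps)\<close>] by simp
    moreover have "emeasure (stream_space thin_law) UNIV = 1"
      using prob_space.emeasure_space_1[OF \<open>prob_space (stream_space thin_law)\<close>]
      by (simp add: space_stream_space thin_law_def)
    ultimately show ?case by simp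
  next
    case (Cons A As)
    let ?C = "scylinder UNIV As"
    have [measurable]: "A \<in> sets borel" "As \<in> lists (sets borel)" using Cons.prems by auto
    note [measurable] = cyl[OF \<open>As \<in> lists (sets borel)\<close>] cyl[OF Cons.prems]
    have ind: "indicator (scylinder UNIV (A # As)) (x ## X) = (indicator A x * indicator ?C X :: ennreal)" for x X
      by (auto simp: indicator_def)
    have "emeasure (distr pair_law (stream_space borel) thin_gaps) (scylinder UNIV (A # As)) =
        (\<integral>\<^sup>+p. indicator (scylinder UNIV (A # As)) (thin_gaps p) \<partial>pair_law)"
      by (subst nn_integral_indicator[symmetric]) (simp_all add: nn_integral_distr del: scylinder.simps nn_integral_indicator)
    also have "\<dots> = (\<integral>\<^sup>+p. (\<lambda>(g, q). indicator A g * indicator ?C (thin_gaps q)) (thin_gap p, thin_step p) \<partial>pair_law)"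
      by (subst thin_gaps_Stream) (simp add: ind del: scylinder.simps)
    also have "\<dots> = (\<integral>\<^sup>+p. (\<integral>\<^sup>+q. (\<lambda>(g, q). indicator A g * indicator ?C (thin_gaps q)) (thin_gap p, q) \<partial>pair_law) \<partial>pair_law)"
      by (rule thin_independent) measurable
    also have "\<dots> = (\<integral>\<^sup>+p. indicator A (thin_gap p) \<partial>pair_law) * (\<integral>\<^sup>+q. indicator ?C (thin_gaps q) \<partial>pair_law)"
      by (simp add: nn_integral_cmult nn_integral_multc)
    also have "(\<integral>\<^sup>+p. indicator A (thin_gap p) \<partial>pair_law) = emeasure thin_law A"
      unfolding thin_law_def
      by (subst nn_integral_indicator[symmetric]) (simp_all add: nn_integral_distr del: nn_integral_indicator)
    also have "(\<integral>\<^sup>+q. indicator ?C (thin_gaps q) \<partial>pair_law) = emeasure (stream_space thin_law) ?C"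
      by (subst Cons.IH[symmetric], fact, subst nn_integral_indicator[symmetric])
        (simp_all add: nn_integral_distr del: nn_integral_indicator)
    also have "emeasure thin_law A * emeasure (stream_space thin_law) ?C =
        (\<integral>\<^sup>+x. \<integral>\<^sup>+X. indicator A x * indicator ?C X \<partial>stream_space thin_law \<partial>thin_law)"
      by (simp add: nn_integral_cmult nn_integral_multc)
    also have "\<dots> = emeasure (stream_space thin_law) (scylinder UNIV (A # As))"
      by (subst nn_integral_indicator[symmetric], simp del: scylinder.simps, subst thin.nn_integral_stream_space)
        (simp_all add: ind del: scylinder.simps nn_integral_indicator)
    finally show ?case .
  qed
  then show "\<And>xs. xs \<noteq> [] \<Longrightarrow> xs \<in> lists (sets borel) \<Longrightarrow>
      emeasure (distr pair_law (stream_space borel) thin_gaps) (scylinder (space borel) xs) =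
      emeasure (stream_space thin_law) (scylinder (space borel) xs)"
    by simp
  show "sets borel = sets (sigma (space borel) (sets (borel :: real measure)))"
    using sets.sigma_sets_eq[of "borel :: real measure"] by simp
qed (auto simp: Int_stable_def)

definition nn_mgf :: "real \<Rightarrow> ennreal" where
  "nn_mgf s = (\<integral>\<^sup>+x. ennreal (exp (s * x)) \<partial>\<mu>)"

text \<open>Each interval without an arrival contributes a factor \<open>nn_mgf (s - 1)\<close>: a gap \<open>x\<close> has no
  arrival with probability \<open>exp (-x)\<close>.\<close>
lemma hit_integral_exp:
  "hit_integral j (\<lambda>(g, _). ennreal (exp (s * g))) =
    nn_mgf (s - 1) ^ j * (\<integral>\<^sup>+x. ennreal (exp (s * x) - exp ((s - 1) * x)) \<partial>\<mu>)"
proof (induction j)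
  case 0
  have "ennreal (1 - exp (-x)) * ennreal (exp (s * x)) = ennreal (exp (s * x) - exp ((s - 1) * x))" for x
    by (subst ennreal_mult''[symmetric]) (simp_all add: algebra_simps exp_add[symmetric])
  then show ?case
    by (simp add: hit_integral_0 gapS.emeasure_space_1 expS.emeasure_space_1)
next
  case (Suc j)
  have shift: "hit_integral j (\<lambda>(g, p). (\<lambda>(g, _). ennreal (exp (s * g))) (x + g, p)) =
      ennreal (exp (s * x)) * hit_integral j (\<lambda>(g, _). ennreal (exp (s * g)))" for x
  proof -
    have "(if b then ennreal (exp (s * (x + y))) else 0) =
        ennreal (exp (s * x)) * (if b then ennreal (exp (s * y)) else 0)" for b y
      by (simp add: ennreal_mult'' exp_add distrib_left)
    note this [simp]
    show ?thesis
      unfolding hit_integral_def by (simp add: nn_integral_cmult cong: if_cong)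
  qed
  have "hit_integral (Suc j) (\<lambda>(g, _). ennreal (exp (s * g))) =
      (\<integral>\<^sup>+x. ennreal (exp (-x)) * (ennreal (exp (s * x)) * hit_integral j (\<lambda>(g, _). ennreal (exp (s * g)))) \<partial>\<mu>)"
    by (subst hit_integral_Suc, measurable, subst shift) simp
  also have "\<dots> = (\<integral>\<^sup>+x. ennreal (exp ((s - 1) * x)) * hit_integral j (\<lambda>(g, _). ennreal (exp (s * g))) \<partial>\<mu>)"
    by (intro nn_integral_cong, subst mult.assoc[symmetric], subst ennreal_mult''[symmetric])
       (simp_all add: exp_add[symmetric] algebra_simps)
  also have "\<dots> = nn_mgf (s - 1) * hit_integral j (\<lambda>(g, _). ennreal (exp (s * g)))"
    by (simp add: nn_integral_multc nn_mgf_def)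
  finally show ?case by (simp add: Suc mult.assoc)
qed

lemma thin_law_exp:
  "(\<integral>\<^sup>+x. ennreal (exp (s * x)) \<partial>thin_law) =
    (\<Sum>j. nn_mgf (s - 1) ^ j * (\<integral>\<^sup>+x. ennreal (exp (s * x) - exp ((s - 1) * x)) \<partial>\<mu>))"
proof -
  have "(\<integral>\<^sup>+x. ennreal (exp (s * x)) \<partial>thin_law) =
      (\<integral>\<^sup>+p. (\<lambda>(g, _). ennreal (exp (s * g))) (thin_gap p, thin_step p) \<partial>pair_law)"
    unfolding thin_law_def by (simp add: nn_integral_distr)
  also have "\<dots> = (\<Sum>j. hit_integral j (\<lambda>(g, _). ennreal (exp (s * g))))"
    by (rule nn_integral_thin) measurable
  finally show ?thesis by (simp add: hit_integral_exp)
qed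

text \<open>The geometric series over the number of intervals without an arrival.\<close>
lemma thin_law_mgf:
  assumes int: "integrable \<mu> (\<lambda>x. exp (s * x))" and s: "s < 1"
  defines "\<phi> \<equiv> \<lambda>s. \<integral>x. exp (s * x) \<partial>\<mu>"
  shows "integrable thin_law (\<lambda>x. exp (s * x))" "\<phi> (s - 1) < 1"
    "(\<integral>x. exp (s * x) \<partial>thin_law) = (\<phi> s - \<phi> (s - 1)) / (1 - \<phi> (s - 1))"
proof -
  have int1: "integrable \<mu> (\<lambda>x. exp ((s - 1) * x))"
    using pos s by (intro integrable_const_bound[where B=1]) (auto simp: mult_nonpos_nonneg)
  have "\<phi> (s - 1) < (\<integral>x. 1 \<partial>\<mu>)"
    unfolding \<phi>_def using int1 pos s
    by (intro integral_less_AE_space) (auto simp: emeasure_space_1 mult_neg_pos)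
  then show lt: "\<phi> (s - 1) < 1" by (simp add: prob_space)
  have nonneg: "0 \<le> \<phi> (s - 1)" unfolding \<phi>_def by simp
  have nn_mgf: "nn_mgf (s - 1) = ennreal (\<phi> (s - 1))"
    unfolding nn_mgf_def \<phi>_def by (rule nn_integral_eq_integral[OF int1]) simp
  have le: "AE x in \<mu>. 0 \<le> exp (s * x) - exp ((s - 1) * x)"
    using pos by eventually_elim (simp add: algebra_simps)
  have diff: "(\<integral>\<^sup>+x. ennreal (exp (s * x) - exp ((s - 1) * x)) \<partial>\<mu>) = ennreal (\<phi> s - \<phi> (s - 1))"
    unfolding \<phi>_def using int int1 le by (subst nn_integral_eq_integral) auto
  have diff0: "0 \<le> \<phi> s - \<phi> (s - 1)"
    unfolding \<phi>_def diff_ge_0_iff_ge using le by (intro integral_mono_AE[OF int1 int]) simp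
  have "(\<integral>\<^sup>+x. ennreal (exp (s * x)) \<partial>thin_law) = (\<Sum>j. ennreal (\<phi> (s - 1) ^ j * (\<phi> s - \<phi> (s - 1))))"
    unfolding thin_law_exp nn_mgf diff using nonneg diff0 by (simp add: ennreal_power ennreal_mult)
  also have "\<dots> = ennreal (\<Sum>j. \<phi> (s - 1) ^ j * (\<phi> s - \<phi> (s - 1)))"
    using nonneg diff0 lt by (intro suminf_ennreal2) (auto intro!: summable_mult2 summable_geometric)
  also have "(\<Sum>j. \<phi> (s - 1) ^ j * (\<phi> s - \<phi> (s - 1))) = (\<phi> s - \<phi> (s - 1)) / (1 - \<phi> (s - 1))"
    using nonneg lt by (subst suminf_mult2[symmetric]) (auto simp: suminf_geometric)
  finally have eq: "(\<integral>\<^sup>+x. ennreal (exp (s * x)) \<partial>thin_law) = ennreal ((\<phi> s - \<phi> (s - 1)) / (1 - \<phi> (s - 1)))" .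
  then show "integrable thin_law (\<lambda>x. exp (s * x))"
    by (intro integrableI_nonneg) auto
  show "(\<integral>x. exp (s * x) \<partial>thin_law) = (\<phi> s - \<phi> (s - 1)) / (1 - \<phi> (s - 1))"
    using eq diff0 lt by (subst integral_eq_nn_integral) auto
qed

lemma thin_law_pos: "AE x in thin_law. 0 < x"
proof -
  have "AE X in gapS. renewing X"
    by (rule AE_renewing[OF _ _ pos]) (simp_all add: prob_space_axioms)
  then have "AE X in gapS. \<forall>E. 0 < thin_gap (X, E)"
  proof eventually_elim
    case (elim X)
    then show ?case
      using psum_strict_mono[of X 0 "Suc k" for k] by (simp add: thin_gap_def renewing_def)
  qed
  then have "AE X in gapS. AE E in expS. 0 < thin_gap (X, E)"
    by eventually_elim simp
  then have "AE p in gapS \<Otimes>\<^sub>M expS. 0 < thin_gap p"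
    using pair_sigma_finite.AE_pair_measure[of gapS expS "\<lambda>p. 0 < thin_gap p"]
    by (simp add: pair_sigma_finite_def gapS.sigma_finite_measure_axioms expS.sigma_finite_measure_axioms)
  then show ?thesis
    unfolding thin_law_def pair_law_def[symmetric] by (subst AE_distr_iff) auto
qed

lemma thin_renewal_law: "renewal_law thin_law"
  by (intro renewal_law.intro renewal_law_axioms.intro thin_law_prob sets_thin_law thin_law_pos)

end

section \<open>The gaps between the fires at a site\<close>

primrec gap_law :: "nat \<Rightarrow> real measure" where
  "gap_law 0 = expM"
| "gap_law (Suc n) = renewal_law.thin_law (gap_law n)"

lemma renewal_law_gap_law: "renewal_law (gap_law n)"
proof (induction n)
  case 0
  show ?case
    by (simp add: renewal_law_def renewal_law_axioms_def prob_space_expM AE_expM_pos)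
next
  case (Suc n)
  then show ?case by (simp add: renewal_law.thin_renewal_law)
qed

primrec fire_gaps :: "nat \<Rightarrow> (nat \<Rightarrow> real stream) \<Rightarrow> real stream" where
  "fire_gaps 0 w = w 0"
| "fire_gaps (Suc n) w = thin_gaps (fire_gaps n w, w (Suc n))"

lemma fire_gaps_restrict: "n \<le> m \<Longrightarrow> fire_gaps n (restrict w {..m}) = fire_gaps n w"
  by (induction n) simp_all

lemma measurable_fire_gaps:
  "n \<le> m \<Longrightarrow> fire_gaps n \<in> measurable (PiM {..m} (\<lambda>_. stream_space borel)) (stream_space borel)"
proof (induction n)
  case 0
  then show ?case by simp
next
  case (Suc n)
  note [measurable] = Suc.IH[OF Suc_leD[OF Suc.prems]]
  interpret renewal_law expM using renewal_law_gap_law[of 0] by simp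
  have "(\<lambda>w. w (Suc n)) \<in> measurable (PiM {..m} (\<lambda>_. stream_space borel)) (stream_space (borel::real measure))"
    using Suc.prems by (intro measurable_component_singleton) simp
  note [measurable] = this
  have "(\<lambda>w. thin_gaps (fire_gaps n w, w (Suc n))) \<in> measurable (PiM {..m} (\<lambda>_. stream_space borel)) (stream_space borel)"
    by measurable
  then show ?case by simp
qed

lemma emeasure_expM_singleton: "emeasure expM {c} = 0"
proof -
  have "AE x in lborel. x \<noteq> c" by (rule AE_lborel_singleton)
  then have "AE x in expM. x \<noteq> c"
    unfolding expM_def by (subst AE_density) (auto elim: eventually_mono)
  then show ?thesis by (subst (asm) AE_iff_measurable[of "{c}"]) auto
qed

text \<open>Arrival times have no atoms, so arrivals at different sites almost surely do not coincide.\<close>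
lemma AE_psum_neq: "AE E in expS. psum E (Suc k) \<noteq> c"
proof -
  have "AE x in expM. x + psum E k \<noteq> c" for E
  proof -
    have "AE x in expM. x \<notin> {c - psum E k}"
      by (rule AE_not_in) (simp add: null_sets_def emeasure_expM_singleton)
    then show ?thesis by eventually_elim auto
  qed
  then have "AE E in expS. AE x in expM. x + psum E k \<noteq> c" by simp
  then have "AE x in expM. AE E in expS. x + psum E k \<noteq> c"
  proof (rule pair_sigma_finite.AE_commute[THEN iffD1, rotated 2])
    show "pair_sigma_finite expS expM"
      by (simp add: pair_sigma_finite_def expM.sigma_finite_measure_axioms expS.sigma_finite_measure_axioms)
    show "{p \<in> space (expS \<Otimes>\<^sub>M expM). snd p + psum (fst p) k \<noteq> c} \<in> sets (expS \<Otimes>\<^sub>M expM)"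
      by measurable
  qed
  then show ?thesis
    by (subst expM.AE_stream_space) simp_all
qed

context forest_fire
begin

definition waiting :: "nat \<Rightarrow> 'a \<Rightarrow> real stream" where
  "waiting y \<omega> = to_stream (\<lambda>k. E y k \<omega>)"

lemma waiting_snth: "waiting y \<omega> !! k = E y k \<omega>"
  by (simp add: waiting_def to_stream_def)

lemma waiting_time_law: "distr M borel (E y k) = expM"
proof -
  have "distr M borel (E y k) = distr M lborel (E y k)" by (rule distr_cong) simp_all
  also have "\<dots> = expM"
    using waiting_times_exponential[of y k] by (simp add: distributed_def expM_def)
  finally show ?thesis .
qed

lemma measurable_E [measurable]: "E y k \<in> borel_measurable M"
  using waiting_times_exponential[of y k] by (simp add: distributed_def)

lemma measurable_waiting [measurable]: "waiting y \<in> measurable M (stream_space borel)"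
  by (rule measurable_stream_space2) (simp add: waiting_snth)

lemma indep_waiting: "indep_vars (\<lambda>_. stream_space borel) waiting UNIV"
proof -
  have "indep_vars (\<lambda>y. PiM ({y} \<times> UNIV) (\<lambda>_. borel))
      (\<lambda>y \<omega>. restrict (\<lambda>i. (\<lambda>(y, k). E y k) i \<omega>) ({y} \<times> UNIV)) UNIV"
    by (rule indep_vars_restrict[OF waiting_times_indep]) (auto simp: disjoint_family_on_def)
  then have "indep_vars (\<lambda>_. stream_space borel) (\<lambda>y \<omega>. to_stream (\<lambda>k.
      restrict (\<lambda>i. (\<lambda>(y, k). E y k) i \<omega>) ({y} \<times> UNIV) (y, k))) UNIV"
    by (rule indep_vars_compose2)
      (auto intro!: measurable_stream_space2 measurable_component_singleton simp: to_stream_def)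
  then show ?thesis
    by (simp add: waiting_def[abs_def])
qed

lemma waiting_law: "distr M (stream_space borel) (waiting y) = expS"
proof -
  let ?P = "PiM UNIV (\<lambda>_::nat \<times> nat. borel :: real measure)"
  have E: "distr M ?P (\<lambda>\<omega> (y, k). E y k \<omega>) = PiM UNIV (\<lambda>_. expM)"
  proof -
    have "distr M ?P (\<lambda>\<omega>. \<lambda>i\<in>UNIV. (\<lambda>(y, k). E y k) i \<omega>) =
        PiM UNIV (\<lambda>i. distr M borel ((\<lambda>(y, k). E y k) i))"
      using waiting_times_indep
      by (subst (asm) indep_vars_iff_distr_eq_PiM) (auto simp: split_beta')
    then show ?thesis
      by (simp add: split_beta' waiting_time_law restrict_UNIV)
  qed
  have mE: "(\<lambda>\<omega> (y, k). E y k \<omega>) \<in> measurable M ?P"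
    by (rule measurable_PiM_single') (auto simp: split_beta')
  have re: "distr (PiM UNIV (\<lambda>_::nat \<times> nat. expM)) (PiM UNIV (\<lambda>_. expM)) (\<lambda>f. \<lambda>k\<in>UNIV. f (y, k)) =
      PiM UNIV (\<lambda>_::nat. expM)"
    using distr_PiM_reindex[of UNIV "\<lambda>_. expM" "\<lambda>k. (y, k)" UNIV]
    by (auto simp: prob_space_expM inj_on_def)
  have sets_P: "sets (PiM UNIV (\<lambda>_::nat \<times> nat. expM)) = sets ?P"
    "sets (PiM UNIV (\<lambda>_::nat. expM)) = sets (PiM UNIV (\<lambda>_::nat. borel))"
    by (auto intro!: sets_PiM_cong)
  have m1: "(\<lambda>f k. f (y, k)) \<in> measurable ?P (PiM UNIV (\<lambda>_::nat. borel :: real measure))"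
    by (rule measurable_PiM_single') auto
  have "expS = distr (PiM UNIV (\<lambda>_::nat. expM)) expS to_stream"
    by (rule stream_space_eq_distr)
  also have "\<dots> = distr (distr (distr M ?P (\<lambda>\<omega> (y, k). E y k \<omega>)) (PiM UNIV (\<lambda>_. borel)) (\<lambda>f k. f (y, k)))
      (stream_space borel) to_stream"
  proof (rule distr_cong)
    show "PiM UNIV (\<lambda>_::nat. expM) =
        distr (distr M ?P (\<lambda>\<omega> (y, k). E y k \<omega>)) (PiM UNIV (\<lambda>_. borel)) (\<lambda>f k. f (y, k))"
      unfolding E by (subst re[symmetric], rule distr_cong) (auto simp: sets_P)
  qed (auto intro!: sets_stream_space_cong)
  also have "\<dots> = distr M (stream_space borel) (waiting y)"
    using mE m1
    by (subst distr_distr) (auto simp: waiting_def[abs_def] comp_def distr_distr intro: measurable_comp)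
  finally show ?thesis ..
qed

text \<open>\<open>fire_gaps n\<close> depends on the arrivals at the sites up to \<open>n\<close> only and is therefore independent
  of the arrivals at \<open>Suc n\<close>.\<close>
lemma fire_gaps_law:
  "distr M (stream_space borel) (\<lambda>\<omega>. fire_gaps n (\<lambda>y. waiting y \<omega>)) = stream_space (gap_law n)"
proof (induction n)
  case 0
  show ?case by (simp add: waiting_law)
next
  case (Suc n)
  interpret L: renewal_law "gap_law n" by (rule renewal_law_gap_law)
  let ?S = "stream_space (borel :: real measure)"
  let ?X = "\<lambda>\<omega>. fire_gaps n (\<lambda>y. waiting y \<omega>)"
  have "indep_var (PiM {..n} (\<lambda>_. ?S)) (\<lambda>\<omega>. restrict (\<lambda>i. waiting i \<omega>) {..n})
      (PiM {Suc n} (\<lambda>_. ?S)) (\<lambda>\<omega>. restrict (\<lambda>i. waiting i \<omega>) {Suc n})"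
    by (rule indep_var_restrict[OF indep_waiting]) auto
  then have "indep_var ?S (fire_gaps n \<circ> (\<lambda>\<omega>. restrict (\<lambda>i. waiting i \<omega>) {..n}))
      ?S ((\<lambda>f. f (Suc n)) \<circ> (\<lambda>\<omega>. restrict (\<lambda>i. waiting i \<omega>) {Suc n}))"
    by (rule indep_var_compose) (auto intro!: measurable_fire_gaps measurable_component_singleton)
  then have ind: "indep_var ?S ?X ?S (waiting (Suc n))"
    by (simp add: comp_def fire_gaps_restrict)
  then have [measurable]: "?X \<in> measurable M ?S"
    by (simp add: indep_var_distribution_eq)
  have joint: "distr M (?S \<Otimes>\<^sub>M ?S) (\<lambda>\<omega>. (?X \<omega>, waiting (Suc n) \<omega>)) = L.pair_law"
    using ind by (simp add: indep_var_distribution_eq Suc waiting_law L.pair_law_def)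
  have "distr M ?S (\<lambda>\<omega>. thin_gaps (?X \<omega>, waiting (Suc n) \<omega>)) = distr L.pair_law ?S thin_gaps"
    unfolding joint[symmetric] by (subst distr_distr) (auto simp: comp_def)
  then show ?case
    by (simp add: L.thin_gaps_law)
qed

lemma arrival_times_eq: "arrival_times E \<omega> y = range (\<lambda>k. psum (waiting y \<omega>) (Suc k))"
  unfolding arrival_times_def psum_def by (simp add: waiting_snth lessThan_Suc_atMost del: snth.simps)

lemma AE_waiting_renewing: "AE \<omega> in M. \<forall>y. renewing (waiting y \<omega>)"
proof -
  have "AE \<omega> in M. renewing (waiting y \<omega>)" for y
  proof -
    have "AE X in distr M (stream_space borel) (waiting y). renewing X"
      unfolding waiting_law by (rule AE_renewing[OF prob_space_expM _ AE_expM_pos]) simp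
    then show ?thesis
      by (rule AE_distrD[rotated]) measurable
  qed
  then show ?thesis by (simp add: AE_all_countable)
qed

lemma AE_arrivals_disjoint:
  "AE \<omega> in M. \<forall>y z. y \<noteq> z \<longrightarrow> arrival_times E \<omega> y \<inter> arrival_times E \<omega> z = {}"
proof -
  let ?S = "stream_space (borel :: real measure)"
  have "AE \<omega> in M. psum (waiting y \<omega>) (Suc k) \<noteq> psum (waiting z \<omega>) (Suc l)" if "y \<noteq> z" for y z k l
  proof -
    have "indep_var (PiM {y} (\<lambda>_. ?S)) (\<lambda>\<omega>. restrict (\<lambda>i. waiting i \<omega>) {y})
        (PiM {z} (\<lambda>_. ?S)) (\<lambda>\<omega>. restrict (\<lambda>i. waiting i \<omega>) {z})"
      using that by (intro indep_var_restrict[OF indep_waiting]) auto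
    then have "indep_var ?S ((\<lambda>f. f y) \<circ> (\<lambda>\<omega>. restrict (\<lambda>i. waiting i \<omega>) {y}))
        ?S ((\<lambda>f. f z) \<circ> (\<lambda>\<omega>. restrict (\<lambda>i. waiting i \<omega>) {z}))"
      by (rule indep_var_compose) (auto intro!: measurable_component_singleton)
    then have "indep_var ?S (waiting y) ?S (waiting z)"
      by (simp add: comp_def)
    then have joint: "distr M (?S \<Otimes>\<^sub>M ?S) (\<lambda>\<omega>. (waiting y \<omega>, waiting z \<omega>)) = expS \<Otimes>\<^sub>M expS"
      by (simp add: indep_var_distribution_eq waiting_law)
    have "AE p in expS \<Otimes>\<^sub>M expS. psum (fst p) (Suc k) \<noteq> psum (snd p) (Suc l)"
    proof (rule pair_sigma_finite.AE_pair_measure)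
      show "pair_sigma_finite expS expS"
        by (simp add: pair_sigma_finite_def expS.sigma_finite_measure_axioms)
      show "AE x in expS. AE y in expS. psum (fst (x, y)) (Suc k) \<noteq> psum (snd (x, y)) (Suc l)"
        using AE_psum_neq[of l] by (simp add: eq_commute[of "psum _ (Suc k)"])
    qed measurable
    then have "AE p in distr M (?S \<Otimes>\<^sub>M ?S) (\<lambda>\<omega>. (waiting y \<omega>, waiting z \<omega>)).
        psum (fst p) (Suc k) \<noteq> psum (snd p) (Suc l)"
      unfolding joint .
    then have "AE \<omega> in M. psum (fst (waiting y \<omega>, waiting z \<omega>)) (Suc k) \<noteq> psum (snd (waiting y \<omega>, waiting z \<omega>)) (Suc l)"
      by (rule AE_distrD[rotated]) measurable
    then show ?thesis by simp
  qed
  then have "AE \<omega> in M. \<forall>y z k l. y \<noteq> z \<longrightarrow> psum (waiting y \<omega>) (Suc k) \<noteq> psum (waiting z \<omega>) (Suc l)"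
    by (simp add: AE_all_countable)
  then show ?thesis
    by eventually_elim (auto simp: arrival_times_eq)
qed

lemma AE_fire_gaps:
  "AE \<omega> in M. \<forall>n. has_gaps (burn_times (arrival_times E \<omega>) (\<eta> \<omega>) n) 0 (fire_gaps n (\<lambda>y. waiting y \<omega>))"
  using dynamics AE_waiting_renewing AE_arrivals_disjoint
proof eventually_elim
  case (elim \<omega>)
  let ?A = "arrival_times E \<omega>" and ?w = "\<lambda>y. waiting y \<omega>"
  have pos: "?A y \<subseteq> {0<..}" for y
    using psum_strict_mono[of "?w y" 0 "Suc k" for k] elim(2)
    by (auto simp: arrival_times_eq renewing_def)
  have gaps: "has_gaps (?A y) 0 (?w y)" for y
    using elim(2) pos[of y] by (auto simp: has_gaps_def renewing_def arrival_times_eq)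
  have disj: "?A y \<inter> ?A z = {}" if "y \<noteq> z" for y z
    using elim(3) that by blast
  show ?case
  proof
    fix n show "has_gaps (burn_times ?A (\<eta> \<omega>) n) 0 (fire_gaps n ?w)"
    proof (induction n)
      case 0
      then show ?case using gaps by (simp add: burn_times_0[OF elim(1) disj pos])
    next
      case (Suc n)
      then show ?case using burn_times_has_gaps_Suc[OF elim(1) disj pos Suc gaps] by simp
    qed
  qed
qed

text \<open>The gap of number \<open>Suc i\<close> is almost surely the entry \<open>i\<close> of an i.i.d. stream; in particular
  its law does not depend on \<open>i\<close>.\<close>
lemma burnout_gap_law: "distr M borel (burnout_gap E \<eta> n (Suc i)) = gap_law n"
proof -
  interpret L: renewal_law "gap_law n" by (rule renewal_law_gap_law)
  have [measurable]: "(\<lambda>\<omega>. fire_gaps n (\<lambda>y. waiting y \<omega>)) \<in> measurable M (stream_space borel)"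
  proof -
    have "(\<lambda>\<omega>. restrict (\<lambda>y. waiting y \<omega>) {..n}) \<in> measurable M (PiM {..n} (\<lambda>_. stream_space borel))"
      by (rule measurable_restrict) simp
    from measurable_compose[OF this measurable_fire_gaps[of n n]] show ?thesis
      by (simp add: fire_gaps_restrict)
  qed
  have "AE \<omega> in M. burnout_gap E \<eta> n (Suc i) \<omega> = fire_gaps n (\<lambda>y. waiting y \<omega>) !! i"
    using AE_fire_gaps
  proof eventually_elim
    case (elim \<omega>)
    note nth_time_has_gaps[OF elim[rule_format, of n]]
    then show ?case
      by (simp add: burnout_gap_def burnout_time_def psum_Suc del: nth_time.simps)
  qed
  then have "distr M borel (burnout_gap E \<eta> n (Suc i)) = distr M borel (\<lambda>\<omega>. fire_gaps n (\<lambda>y. waiting y \<omega>) !! i)"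
    using burnout_time_measurable by (intro distr_cong_AE) (auto simp: burnout_gap_def[abs_def])
  also have "\<dots> = distr (stream_space (gap_law n)) borel (\<lambda>X. X !! i)"
    unfolding fire_gaps_law[symmetric] by (subst distr_distr) (auto simp: comp_def)
  also have "\<dots> = gap_law n"
  proof (rule measure_eqI)
    fix A assume "A \<in> sets (distr (stream_space (gap_law n)) borel (\<lambda>X. X !! i))"
    then have [measurable]: "A \<in> sets borel" by simp
    have "(\<integral>\<^sup>+X. indicator A (X !! i) \<partial>stream_space (gap_law n)) = (\<integral>\<^sup>+x. indicator A x \<partial>gap_law n)"
    proof (induction i)
      case 0
      then show ?case by (subst L.nn_integral_stream_space) (simp_all add: L.gapS.emeasure_space_1)
    next
      case (Suc i)
      then show ?case
        by (subst L.nn_integral_stream_space) (simp_all add: L.emeasure_space_1 del: nn_integral_indicator)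
    qed
    then show "emeasure (distr (stream_space (gap_law n)) borel (\<lambda>X. X !! i)) A = emeasure (gap_law n) A"
      by (subst nn_integral_indicator[symmetric], simp, subst nn_integral_distr) simp_all
  qed simp
  finally show ?thesis .
qed

end

section \<open>Exponential integrals\<close>

lemma integral_FTC_Icc:
  fixes f F :: "real \<Rightarrow> real"
  assumes "a \<le> b" "\<And>x. a \<le> x \<Longrightarrow> x \<le> b \<Longrightarrow> (F has_real_derivative f x) (at x)" "continuous_on {a..b} f"
  shows "integrable lborel (\<lambda>x. indicator {a..b} x * f x)"
    "(\<integral>x. indicator {a..b} x * f x \<partial>lborel) = F b - F a"
proof -
  show "integrable lborel (\<lambda>x. indicator {a..b} x * f x)"
    using borel_integrable_atLeastAtMost'[OF assms(3)] by (simp add: set_integrable_def)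
  have "(F has_vector_derivative f x) (at x within {a..b})" if "a \<le> x" "x \<le> b" for x
    using assms(2)[OF that] by (meson has_field_derivative_at_within has_real_derivative_iff_has_vector_derivative)
  from integral_FTC_atLeastAtMost[OF assms(1) this assms(3)]
  show "(\<integral>x. indicator {a..b} x * f x \<partial>lborel) = F b - F a" by simp
qed

lemma dominated_convergence_eventually:
  fixes s :: "nat \<Rightarrow> 'b \<Rightarrow> real"
  assumes [measurable]: "f \<in> borel_measurable M" "\<And>n. s n \<in> borel_measurable M"
    and w: "integrable M w" and lim: "AE x in M. (\<lambda>n. s n x) \<longlonglongrightarrow> f x"
    and bound: "\<forall>\<^sub>F n in sequentially. AE x in M. \<bar>s n x\<bar> \<le> w x"
  shows "integrable M f" "(\<lambda>n. integral\<^sup>L M (s n)) \<longlonglongrightarrow> integral\<^sup>L M f"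
proof -
  obtain N where N: "\<And>n. n \<ge> N \<Longrightarrow> AE x in M. \<bar>s n x\<bar> \<le> w x"
    using bound by (auto simp: eventually_sequentially)
  have lim': "AE x in M. (\<lambda>n. s (n + N) x) \<longlonglongrightarrow> f x"
    using lim by eventually_elim (rule LIMSEQ_ignore_initial_segment)
  show "integrable M f"
    by (rule integrable_dominated_convergence[where s="\<lambda>n. s (n + N)", OF _ _ w lim']) (use N in auto)
  have "(\<lambda>n. integral\<^sup>L M (s (n + N))) \<longlonglongrightarrow> integral\<^sup>L M f"
    by (rule integral_dominated_convergence[OF _ _ w lim']) (use N in auto)
  then show "(\<lambda>n. integral\<^sup>L M (s n)) \<longlonglongrightarrow> integral\<^sup>L M f"
    by (rule LIMSEQ_offset)
qed

lemma exp_tail: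
  assumes c: "0 < (c::real)"
  shows "integrable lborel (\<lambda>x. indicator {a..} x * exp (- c * x))"
    "(\<integral>\<^sup>+x. ennreal (exp (- c * x)) * indicator {a..} x \<partial>lborel) = ennreal (exp (- c * a) / c)"
proof -
  have "((\<lambda>x. exp (- c * x)) \<longlongrightarrow> 0) at_top"
    using c by (intro filterlim_compose[OF exp_at_bot] filterlim_tendsto_neg_mult_at_bot[OF tendsto_const])
      (auto intro: filterlim_ident)
  then have "((\<lambda>x. - exp (- c * x) / c) \<longlongrightarrow> - 0 / c) at_top"
    by (intro tendsto_intros) (use c in auto)
  then have "((\<lambda>x. - exp (- c * x) / c) \<longlongrightarrow> 0) at_top" by simp
  then have eq: "(\<integral>\<^sup>+x. ennreal (exp (- c * x)) * indicator {a..} x \<partial>lborel) = 0 - (- exp (- c * a) / c)"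
    using c by (intro nn_integral_FTC_atLeast) (auto intro!: derivative_eq_intros)
  then show "(\<integral>\<^sup>+x. ennreal (exp (- c * x)) * indicator {a..} x \<partial>lborel) = ennreal (exp (- c * a) / c)"
    by simp
  have "(\<integral>\<^sup>+x. ennreal (indicator {a..} x * exp (- c * x)) \<partial>lborel) < \<infinity>"
    using eq by (simp add: ennreal_mult' mult.commute ennreal_indicator)
  then show "integrable lborel (\<lambda>x. indicator {a..} x * exp (- c * x))"
    by (intro integrableI_nonneg) auto
qed

subsection \<open>The entire function behind the exponential integral\<close>

text \<open>\<open>ein x + ln \<bar>x\<bar>\<close> is an antiderivative of \<open>exp x / x\<close>, so \<open>ein\<close> is the entire part of the
  exponential integral. Its derivative is \<open>exprel x = (exp x - 1) / x\<close>, continued to \<open>0\<close>.\<close>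
definition ein :: "real \<Rightarrow> real" where
  "ein s = (\<Sum>m. s ^ Suc m / (real (Suc m) * fact (Suc m)))"

definition exprel :: "real \<Rightarrow> real" where
  "exprel x = (\<Sum>n. inverse (fact (Suc n)) * x ^ n)"

lemma summable_exprel: "summable (\<lambda>n. inverse (fact (Suc n)) * x ^ n)" for x :: real
proof (rule summable_comparison_test'[OF summable_exp[of "\<bar>x\<bar>"]])
  fix n :: nat
  have "inverse (fact (Suc n)) \<le> (inverse (fact n) :: real)"
    by (intro le_imp_inverse_le fact_mono) simp_all
  then show "norm (inverse (fact (Suc n)) * x ^ n) \<le> inverse (fact n) * \<bar>x\<bar> ^ n"
    by (simp add: abs_mult power_abs mult_right_mono del: fact_Suc)
qed

lemma exprel_eq: "x * exprel x = exp x - 1"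
proof -
  have "exp x = (\<Sum>n. inverse (fact n) * x ^ n)"
    by (simp add: exp_def divide_inverse)
  also have "\<dots> = 1 + (\<Sum>n. inverse (fact (Suc n)) * x ^ Suc n)"
    using summable_exp[of x] by (subst suminf_split_head) (simp_all del: fact_Suc)
  also have "(\<Sum>n. inverse (fact (Suc n)) * x ^ Suc n) = x * exprel x"
    unfolding exprel_def using summable_exprel[of x]
    by (subst suminf_mult[symmetric]) (simp_all add: mult_ac del: fact_Suc)
  finally show ?thesis by simp
qed

lemma isCont_exprel: "isCont exprel x"
  unfolding exprel_def[abs_def]
  by (rule isCont_powser_converges_everywhere) (rule summable_exprel)

lemma DERIV_ein: "(ein has_real_derivative exprel x) (at x)"
proof -
  \<comment> \<open>The coefficient at \<open>0\<close> vanishes, because \<open>inverse 0 = 0\<close>.\<close>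
  define c :: "nat \<Rightarrow> real" where "c n = inverse (real n * fact n)" for n
  have le: "norm (c n * y ^ n) \<le> inverse (fact n) * \<bar>y\<bar> ^ n" for n and y :: real
  proof (cases n)
    case (Suc m)
    have "fact n \<le> real n * fact n"
      using Suc by (simp del: fact_Suc)
    then have "c n \<le> inverse (fact n)"
      unfolding c_def by (intro le_imp_inverse_le) simp_all
    moreover have "0 \<le> c n" by (simp add: c_def)
    ultimately show ?thesis by (simp add: abs_mult power_abs mult_right_mono)
  qed (simp add: c_def)
  have sum: "summable (\<lambda>n. c n * y ^ n)" for y
    by (rule summable_comparison_test'[OF summable_exp[of "\<bar>y\<bar>"] le])
  have c: "ein x = (\<Sum>n. c n * x ^ n)" for x
    using suminf_split_head[OF sum[of x]]
    by (simp add: ein_def c_def divide_inverse mult.commute del: fact_Suc)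
  have d: "diffs c n = inverse (fact (Suc n))" for n
    by (simp add: diffs_def c_def del: fact_Suc of_nat_Suc)
  have "((\<lambda>x. \<Sum>n. c n * x ^ n) has_real_derivative (\<Sum>n. diffs c n * x ^ n)) (at x)"
    by (rule termdiffs_strong_converges_everywhere) (rule sum)
  then show ?thesis
    by (simp add: c[abs_def, symmetric] d exprel_def)
qed

lemma ein_0 [simp]: "ein 0 = 0"
  by (simp add: ein_def)

lemma ein_integral:
  assumes "0 \<le> b"
  shows "integrable lborel (\<lambda>v. indicator {0..b} v * ((exp (s * v) - 1) / v))"
    "(\<integral>v. indicator {0..b} v * ((exp (s * v) - 1) / v) \<partial>lborel) = ein (s * b)"
proof -
  have d: "((\<lambda>v. ein (s * v)) has_real_derivative s * exprel (s * v)) (at v)" for v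
    by (rule DERIV_cong[OF DERIV_chain2[OF DERIV_ein]]) (auto intro!: derivative_eq_intros)
  have "continuous_on {0..b} (\<lambda>v. s * exprel (s * v))"
    by (intro continuous_at_imp_continuous_on ballI continuous_intros isCont_o2[OF _ isCont_exprel])
  note FTC = integral_FTC_Icc[OF assms d this]
  have eq: "AE v in lborel. indicator {0..b} v * ((exp (s * v) - 1) / v) = indicator {0..b} v * (s * exprel (s * v))"
    using AE_lborel_singleton[of 0]
  proof eventually_elim
    case (elim v)
    have "(exp (s * v) - 1) / v = s * exprel (s * v)"
      using elim exprel_eq[of "s * v"] by (simp add: field_simps)
    then show ?case by simp
  qed
  show "integrable lborel (\<lambda>v. indicator {0..b} v * ((exp (s * v) - 1) / v))"
    by (rule iffD2[OF integrable_cong_AE[OF _ _ eq] FTC(1)])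
      (use borel_measurable_integrable[OF FTC(1)] in auto)
  show "(\<integral>v. indicator {0..b} v * ((exp (s * v) - 1) / v) \<partial>lborel) = ein (s * b)"
    using FTC(2) integral_cong_AE[OF _ _ eq] borel_measurable_integrable[OF FTC(1)] by simp
qed

subsection \<open>An integral for the Euler constant\<close>

text \<open>With \<open>y = 1 - v / n\<close>, the quotient \<open>(1 - y ^ n) / v\<close> is a geometric sum. Its integral over
  \<open>{0..n}\<close> is a harmonic number, and the remaining \<open>- 1 / v\<close> on \<open>{1..n}\<close> contributes
  \<open>- ln n\<close>.\<close>
lemma euler_integrand_finite:
  fixes n :: nat
  assumes n: "n > 0"
  defines "f \<equiv> \<lambda>v. indicator {0<..} v * ((indicator {..<1} v - indicator {..real n} v * (1 - v / n) ^ n) / v)"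
  shows "integral\<^sup>L lborel f = harm n - ln n"
proof -
  define p where "p v = (\<Sum>k<n. (1 - v / n) ^ k) / n" for v :: real
  define F where "F v = - (\<Sum>k<n. (1 - v / n) ^ Suc k / real (Suc k))" for v :: real
  have p: "(1 - (1 - v / n) ^ n) / v = p v" if "v \<noteq> 0" for v
    using n that one_diff_power_eq[of "1 - v / n" n] by (simp add: p_def field_simps)
  have dF: "(F has_real_derivative p v) (at v)" for v
  proof -
    have "((\<lambda>v. (1 - v / n) ^ Suc k / real (Suc k)) has_real_derivative - ((1 - v / n) ^ k / n)) (at v)" for k
    proof -
      have "((\<lambda>v. 1 - v / n) has_real_derivative - (1 / n)) (at v)"
        using n by (auto intro!: derivative_eq_intros)
      from DERIV_cdivide[OF DERIV_power[OF this, of "Suc k"], of "real (Suc k)"] show ?thesis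
        by (simp del: of_nat_Suc power_Suc)
    qed
    then show ?thesis
      unfolding F_def p_def
      by (auto intro!: DERIV_cong[OF DERIV_minus[OF DERIV_sum]] simp: sum_negf sum_divide_distrib)
  qed
  have contp: "continuous_on S p" for S
    unfolding p_def using n by (auto intro!: continuous_intros)
  have F: "F 0 = - harm n" "F n = 0"
  proof -
    have "(\<Sum>k<n. 1 / real (Suc k)) = harm n"
      unfolding harm_def
      by (rule sum.reindex_bij_witness[of _ "\<lambda>k. k - 1" Suc]) (auto simp: divide_inverse)
    then show "F 0 = - harm n" by (simp add: F_def)
    show "F n = 0" using n by (simp add: F_def)
  qed
  have d2: "((\<lambda>v. F v - ln v) has_real_derivative p v - 1 / v) (at v)" if "1 \<le> v" for v
    using dF that by (auto intro!: derivative_eq_intros)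
  have c2: "continuous_on {1..real n} (\<lambda>v. p v - 1 / v)"
    by (intro continuous_intros contp) auto
  note A = integral_FTC_Icc[OF _ dF contp, of 0 1]
  note B = integral_FTC_Icc[OF _ d2 c2]
  have "AE v in lborel. f v = indicator {0..1} v * p v + indicator {1..real n} v * (p v - 1 / v)"
    using AE_lborel_singleton[of 0] AE_lborel_singleton[of 1]
  proof eventually_elim
    case (elim v)
    then show ?case
      using n by (auto simp: f_def indicator_def p[symmetric] diff_divide_distrib)
  qed
  then have "integral\<^sup>L lborel f = (\<integral>v. indicator {0..1} v * p v + indicator {1..real n} v * (p v - 1 / v) \<partial>lborel)"
    using A(1) B(1) n by (intro integral_cong_AE) (auto simp: f_def)
  also have "\<dots> = (F 1 - F 0) + ((F n - ln n) - (F 1 - ln 1))"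
    using A B n by simp
  finally show ?thesis by (simp add: F)
qed

text \<open>As \<open>(1 - v / n) ^ n\<close> tends to \<open>exp (-v)\<close>, dominated convergence turns the limit of
  \<open>harm n - ln n\<close> into an integral.\<close>
lemma euler_integral:
  defines "G \<equiv> \<lambda>v::real. indicator {0<..} v * ((indicator {..<1} v - exp (- v)) / v)"
  shows "integrable lborel G" "integral\<^sup>L lborel G = euler_mascheroni"
proof -
  define f where "f n v = indicator {0<..} v * ((indicator {..<1} v - indicator {..real n} v * (1 - v / n) ^ n) / v)"
    for n :: nat and v :: real
  define w where "w v = indicator {0..1} v * 1 + indicator {1..} v * exp (- 1 * v)" for v :: real
  have w: "integrable lborel w"
    unfolding w_def using exp_tail(1)[of 1 1]
    by (intro Bochner_Integration.integrable_add integrable_real_indicator integrable_mult_left) auto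
  have lim: "(\<lambda>n. f n v) \<longlonglongrightarrow> G v" for v
  proof -
    have "(\<lambda>n. indicator {..real n} v * (1 - v / n) ^ n) \<longlonglongrightarrow> exp (- v)"
    proof (rule Lim_transform_eventually)
      show "(\<lambda>n. (1 + (- v) / real n) ^ n) \<longlonglongrightarrow> exp (- v)"
        by (rule tendsto_exp_limit_sequentially)
      show "\<forall>\<^sub>F n in sequentially. (1 + (- v) / real n) ^ n = indicator {..real n} v * (1 - v / real n) ^ n"
        using eventually_ge_at_top[of "nat \<lceil>v\<rceil>"]
        by eventually_elim (simp add: indicator_def nat_le_iff ceiling_le_iff)
    qed
    then show ?thesis
      unfolding f_def G_def by (cases "v = 0") (auto intro!: tendsto_intros)
  qed
  have bound: "\<bar>f n v\<bar> \<le> w v" if n: "n > 0" and v: "v \<noteq> 1" for n v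
  proof (cases "0 < v")
    case True
    consider "v < 1" | "1 < v" "v \<le> n" | "1 < v" "n < v" using v by linarith
    then show ?thesis
    proof cases
      case 1
      then have vn: "v \<le> n" using n by (smt (verit) of_nat_0_less_iff of_nat_1 of_nat_mono One_nat_def Suc_leI)
      have "v / n \<le> 1" using vn n by simp
      then have "1 + real n * (- (v / n)) \<le> (1 + (- (v / n))) ^ n"
        by (intro Bernoulli_inequality) simp
      then have "1 - v \<le> (1 - v / n) ^ n" using n by simp
      moreover have "(1 - v / n) ^ n \<le> 1"
        using True \<open>v / n \<le> 1\<close> by (intro power_le_one) auto
      ultimately show ?thesis
        using 1 True vn by (simp add: f_def w_def indicator_def)
    next
      case 2
      have "0 \<le> 1 - v / n" using 2 n by simp
      moreover have "1 - v / n \<le> exp (- (v / n))"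
        using exp_ge_add_one_self[of "- (v / n)"] by simp
      ultimately have "(1 - v / n) ^ n \<le> exp (- (v / n)) ^ n" "0 \<le> (1 - v / n) ^ n"
        by (auto intro: power_mono)
      moreover have "exp (- (v / n)) ^ n = exp (- v)"
        using n by (simp add: exp_of_nat_mult[symmetric])
      moreover have "(1 - v / n) ^ n / v \<le> (1 - v / n) ^ n / 1"
        using 2 \<open>0 \<le> (1 - v / n) ^ n\<close> by (intro divide_left_mono) auto
      ultimately show ?thesis
        using 2 by (simp add: f_def w_def indicator_def)
    next
      case 3
      then show ?thesis using True by (simp add: f_def w_def indicator_def)
    qed
  qed (simp add: f_def w_def indicator_def)
  have ev: "\<forall>\<^sub>F n in sequentially. AE v in lborel. \<bar>f n v\<bar> \<le> w v"
    using eventually_gt_at_top[of 0]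
  proof eventually_elim
    case (elim n)
    show ?case using AE_lborel_singleton[of 1] by eventually_elim (rule bound[OF elim])
  qed
  have meas: "G \<in> borel_measurable lborel" "\<And>n. f n \<in> borel_measurable lborel"
    unfolding G_def f_def by measurable
  note D = dominated_convergence_eventually[OF meas w _ ev]
  show "integrable lborel G"
    by (rule D) (simp add: lim)
  have "(\<lambda>n. integral\<^sup>L lborel (f n)) \<longlonglongrightarrow> integral\<^sup>L lborel G"
    by (rule D) (simp add: lim)
  moreover have "(\<lambda>n. integral\<^sup>L lborel (f n)) \<longlonglongrightarrow> euler_mascheroni"
  proof (rule Lim_transform_eventually[OF euler_mascheroni_LIMSEQ])
    show "\<forall>\<^sub>F n in sequentially. harm n - ln (real n) = integral\<^sup>L lborel (f n)"
      using eventually_gt_at_top[of 0]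
      unfolding f_def[abs_def] by eventually_elim (rule euler_integrand_finite[symmetric])
  qed
  ultimately show "integral\<^sup>L lborel G = euler_mascheroni"
    by (rule LIMSEQ_unique)
qed

subsection \<open>A Frullani integral\<close>

text \<open>\<open>frullani n l\<close> will turn out to be \<open>- ln (1 - \<phi> (-l))\<close>, where \<open>\<phi>\<close> is the moment generating
  function of the gaps at site \<open>n\<close>. It is, up to sign, an iterated difference of \<open>ln\<close> at
  \<open>l\<close>.\<close>
definition frullani :: "nat \<Rightarrow> real \<Rightarrow> real" where
  "frullani k l = (\<integral>u. indicator {0<..} u * (exp (- l * u) * (1 - exp (- u)) ^ Suc k / u) \<partial>lborel)"

lemma frullani_integrable:
  fixes l :: real
  assumes "0 < l"
  shows "integrable lborel (\<lambda>u. indicator {0<..} u * (exp (- l * u) * (1 - exp (- u)) ^ Suc k / u))"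
proof (rule Bochner_Integration.integrable_bound[OF exp_tail(1)[OF assms, of 0]])
  show "AE u in lborel. norm (indicator {0<..} u * (exp (- l * u) * (1 - exp (- u)) ^ Suc k / u))
      \<le> norm (indicator {0..} u * exp (- l * u))"
  proof (rule AE_I2)
    fix u :: real
    show "norm (indicator {0<..} u * (exp (- l * u) * (1 - exp (- u)) ^ Suc k / u))
      \<le> norm (indicator {0..} u * exp (- l * u))"
    proof (cases "0 < u")
      case True
      have q: "0 \<le> 1 - exp (- u)" "1 - exp (- u) \<le> 1" "1 - exp (- u) \<le> u"
        using True exp_ge_add_one_self[of "- u"] by auto
      have "(1 - exp (- u)) ^ Suc k \<le> (1 - exp (- u)) * 1"
        unfolding power_Suc using q by (intro mult_left_mono power_le_one)
      then have "(1 - exp (- u)) ^ Suc k / u \<le> 1" using q True by (simp del: power_Suc)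
      then have "exp (- l * u) * ((1 - exp (- u)) ^ Suc k / u) \<le> exp (- l * u) * 1"
        by (intro mult_left_mono) auto
      moreover have "0 \<le> exp (- l * u) * ((1 - exp (- u)) ^ Suc k / u)"
        using True q by (intro mult_nonneg_nonneg divide_nonneg_nonneg zero_le_power) auto
      ultimately show ?thesis using True by (simp add: indicator_def)
    qed simp
  qed
qed simp

lemma frullani_diff:
  assumes "0 < l"
  shows "frullani k (l + 1) = frullani k l - frullani (Suc k) l"
proof -
  have "exp (- (l + 1) * u) * (1 - exp (- u)) ^ Suc k / u =
      exp (- l * u) * (1 - exp (- u)) ^ Suc k / u - exp (- l * u) * (1 - exp (- u)) ^ Suc (Suc k) / u" for u
  proof -
    have "exp (- (l + 1) * u) = exp (- l * u) * (1 - (1 - exp (- u)))"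
      by (simp add: exp_add[symmetric] algebra_simps)
    then show ?thesis
      by (simp only: power_Suc[of _ "Suc k"]) (simp add: algebra_simps diff_divide_distrib del: power_Suc)
  qed
  then show ?thesis
    unfolding frullani_def
    by (subst Bochner_Integration.integral_diff[symmetric, OF frullani_integrable frullani_integrable])
      (use assms in \<open>auto intro!: Bochner_Integration.integral_cong simp: right_diff_distrib simp del: power_Suc\<close>)
qed

text \<open>The integrand is the integral of \<open>exp (- u x)\<close> over \<open>x\<close> in \<open>{l..l + 1}\<close>; exchange the
  integrals.\<close>
lemma frullani_0:
  assumes l: "0 < l"
  shows "frullani 0 l = ln ((1 + l) / l)"
proof -
  have "ennreal (frullani 0 l) = (\<integral>\<^sup>+u. ennreal (indicator {0<..} u * (exp (- l * u) * (1 - exp (- u)) ^ Suc 0 / u)) \<partial>lborel)"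
    unfolding frullani_def using frullani_integrable[OF l, of 0]
    by (subst nn_integral_eq_integral) (auto simp: indicator_def)
  also have "\<dots> = (\<integral>\<^sup>+u. \<integral>\<^sup>+x. ennreal (exp (- u * x)) * indicator {0..} u * indicator {l..l + 1} x \<partial>lborel \<partial>lborel)"
  proof (rule nn_integral_cong_AE)
    show "AE u in lborel. ennreal (indicator {0<..} u * (exp (- l * u) * (1 - exp (- u)) ^ Suc 0 / u)) =
        (\<integral>\<^sup>+x. ennreal (exp (- u * x)) * indicator {0..} u * indicator {l..l + 1} x \<partial>lborel)"
      using AE_lborel_singleton[of 0]
    proof eventually_elim
      case (elim u)
      show ?case
      proof (cases "0 < u")
        case True
        have "(\<integral>\<^sup>+x. ennreal (exp (- u * x)) * indicator {l..l + 1} x \<partial>lborel) =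
            ennreal (- exp (- u * (l + 1)) / u - (- exp (- u * l) / u))"
          using True by (intro nn_integral_FTC_Icc) (auto intro!: derivative_eq_intros)
        also have "- exp (- u * (l + 1)) / u - (- exp (- u * l) / u) = exp (- l * u) * (1 - exp (- u)) / u"
        proof -
          have "exp (- u * (l + 1)) = exp (- l * u) * exp (- u)"
            by (simp add: exp_add[symmetric] algebra_simps)
          then show ?thesis by (simp add: algebra_simps diff_divide_distrib)
        qed
        finally show ?thesis using True by (simp add: indicator_def)
      qed (use elim in \<open>simp add: indicator_def\<close>)
    qed
  qed
  also have "\<dots> = (\<integral>\<^sup>+x. \<integral>\<^sup>+u. ennreal (exp (- u * x)) * indicator {0..} u * indicator {l..l + 1} x \<partial>lborel \<partial>lborel)"
    by (rule lborel_pair.Fubini') measurable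
  also have "\<dots> = (\<integral>\<^sup>+x. ennreal (1 / x) * indicator {l..l + 1} x \<partial>lborel)"
  proof (rule nn_integral_cong)
    fix x :: real
    show "(\<integral>\<^sup>+u. ennreal (exp (- u * x)) * indicator {0..} u * indicator {l..l + 1} x \<partial>lborel) =
        ennreal (1 / x) * indicator {l..l + 1} x"
    proof (cases "x \<in> {l..l + 1}")
      case True
      then show ?thesis using exp_tail(2)[of x 0] l by (simp add: mult.commute[of _ x])
    qed simp
  qed
  also have "\<dots> = ennreal (ln (l + 1) - ln l)"
    using l by (intro nn_integral_FTC_Icc) (auto intro!: derivative_eq_intros)
  also have "ln (l + 1) - ln l = ln ((1 + l) / l)"
    using l by (simp add: ln_div add.commute)
  finally have "ennreal (frullani 0 l) = ennreal (ln ((1 + l) / l))" .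
  moreover have "0 \<le> frullani 0 l"
    unfolding frullani_def by (intro integral_nonneg_AE) (auto simp: indicator_def)
  moreover have "0 \<le> ln ((1 + l) / l)" using l by simp
  ultimately show ?thesis by (simp add: ennreal_inj)
qed

section \<open>Asymptotics of the moment generating functions\<close>

text \<open>The exponent \<open>K\<^bsub>n\<^esub>(s)\<close> in the moment generating function of the gaps at site \<open>n\<close>.\<close>
definition log_mgf :: "nat \<Rightarrow> real \<Rightarrow> real" where
  "log_mgf n s = (\<Sum>k<n. frullani k (1 - s))"

text \<open>A geometric sum in \<open>q = 1 - exp (-u)\<close> with \<open>1 - q = exp (-u)\<close>.\<close>
lemma log_mgf_integral:
  fixes n :: nat
  assumes s: "s < 1"
  defines "f \<equiv> \<lambda>u::real. indicator {0<..} u * (exp (s * u) * (1 - exp (- u)) * (1 - (1 - exp (- u)) ^ n) / u)"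
  shows "integrable lborel f" "log_mgf n s = integral\<^sup>L lborel f"
proof -
  define g where "g k u = indicator {0<..} u * (exp (- (1 - s) * u) * (1 - exp (- u)) ^ Suc k / u)" for k and u :: real
  have g: "integrable lborel (g k)" for k
    unfolding g_def using s by (intro frullani_integrable) simp
  have "(\<Sum>k<n. g k u) = f u" for u
  proof -
    define q where "q = 1 - exp (- u)"
    have "exp (- (1 - s) * u) = exp (s * u) * (1 - q)"
      by (simp add: q_def exp_add[symmetric] algebra_simps)
    then have "(\<Sum>k<n. g k u) = indicator {0<..} u * (exp (s * u) * q * ((1 - q) * (\<Sum>k<n. q ^ k)) / u)"
      by (simp add: g_def q_def[symmetric] sum_distrib_left sum_divide_distrib mult_ac)
    then show ?thesis
      unfolding one_diff_power_eq[symmetric] by (simp add: f_def q_def)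
  qed
  then have f: "f = (\<lambda>u. \<Sum>k<n. g k u)" by auto
  show "integrable lborel f" unfolding f using g by simp
  show "log_mgf n s = integral\<^sup>L lborel f"
  proof -
    have "frullani k (1 - s) = integral\<^sup>L lborel (g k)" for k
      unfolding frullani_def g_def[abs_def] ..
    then show ?thesis
      unfolding f log_mgf_def using g by simp
  qed
qed

text \<open>For \<open>L = ln n\<close> both terms grow with \<open>n\<close>. As \<open>ln (1 + L)\<close> is the Frullani integral at
  \<open>1 / L\<close>, the difference is one integral; its integrand stays bounded near \<open>0\<close> as \<open>n\<close> grows.\<close>
lemma log_mgf_scaled:
  assumes L: "0 < L" "s < L"
  defines "q \<equiv> \<lambda>v. 1 - exp (- L * v)"
  shows "log_mgf n (s / L) - ln (1 + L) =
    (\<integral>v. indicator {0<..} v * ((exp (s * v) * (1 - q v ^ n) - exp (- v)) * q v / v) \<partial>lborel)"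
proof -
  define f where "f u = indicator {0<..} u * (exp (s / L * u) * (1 - exp (- u)) * (1 - (1 - exp (- u)) ^ n) / u)" for u :: real
  define g where "g u = indicator {0<..} u * (exp (- (1 / L) * u) * (1 - exp (- u)) ^ Suc 0 / u)" for u :: real
  have sL: "s / L < 1" using L by simp
  have "ln (1 + L) = frullani 0 (1 / L)"
  proof -
    have "(1 + 1 / L) / (1 / L) = 1 + L" using L by (simp add: distrib_right)
    then show ?thesis using L by (subst frullani_0) simp_all
  qed
  then have "log_mgf n (s / L) - ln (1 + L) = integral\<^sup>L lborel f - integral\<^sup>L lborel g"
    using log_mgf_integral(2)[OF sL, of n] by (simp only: f_def[abs_def] g_def[abs_def] frullani_def)
  also have "\<dots> = (\<integral>u. f u - g u \<partial>lborel)"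
    using log_mgf_integral(1)[OF sL, of n] frullani_integrable[of "1 / L" 0] L
    by (subst Bochner_Integration.integral_diff) (simp_all add: f_def[abs_def] g_def[abs_def])
  also have "\<dots> = \<bar>L\<bar> *\<^sub>R (\<integral>v. f (0 + L * v) - g (0 + L * v) \<partial>lborel)"
    using L by (intro lborel_integral_real_affine) simp
  also have "\<dots> = (\<integral>v. L * (f (L * v) - g (L * v)) \<partial>lborel)"
    using L by simp
  also have "\<dots> = (\<integral>v. indicator {0<..} v * ((exp (s * v) * (1 - q v ^ n) - exp (- v)) * q v / v) \<partial>lborel)"
  proof (rule Bochner_Integration.integral_cong[OF refl])
    fix v :: real
    have "(0 < L * v) = (0 < v)" using L by (simp add: zero_less_mult_iff)
    then show "L * (f (L * v) - g (L * v)) =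
        indicator {0<..} v * ((exp (s * v) * (1 - q v ^ n) - exp (- v)) * q v / v)"
      using L by (simp add: f_def g_def q_def indicator_def field_simps)
  qed
  finally show ?thesis .
qed

lemma exp_diff_le:
  fixes s v :: real
  assumes "0 \<le> v"
  shows "\<bar>exp (s * v) - 1\<bar> \<le> \<bar>s\<bar> * v * exp (\<bar>s\<bar> * v)"
proof -
  have *: "exp y - 1 \<le> y * exp y" for y :: real
    using exp_ge_add_one_self[of "- y"] mult_left_mono[of "1 - y" "exp (- y)" "exp y"]
    by (simp add: algebra_simps exp_add[symmetric])
  show ?thesis
  proof (cases "0 \<le> s")
    case True
    then show ?thesis using *[of "s * v"] assms by simp
  next
    case False
    have "1 - exp (s * v) \<le> \<bar>s\<bar> * v"
    proof -
      have "\<bar>s\<bar> * v = - (s * v)" using False by simp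
      then show ?thesis using exp_ge_add_one_self[of "s * v"] by linarith
    qed
    also have "\<dots> \<le> \<bar>s\<bar> * v * exp (\<bar>s\<bar> * v)"
      using assms mult_left_mono[of 1 "exp (\<bar>s\<bar> * v)" "\<bar>s\<bar> * v"] by simp
    finally show ?thesis
      using assms False by (simp add: mult_nonpos_nonneg)
  qed
qed

lemma power_exp_small: "\<lbrakk>0 \<le> x; x \<le> 1\<rbrakk> \<Longrightarrow> (1 - x) ^ n \<le> exp (- real n * x)" for x :: real
proof -
  assume x: "0 \<le> x" "x \<le> 1"
  have "(1 - x) ^ n \<le> exp (- x) ^ n"
    using x exp_ge_add_one_self[of "- x"] by (intro power_mono) auto
  then show ?thesis by (simp add: exp_of_nat_mult[symmetric])
qed

lemma power_diff_small: "\<lbrakk>0 \<le> x; x \<le> 1\<rbrakk> \<Longrightarrow> 1 - (1 - x) ^ n \<le> real n * x" for x :: real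
  using Bernoulli_inequality[of "- x" n] by simp

text \<open>Dominated convergence. The integrand is controlled separately near \<open>0\<close>, where
  \<open>q n v ^ n\<close> is at most \<open>exp (- sqrt n)\<close> and beats the factor \<open>q n v / v \<le> ln n\<close>, on a bounded
  interval around \<open>1\<close>, where every factor is bounded, and for \<open>v > 2\<close>, where
  \<open>1 - q n v ^ n \<le> n powr (1 - v)\<close> beats \<open>exp (s v)\<close> as soon as \<open>ln n \<ge> 2 (\<bar>s\<bar> + 1)\<close>.\<close>
lemma log_mgf_limit:
  "(\<lambda>n. log_mgf n (s / ln (real n)) - ln (1 + ln (real n))) \<longlonglongrightarrow> euler_mascheroni + ein s"
proof -
  define q where "q n v = 1 - exp (- ln (real n) * v)" for n :: nat and v :: real
  define h where "h n v = indicator {0<..} v * ((exp (s * v) * (1 - q n v ^ n) - exp (- v)) * q n v / v)" for n and v :: real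
  define f where "f v = indicator {0<..} v * ((indicator {..<1} v * exp (s * v) - exp (- v)) / v)" for v :: real
  \<comment> \<open>The dominating function is \<open>C\<close> up to \<open>2\<close>, and \<open>2 exp (-v)\<close> beyond.\<close>
  define C where "C = 2 * (\<bar>s\<bar> + 2) * exp (2 * \<bar>s\<bar>)"
  define w where "w v = indicator {0..2} v * C + indicator {2..} v * exp (- 1 * v) * 2" for v :: real
  have ln_top: "filterlim (\<lambda>n. ln (real n)) at_top sequentially"
    by (rule filterlim_compose[OF ln_at_top filterlim_real_sequentially])
  have exp_half: "(\<lambda>n. ln (real n) * exp (- sqrt (real n))) \<longlonglongrightarrow> 0"
  proof -
    have "((\<lambda>x. x ^ 1 / exp x) \<longlongrightarrow> (0::real)) at_top"
      by (rule tendsto_power_div_exp_0)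
    moreover have sq: "filterlim (\<lambda>n. sqrt (real n)) at_top sequentially"
      by (rule filterlim_compose[OF sqrt_at_top filterlim_real_sequentially])
    ultimately have "(\<lambda>n. sqrt (real n) ^ 1 / exp (sqrt (real n))) \<longlonglongrightarrow> 0"
      by (rule filterlim_compose)
    then have lim: "(\<lambda>n. 2 * (sqrt (real n) * exp (- sqrt (real n)))) \<longlonglongrightarrow> 0"
      by (auto simp: exp_minus divide_inverse intro!: tendsto_mult_right_zero)
    show ?thesis
    proof (rule tendsto_sandwich[OF _ _ tendsto_const lim])
      show "\<forall>\<^sub>F n in sequentially. 0 \<le> ln (real n) * exp (- sqrt (real n))"
        using eventually_ge_at_top[of 1] by eventually_elim simp
      show "\<forall>\<^sub>F n in sequentially. ln (real n) * exp (- sqrt (real n)) \<le> 2 * (sqrt (real n) * exp (- sqrt (real n)))"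
        using eventually_ge_at_top[of 1]
      proof eventually_elim
        case (elim n)
        have "ln (real n) = 2 * ln (sqrt (real n))"
          using elim by (simp add: ln_sqrt)
        also have "\<dots> \<le> 2 * sqrt (real n)"
          using ln_le_minus_one[of "sqrt (real n)"] elim by simp
        finally show ?case by (simp add: mult_right_mono)
      qed
    qed
  qed
  have w: "integrable lborel w"
    unfolding w_def using exp_tail(1)[of 1 2]
    by (intro Bochner_Integration.integrable_add integrable_real_indicator integrable_mult_left) auto
  have lim: "(\<lambda>n. h n v) \<longlonglongrightarrow> f v" if v: "v \<noteq> 1" for v
  proof (cases "0 < v")
    case True
    have e0: "(\<lambda>n. exp (- ln (real n) * v)) \<longlonglongrightarrow> 0"
    proof -
      have "filterlim (\<lambda>n. v * ln (real n)) at_top sequentially"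
        by (rule filterlim_tendsto_pos_mult_at_top[OF tendsto_const True ln_top])
      then have "filterlim (\<lambda>n. - (v * ln (real n))) at_bot sequentially"
        by (simp add: filterlim_uminus_at_bot)
      from filterlim_compose[OF exp_at_bot this] show ?thesis by (simp add: mult.commute)
    qed
    have q1: "(\<lambda>n. q n v) \<longlonglongrightarrow> 1"
      unfolding q_def using tendsto_diff[OF tendsto_const[of 1] e0] by simp
    have e: "real n * exp (- ln (real n) * v) = exp (ln (real n) * (1 - v))" if "n \<ge> 1" for n
    proof -
      have "real n = exp (ln (real n))" using that by simp
      then have "real n * exp (- ln (real n) * v) = exp (ln (real n)) * exp (- ln (real n) * v)" by metis
      then show ?thesis by (simp add: exp_add[symmetric] algebra_simps)
    qed
    have x: "0 \<le> exp (- ln (real n) * v)" "exp (- ln (real n) * v) \<le> 1" if "n \<ge> 1" for n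
      using that True by auto
    have "(\<lambda>n. q n v ^ n) \<longlonglongrightarrow> 1 - indicator {..<1} v"
    proof (cases "v < 1")
      case True
      have "filterlim (\<lambda>n. ln (real n) * (1 - v)) at_top sequentially"
        using True by (intro filterlim_at_top_mult_tendsto_pos[OF tendsto_const _ ln_top]) simp
      from filterlim_compose[OF exp_at_top this]
      have "filterlim (\<lambda>n. - exp (ln (real n) * (1 - v))) at_bot sequentially"
        by (simp add: filterlim_uminus_at_bot)
      from filterlim_compose[OF exp_at_bot this]
      have lim: "(\<lambda>n. exp (- exp (ln (real n) * (1 - v)))) \<longlonglongrightarrow> 0" .
      have "(\<lambda>n. q n v ^ n) \<longlonglongrightarrow> 0"
      proof (rule tendsto_sandwich[OF _ _ tendsto_const lim])
        show "\<forall>\<^sub>F n in sequentially. 0 \<le> q n v ^ n"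
          using eventually_ge_at_top[of 1] by eventually_elim (use x in \<open>simp add: q_def\<close>)
        show "\<forall>\<^sub>F n in sequentially. q n v ^ n \<le> exp (- exp (ln (real n) * (1 - v)))"
          using eventually_ge_at_top[of 1]
        proof eventually_elim
          case (elim n)
          show ?case
            using power_exp_small[OF x[OF elim], of n] e[OF elim] unfolding q_def by simp
        qed
      qed
      then show ?thesis using True by simp
    next
      case False
      then have v1: "1 < v" using v by simp
      have "filterlim (\<lambda>n. ln (real n) * (v - 1)) at_top sequentially"
        using v1 by (intro filterlim_at_top_mult_tendsto_pos[OF tendsto_const _ ln_top]) simp
      then have "filterlim (\<lambda>n. - (ln (real n) * (v - 1))) at_bot sequentially"
        by (simp add: filterlim_uminus_at_bot)
      from filterlim_compose[OF exp_at_bot this]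
      have "(\<lambda>n. exp (ln (real n) * (1 - v))) \<longlonglongrightarrow> 0" by (simp add: algebra_simps)
      from tendsto_diff[OF tendsto_const[of 1] this]
      have lim: "(\<lambda>n. 1 - exp (ln (real n) * (1 - v))) \<longlonglongrightarrow> 1" by simp
      have "(\<lambda>n. q n v ^ n) \<longlonglongrightarrow> 1"
      proof (rule tendsto_sandwich[OF _ _ lim tendsto_const])
        show "\<forall>\<^sub>F n in sequentially. q n v ^ n \<le> 1"
          using eventually_ge_at_top[of 1] by eventually_elim (use x in \<open>auto simp: q_def intro!: power_le_one\<close>)
        show "\<forall>\<^sub>F n in sequentially. 1 - exp (ln (real n) * (1 - v)) \<le> q n v ^ n"
          using eventually_ge_at_top[of 1]
        proof eventually_elim
          case (elim n)
          show ?case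
            using power_diff_small[OF x[OF elim], of n] e[OF elim] unfolding q_def by simp
        qed
      qed
      then show ?thesis using False by simp
    qed
    from tendsto_diff[OF tendsto_const[of 1] this]
    have "(\<lambda>n. 1 - q n v ^ n) \<longlonglongrightarrow> indicator {..<1} v" by simp
    then have "(\<lambda>n. h n v) \<longlonglongrightarrow> indicator {0<..} v * ((exp (s * v) * indicator {..<1} v - exp (- v)) * 1 / v)"
      unfolding h_def using True by (intro tendsto_intros q1) auto
    then show ?thesis by (simp add: f_def mult.commute)
  qed (simp add: h_def f_def)
  have bound: "\<bar>h n v\<bar> \<le> w v"
    if n: "n \<ge> 1" and L: "ln (real n) \<ge> 2 * (\<bar>s\<bar> + 1)" and small: "ln (real n) * exp (- sqrt (real n)) \<le> 1"
    for n and v :: real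
  proof (cases "0 < v")
    case True
    define x where "x = exp (- ln (real n) * v)"
    have L0: "0 < ln (real n)" by (rule less_le_trans[OF _ L]) (simp add: add_nonneg_pos)
    have x: "0 \<le> x" "x \<le> 1" using True L0 by (auto simp: x_def)
    have q: "0 \<le> q n v" "q n v \<le> 1" "q n v = 1 - x" using x by (auto simp: q_def x_def)
    have qn: "0 \<le> q n v ^ n" "q n v ^ n \<le> 1" using q by (auto intro: power_le_one)
    have es: "exp (s * v) \<le> exp (\<bar>s\<bar> * v)" using True by simp
    have C2: "2 * exp (\<bar>s\<bar> * 2) \<le> C / 2" unfolding C_def by (simp add: algebra_simps)
    consider "v \<le> 1 / 2" | "1 / 2 < v" "v \<le> 2" | "2 < v" by linarith
    then show ?thesis
    proof cases
      case 1
      have sv: "\<bar>s\<bar> * v \<le> 2 * \<bar>s\<bar>" using 1 True by (simp add: mult.commute[of "\<bar>s\<bar>"] mult_right_mono)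
      have E: "exp (\<bar>s\<bar> * v) \<le> exp (2 * \<bar>s\<bar>)" using sv by simp
      have E1: "1 \<le> exp (2 * \<bar>s\<bar>)" by simp
      have E2: "exp (s * v) \<le> exp (2 * \<bar>s\<bar>)" using es E by (rule order_trans)
      have "\<bar>exp (s * v) - exp (- v)\<bar> \<le> \<bar>exp (s * v) - 1\<bar> + \<bar>1 - exp (- v)\<bar>" by linarith
      also have "\<dots> \<le> \<bar>s\<bar> * v * exp (\<bar>s\<bar> * v) + v"
        using exp_diff_le[of v s] exp_ge_add_one_self[of "- v"] True by (intro add_mono) auto
      also have "\<dots> \<le> \<bar>s\<bar> * v * exp (2 * \<bar>s\<bar>) + v * exp (2 * \<bar>s\<bar>)"
        using True E E1 by (intro add_mono mult_left_mono) auto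
      finally have a: "\<bar>exp (s * v) - exp (- v)\<bar> / v \<le> (\<bar>s\<bar> + 1) * exp (2 * \<bar>s\<bar>)"
        using True by (simp add: field_simps)
      have "x \<ge> exp (- ln (real n) * (1 / 2))"
        using 1 L0 unfolding x_def by simp
      moreover have "real n * exp (- ln (real n) * (1 / 2)) = sqrt (real n)"
      proof -
        have "real n * exp (- ln (real n) * (1 / 2)) = exp (ln (real n)) * exp (- ln (real n) * (1 / 2))"
          using n by simp
        also have "\<dots> = exp (ln (sqrt (real n)))"
          using n by (simp only: exp_add[symmetric]) (simp add: ln_sqrt)
        finally show ?thesis using n by simp
      qed
      ultimately have "sqrt (real n) \<le> real n * x"
        using n by (metis mult_left_mono of_nat_0_le_iff)
      then have "q n v ^ n \<le> exp (- sqrt (real n))"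
        using power_exp_small[OF x, of n] q by (simp add: order_trans)
      moreover have "q n v / v \<le> ln (real n)"
        using True exp_ge_add_one_self[of "- ln (real n) * v"] by (simp add: q_def field_simps)
      ultimately have "q n v / v * q n v ^ n \<le> ln (real n) * exp (- sqrt (real n))"
        using L0 q qn True by (intro mult_mono) auto
      then have b: "q n v / v * q n v ^ n \<le> 1" using small by simp
      have "h n v = (exp (s * v) - exp (- v)) / v * q n v - exp (s * v) * (q n v / v * q n v ^ n)"
        using True by (simp add: h_def algebra_simps diff_divide_distrib add_divide_distrib)
      also have "\<bar>\<dots>\<bar> \<le> \<bar>exp (s * v) - exp (- v)\<bar> / v * q n v + exp (s * v) * (q n v / v * q n v ^ n)"
        using True q qn by (intro order_trans[OF abs_triangle_ineq4] add_mono) (auto simp: abs_mult)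
      also have "\<dots> \<le> (\<bar>s\<bar> + 1) * exp (2 * \<bar>s\<bar>) * 1 + exp (2 * \<bar>s\<bar>) * 1"
        using a b q qn True by (intro add_mono mult_mono E2) auto
      also have "\<dots> \<le> C" unfolding C_def by (simp add: algebra_simps)
      finally show ?thesis using 1 True by (simp add: w_def indicator_def)
    next
      case 2
      have "exp (\<bar>s\<bar> * v) \<le> exp (\<bar>s\<bar> * 2)" using 2 by (simp add: mult_left_mono)
      with es have E: "exp (s * v) \<le> exp (\<bar>s\<bar> * 2)" by (rule order_trans)
      have "\<bar>exp (s * v) * (1 - q n v ^ n) - exp (- v)\<bar> \<le> exp (s * v) * (1 - q n v ^ n) + exp (- v)"
        using qn by (intro order_trans[OF abs_triangle_ineq4]) (auto simp: abs_mult)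
      also have "\<dots> \<le> exp (\<bar>s\<bar> * 2) * 1 + 1"
        using qn 2 by (intro add_mono mult_mono E) auto
      also have "\<dots> \<le> 2 * exp (\<bar>s\<bar> * 2)" by simp
      finally have "\<bar>exp (s * v) * (1 - q n v ^ n) - exp (- v)\<bar> \<le> 2 * exp (\<bar>s\<bar> * 2)" .
      moreover have "q n v / v \<le> 2" using q 2 by (simp add: divide_le_eq)
      ultimately have "\<bar>exp (s * v) * (1 - q n v ^ n) - exp (- v)\<bar> * (q n v / v) \<le> 2 * exp (\<bar>s\<bar> * 2) * 2"
        using q True by (intro mult_mono) auto
      also have "\<dots> \<le> C" using C2 by simp
      finally have "\<bar>h n v\<bar> \<le> C" using True q by (simp add: h_def abs_mult)
      also have "C \<le> w v" using 2 by (simp add: w_def indicator_def)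
      finally show ?thesis .
    next
      case 3
      have "exp (s * v) * (1 - q n v ^ n) \<le> exp (\<bar>s\<bar> * v) * (real n * x)"
        using es power_diff_small[OF x, of n] q qn by (intro mult_mono) auto
      also have "real n * x = exp (ln (real n)) * x" using n by simp
      also have "exp (\<bar>s\<bar> * v) * \<dots> = exp (\<bar>s\<bar> * v + (ln (real n) + - ln (real n) * v))"
        by (simp only: x_def exp_add)
      also have "\<dots> \<le> exp (- v)"
      proof -
        have "(\<bar>s\<bar> + 1) * v \<le> ln (real n) / 2 * v"
          using L True by (intro mult_right_mono) auto
        moreover have "ln (real n) / 2 * v \<le> ln (real n) * (v - 1)"
          using L0 3 by (simp add: field_simps)
        ultimately show ?thesis by (simp add: algebra_simps)
      qed
      finally have e: "exp (s * v) * (1 - q n v ^ n) \<le> exp (- v)" .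
      have "\<bar>exp (s * v) * (1 - q n v ^ n) - exp (- v)\<bar> \<le> exp (s * v) * (1 - q n v ^ n) + exp (- v)"
        using qn by (intro order_trans[OF abs_triangle_ineq4]) (auto simp: abs_mult)
      then have "\<bar>exp (s * v) * (1 - q n v ^ n) - exp (- v)\<bar> \<le> 2 * exp (- v)" using e by simp
      moreover have "q n v / v \<le> 1" using q 3 by (simp add: divide_le_eq)
      ultimately have "\<bar>exp (s * v) * (1 - q n v ^ n) - exp (- v)\<bar> * (q n v / v) \<le> 2 * exp (- v) * 1"
        using q True by (intro mult_mono) auto
      then show ?thesis using 3 True q by (simp add: h_def w_def indicator_def abs_mult)
    qed
  next
    case False
    have "0 \<le> C" by (simp add: C_def)
    then show ?thesis using False by (simp add: h_def w_def indicator_def)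
  qed
  have large: "\<forall>\<^sub>F n in sequentially. ln (real n) \<ge> 2 * (\<bar>s\<bar> + 1)"
    using ln_top by (simp add: filterlim_at_top)
  have small: "\<forall>\<^sub>F n in sequentially. ln (real n) * exp (- sqrt (real n)) \<le> 1"
    using order_tendstoD(2)[OF exp_half, of 1] by (auto elim: eventually_mono)
  have ev: "\<forall>\<^sub>F n in sequentially. AE v in lborel. \<bar>h n v\<bar> \<le> w v"
    using eventually_ge_at_top[of 1] large small
    by eventually_elim (simp add: bound)
  have limAE: "AE v in lborel. (\<lambda>n. h n v) \<longlonglongrightarrow> f v"
    using AE_lborel_singleton[of 1] by eventually_elim (rule lim)
  have meas: "f \<in> borel_measurable lborel" "\<And>n. h n \<in> borel_measurable lborel"
    unfolding f_def h_def q_def by measurable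
  have conv: "(\<lambda>n. integral\<^sup>L lborel (h n)) \<longlonglongrightarrow> integral\<^sup>L lborel f"
    by (rule dominated_convergence_eventually(2)[OF meas w limAE ev])
  have "integral\<^sup>L lborel f = euler_mascheroni + ein s"
  proof -
    have "AE v in lborel. f v = indicator {0<..} v * ((indicator {..<1} v - exp (- v)) / v)
        + indicator {0..1} v * ((exp (s * v) - 1) / v)"
      using AE_lborel_singleton[of 0] AE_lborel_singleton[of 1]
      by eventually_elim (auto simp: f_def indicator_def add_divide_distrib[symmetric])
    then have "integral\<^sup>L lborel f = (\<integral>v. indicator {0<..} v * ((indicator {..<1} v - exp (- v)) / v)
        + indicator {0..1} v * ((exp (s * v) - 1) / v) \<partial>lborel)"
      using meas by (intro integral_cong_AE) auto
    also have "\<dots> = euler_mascheroni + ein (s * 1)"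
      using euler_integral ein_integral[of 1 s] by (subst Bochner_Integration.integral_add) simp_all
    finally show ?thesis by simp
  qed
  with conv have "(\<lambda>n. integral\<^sup>L lborel (h n)) \<longlonglongrightarrow> euler_mascheroni + ein s" by simp
  then show ?thesis
  proof (rule Lim_transform_eventually)
    show "\<forall>\<^sub>F n in sequentially. integral\<^sup>L lborel (h n) = log_mgf n (s / ln (real n)) - ln (1 + ln (real n))"
      using large
    proof eventually_elim
      case (elim n)
      have "0 < 2 * (t + 1)" "s < 2 * (t + 1)" if "0 \<le> t" "s \<le> t" for t :: real
        using that by auto
      from this[of "\<bar>s\<bar>"] have "0 < ln (real n)" "s < ln (real n)"
        using elim by (auto intro: less_le_trans)
      from log_mgf_scaled[OF this, of n] show ?case by (simp add: h_def[abs_def] q_def)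
    qed
  qed
qed

section \<open>Convergence of moment generating functions\<close>

lemma integrable_bounded_real_distribution:
  assumes "real_distribution \<mu>" "f \<in> borel_measurable borel" "\<And>x. \<bar>f x\<bar> \<le> (B::real)"
  shows "integrable \<mu> f"
proof -
  interpret real_distribution \<mu> by fact
  show ?thesis
    using assms by (intro integrable_const_bound[where B=B]) auto
qed

text \<open>On \<open>{0..1}\<close> the function \<open>g\<close> is a uniform limit of polynomials, and the integrals of the
  powers of \<open>exp (-x)\<close> agree.\<close>
lemma laplace_determines_continuous:
  assumes \<mu>: "real_distribution \<mu>" "AE x in \<mu>. 0 \<le> x" and \<nu>: "real_distribution \<nu>" "AE x in \<nu>. 0 \<le> x"
    and eq: "\<And>k::nat. (\<integral>x. exp (- real k * x) \<partial>\<mu>) = (\<integral>x. exp (- real k * x) \<partial>\<nu>)"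
    and g: "continuous_on UNIV (g :: real \<Rightarrow> real)" "\<And>y. \<bar>g y\<bar> \<le> B"
  shows "(\<integral>x. g (exp (- x)) \<partial>\<mu>) = (\<integral>x. g (exp (- x)) \<partial>\<nu>)"
proof -
  interpret M: real_distribution \<mu> by fact
  interpret N: real_distribution \<nu> by fact
  have [measurable]: "g \<in> borel_measurable borel" using g(1) by (rule borel_measurable_continuous_onI)
  have int_exp: "integrable \<kappa> (\<lambda>x. exp (- real k * x))"
    if "real_distribution \<kappa>" "AE x in \<kappa>. 0 \<le> x" for \<kappa> :: "real measure" and k
  proof -
    interpret real_distribution \<kappa> by fact
    show ?thesis
      using that(2) by (intro integrable_const_bound[where B=1]) (auto elim!: eventually_mono)
  qed
  have close: "\<bar>(\<integral>x. g (exp (- x)) \<partial>\<mu>) - (\<integral>x. g (exp (- x)) \<partial>\<nu>)\<bar> \<le> 2 * e" if e: "0 < e" for e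
  proof -
    obtain p where p: "real_polynomial_function p" "\<And>y. y \<in> {0..1} \<Longrightarrow> \<bar>g y - p y\<bar> < e"
      using Stone_Weierstrass_real_polynomial_function[of "{0..1}" g e] e g(1)
      by (auto intro: continuous_on_subset)
    then obtain a n where a: "p = (\<lambda>y. \<Sum>i\<le>n. a i * y ^ i)"
      unfolding real_polynomial_function_iff_sum by blast
    have pe: "p (exp (- x)) = (\<Sum>i\<le>n. a i * exp (- real i * x))" for x
      by (simp add: a exp_of_nat_mult[symmetric])
    have peq: "(\<integral>x. p (exp (- x)) \<partial>\<mu>) = (\<integral>x. p (exp (- x)) \<partial>\<nu>)"
      unfolding pe using int_exp[OF \<mu>] int_exp[OF \<nu>] eq by simp
    have dist: "\<bar>(\<integral>x. g (exp (- x)) \<partial>\<kappa>) - (\<integral>x. p (exp (- x)) \<partial>\<kappa>)\<bar> \<le> e"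
      if \<kappa>: "real_distribution \<kappa>" "AE x in \<kappa>. 0 \<le> x" for \<kappa> :: "real measure"
    proof -
      interpret real_distribution \<kappa> by fact
      have i: "integrable \<kappa> (\<lambda>x. g (exp (- x)))"
        by (rule integrable_bounded_real_distribution[OF \<kappa>(1), of _ B]) (simp_all add: g)
      have j: "integrable \<kappa> (\<lambda>x. p (exp (- x)))"
        unfolding pe using int_exp[OF \<kappa>] by simp
      have "\<bar>\<integral>x. g (exp (- x)) - p (exp (- x)) \<partial>\<kappa>\<bar> \<le> (\<integral>x. \<bar>g (exp (- x)) - p (exp (- x))\<bar> \<partial>\<kappa>)"
        by (rule integral_abs_bound)
      also have "\<dots> \<le> (\<integral>x. e \<partial>\<kappa>)"
        using \<kappa>(2) i j by (intro integral_mono_AE) (auto elim!: eventually_mono intro!: less_imp_le p(2))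
      finally show ?thesis using i j prob_space by simp
    qed
    show ?thesis using dist[OF \<mu>] dist[OF \<nu>] peq by linarith
  qed
  have "\<bar>(\<integral>x. g (exp (- x)) \<partial>\<mu>) - (\<integral>x. g (exp (- x)) \<partial>\<nu>)\<bar> \<le> 0"
  proof (rule field_le_epsilon)
    fix e :: real assume "0 < e"
    then show "\<bar>(\<integral>x. g (exp (- x)) \<partial>\<mu>) - (\<integral>x. g (exp (- x)) \<partial>\<nu>)\<bar> \<le> 0 + e"
      using close[of "e / 2"] by simp
  qed
  then show ?thesis by simp
qed

text \<open>The distribution functions agree: the indicator of \<open>{..a}\<close>, written in terms of
  \<open>y = exp (-x)\<close>, is the indicator of \<open>y \<ge> exp (-a)\<close>, a pointwise limit of continuous ramps.\<close>
lemma laplace_unique: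
  assumes \<mu>: "real_distribution \<mu>" "AE x in \<mu>. 0 \<le> x" and \<nu>: "real_distribution \<nu>" "AE x in \<nu>. 0 \<le> x"
    and eq: "\<And>k::nat. (\<integral>x. exp (- real k * x) \<partial>\<mu>) = (\<integral>x. exp (- real k * x) \<partial>\<nu>)"
  shows "\<mu> = \<nu>"
proof (rule cdf_unique[OF \<mu>(1) \<nu>(1)], rule ext)
  fix a :: real
  define g where "g k y = min 1 (max 0 (1 + real k * (y - exp (- a))))" for k :: nat and y :: real
  have g01: "\<bar>g k y\<bar> \<le> 1" for k y by (simp add: g_def)
  have gc: "continuous_on UNIV (g k)" for k
    unfolding g_def by (intro continuous_intros)
  have [measurable]: "g k \<in> borel_measurable borel" for k
    using gc by (rule borel_measurable_continuous_onI)
  have lim: "(\<lambda>k. \<integral>x. g k (exp (- x)) \<partial>\<kappa>) \<longlonglongrightarrow> cdf \<kappa> a" if "real_distribution \<kappa>" for \<kappa>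
  proof -
    interpret real_distribution \<kappa> by fact
    have "(\<lambda>k. g k (exp (- x))) \<longlonglongrightarrow> indicator {..a} x" for x
    proof (cases "x \<le> a")
      case True
      then have "g k (exp (- x)) = 1" for k by (simp add: g_def)
      then show ?thesis using True by simp
    next
      case False
      then have d: "0 < exp (- a) - exp (- x)" by simp
      obtain K :: nat where K: "1 < real K * (exp (- a) - exp (- x))"
        using ex_less_of_nat_mult[OF d] by blast
      have "g k (exp (- x)) = 0" if "k \<ge> K" for k
      proof -
        have "real K * (exp (- a) - exp (- x)) \<le> real k * (exp (- a) - exp (- x))"
          using that d by (intro mult_right_mono) auto
        then have "1 + real k * (exp (- x) - exp (- a)) \<le> 0" using K by (simp add: algebra_simps)
        then show ?thesis by (simp add: g_def)
      qed
      then have "\<forall>\<^sub>F k in sequentially. g k (exp (- x)) = 0"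
        by (auto simp: eventually_sequentially)
      then show ?thesis using False by (simp add: tendsto_eventually)
    qed
    then have "(\<lambda>k. \<integral>x. g k (exp (- x)) \<partial>\<kappa>) \<longlonglongrightarrow> (\<integral>x. indicator {..a} x \<partial>\<kappa>)"
      using g01 by (intro integral_dominated_convergence[where w="\<lambda>_. 1"]) auto
    then show ?thesis by (simp add: cdf_def)
  qed
  have "(\<integral>x. g k (exp (- x)) \<partial>\<mu>) = (\<integral>x. g k (exp (- x)) \<partial>\<nu>)" for k
    by (rule laplace_determines_continuous[OF \<mu> \<nu> eq gc g01])
  then show "cdf \<mu> a = cdf \<nu> a"
    using lim[OF \<mu>(1)] lim[OF \<nu>(1)] LIMSEQ_unique by simp
qed

text \<open>Weak convergence controls the bounded functions \<open>min (exp (s x)) c\<close>. Truncation at \<open>c\<close> costs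
  at most \<open>exp (2 s x) / c\<close>, whose integrals stay bounded by the convergence at \<open>2 s\<close>; let \<open>c\<close>
  tend to infinity.\<close>
lemma weak_limit_mgf:
  fixes \<nu> :: "nat \<Rightarrow> real measure" and \<Phi> :: "real \<Rightarrow> real"
  assumes \<nu>: "\<And>n. real_distribution (\<nu> n)" "\<And>n. AE x in \<nu> n. 0 \<le> x"
    and int: "\<And>s. \<forall>\<^sub>F n in sequentially. integrable (\<nu> n) (\<lambda>x. exp (s * x))"
    and lim: "\<And>s. (\<lambda>n. \<integral>x. exp (s * x) \<partial>\<nu> n) \<longlonglongrightarrow> \<Phi> s"
    and \<kappa>: "real_distribution \<kappa>" "weak_conv_m \<nu> \<kappa>"
  shows "AE x in \<kappa>. 0 \<le> x" "integrable \<kappa> (\<lambda>x. exp (s * x))" "(\<integral>x. exp (s * x) \<partial>\<kappa>) = \<Phi> s"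
proof -
  interpret K: real_distribution \<kappa> by fact
  note weak = weak_conv_imp_integral_bdd_continuous_conv[OF \<nu>(1) \<kappa>]
  show "AE x in \<kappa>. 0 \<le> x"
  proof -
    let ?f = "\<lambda>x::real. min 1 (max 0 (- x))"
    have "(\<lambda>n. \<integral>x. ?f x \<partial>\<nu> n) \<longlonglongrightarrow> (\<integral>x. ?f x \<partial>\<kappa>)"
      by (rule weak[where B=1]) (auto intro!: continuous_intros)
    moreover have "(\<integral>x. ?f x \<partial>\<nu> n) = 0" for n
      using \<nu>(2)[of n] by (intro integral_eq_zero_AE) (auto elim!: eventually_mono)
    ultimately have "(\<integral>x. ?f x \<partial>\<kappa>) = 0" by (simp add: LIMSEQ_const_iff)
    moreover have "integrable \<kappa> ?f"
      by (rule integrable_bounded_real_distribution[OF \<kappa>(1), of _ 1]) auto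
    ultimately have "AE x in \<kappa>. ?f x = 0"
      by (subst (asm) integral_nonneg_eq_0_iff_AE) auto
    then show ?thesis by eventually_elim (auto simp: min_def max_def split: if_splits)
  qed
  define f where "f c x = min (exp (s * x)) c" for c x :: real
  have f: "integrable \<rho> (f c)" if "real_distribution \<rho>" "0 < c" for \<rho> c
    unfolding f_def using that
    by (intro integrable_bounded_real_distribution[of _ _ c]) (auto simp: min_def)
  have flim: "(\<lambda>n. \<integral>x. f c x \<partial>\<nu> n) \<longlonglongrightarrow> (\<integral>x. f c x \<partial>\<kappa>)" if "0 < c" for c
    unfolding f_def
  proof (rule weak[where B=c])
    show "isCont (\<lambda>x. min (exp (s * x)) c) x" for x by (intro continuous_intros)
    show "norm (min (exp (s * x)) c) \<le> c" for x using that by (simp add: min_def)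
  qed
  have upper: "(\<integral>x. f c x \<partial>\<kappa>) \<le> \<Phi> s" if c: "0 < c" for c
  proof (rule tendsto_le[OF sequentially_bot lim flim[OF c]])
    show "\<forall>\<^sub>F n in sequentially. (\<integral>x. f c x \<partial>\<nu> n) \<le> (\<integral>x. exp (s * x) \<partial>\<nu> n)"
      using int[of s] by eventually_elim (rule integral_mono[OF f[OF \<nu>(1) c]], auto simp: f_def)
  qed
  have lower: "\<Phi> s \<le> (\<integral>x. f c x \<partial>\<kappa>) + \<Phi> (2 * s) / c" if c: "0 < c" for c
  proof (rule tendsto_le[OF sequentially_bot tendsto_add[OF flim[OF c] tendsto_divide[OF lim tendsto_const]] lim])
    show "\<forall>\<^sub>F n in sequentially. (\<integral>x. exp (s * x) \<partial>\<nu> n) \<le> (\<integral>x. f c x \<partial>\<nu> n) + (\<integral>x. exp (2 * s * x) \<partial>\<nu> n) / c"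
      using int[of s] int[of "2 * s"]
    proof eventually_elim
      case (elim n)
      have "exp (s * x) \<le> f c x + exp (2 * s * x) / c" for x
      proof (cases "exp (s * x) \<le> c")
        case False
        have "exp (s * x) * c \<le> exp (s * x) * exp (s * x)"
          using False by (intro mult_left_mono) auto
        also have "\<dots> = exp (2 * s * x)" by (simp add: exp_add[symmetric])
        finally have "exp (s * x) \<le> exp (2 * s * x) / c" using c by (simp add: pos_le_divide_eq)
        then show ?thesis using c by (simp add: f_def min_def)
      qed (use c in \<open>simp add: f_def\<close>)
      then have "(\<integral>x. exp (s * x) \<partial>\<nu> n) \<le> (\<integral>x. f c x + exp (2 * s * x) / c \<partial>\<nu> n)"
        using elim f[OF \<nu>(1) c] by (intro integral_mono) auto
      then show ?case using elim f[OF \<nu>(1) c, of n] by simp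
    qed
  qed (use c in auto)
  have "(\<integral>\<^sup>+x. ennreal (exp (s * x)) \<partial>\<kappa>) \<le> ennreal (\<Phi> s)"
  proof -
    have "(\<integral>\<^sup>+x. ennreal (exp (s * x)) \<partial>\<kappa>) = (\<integral>\<^sup>+x. (SUP k. ennreal (f (real (Suc k)) x)) \<partial>\<kappa>)"
    proof (rule nn_integral_cong)
      fix x :: real
      obtain k where k: "exp (s * x) < real k" using reals_Archimedean2 by blast
      show "ennreal (exp (s * x)) = (SUP k. ennreal (f (real (Suc k)) x))"
      proof (rule antisym)
        show "ennreal (exp (s * x)) \<le> (SUP k. ennreal (f (real (Suc k)) x))"
          using k by (intro SUP_upper2[of k]) (auto simp: f_def min_def)
        show "(SUP k. ennreal (f (real (Suc k)) x)) \<le> ennreal (exp (s * x))"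
          by (intro SUP_least ennreal_leI) (simp add: f_def)
      qed
    qed
    also have "\<dots> = (SUP k. \<integral>\<^sup>+x. ennreal (f (real (Suc k)) x) \<partial>\<kappa>)"
      by (rule nn_integral_monotone_convergence_SUP)
        (auto simp: incseq_def le_fun_def f_def intro!: ennreal_leI min.mono)
    also have "\<dots> \<le> ennreal (\<Phi> s)"
    proof (rule SUP_least)
      fix k
      have "(\<integral>\<^sup>+x. ennreal (f (real (Suc k)) x) \<partial>\<kappa>) = ennreal (\<integral>x. f (real (Suc k)) x \<partial>\<kappa>)"
        by (intro nn_integral_eq_integral f[OF \<kappa>(1)]) (auto simp: f_def)
      also have "\<dots> \<le> ennreal (\<Phi> s)"
        using upper[of "real (Suc k)"] by (intro ennreal_leI) simp
      finally show "(\<integral>\<^sup>+x. ennreal (f (real (Suc k)) x) \<partial>\<kappa>) \<le> ennreal (\<Phi> s)" .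
    qed
    finally show ?thesis .
  qed
  note nn = this
  show int\<kappa>: "integrable \<kappa> (\<lambda>x. exp (s * x))"
    using nn by (intro integrableI_nonneg) (auto intro: le_less_trans)
  have \<Phi>0: "0 \<le> \<Phi> s" for s
    by (rule tendsto_lowerbound[OF lim]) auto
  have "(\<integral>x. exp (s * x) \<partial>\<kappa>) \<le> \<Phi> s"
    using nn nn_integral_eq_integral[OF int\<kappa>] \<Phi>0[of s] by (simp add: ennreal_le_iff)
  moreover have "\<Phi> s \<le> (\<integral>x. exp (s * x) \<partial>\<kappa>)"
  proof (rule tendsto_lowerbound[of "\<lambda>k. (\<integral>x. exp (s * x) \<partial>\<kappa>) + \<Phi> (2 * s) / real k" _ sequentially])
    show "(\<lambda>k. (\<integral>x. exp (s * x) \<partial>\<kappa>) + \<Phi> (2 * s) / real k) \<longlonglongrightarrow> (\<integral>x. exp (s * x) \<partial>\<kappa>)"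
      using tendsto_add[OF tendsto_const lim_const_over_n] by force
    show "\<forall>\<^sub>F k in sequentially. \<Phi> s \<le> (\<integral>x. exp (s * x) \<partial>\<kappa>) + \<Phi> (2 * s) / real k"
      using eventually_gt_at_top[of 0]
    proof eventually_elim
      case (elim k)
      have "(\<integral>x. f (real k) x \<partial>\<kappa>) \<le> (\<integral>x. exp (s * x) \<partial>\<kappa>)"
        using f[OF \<kappa>(1), of "real k"] elim int\<kappa> by (intro integral_mono) (auto simp: f_def)
      then show ?case using lower[of "real k"] elim by simp
    qed
  qed simp
  ultimately show "(\<integral>x. exp (s * x) \<partial>\<kappa>) = \<Phi> s" by simp
qed

text \<open>Exponential moments give tightness. All subsequential limits have the moment generating function
  \<open>\<Phi>\<close> and live on the half line, so they coincide.\<close>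
theorem mgf_convergence:
  fixes \<nu> :: "nat \<Rightarrow> real measure" and \<Phi> :: "real \<Rightarrow> real"
  assumes \<nu>: "\<And>n. real_distribution (\<nu> n)" "\<And>n. AE x in \<nu> n. 0 \<le> x"
    and int: "\<And>s. \<forall>\<^sub>F n in sequentially. integrable (\<nu> n) (\<lambda>x. exp (s * x))"
    and lim: "\<And>s. (\<lambda>n. \<integral>x. exp (s * x) \<partial>\<nu> n) \<longlonglongrightarrow> \<Phi> s"
  obtains \<mu> where "real_distribution \<mu>" "weak_conv_m \<nu> \<mu>"
    "\<And>s. integrable \<mu> (\<lambda>x. exp (s * x))" "\<And>s. (\<integral>x. exp (s * x) \<partial>\<mu>) = \<Phi> s"
proof -
  have "\<forall>\<^sub>F n in sequentially. (\<integral>x. exp (1 * x) \<partial>\<nu> n) < \<Phi> 1 + 1"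
    using lim[of 1] by (rule order_tendstoD) simp
  with int[of 1] have "\<forall>\<^sub>F n in sequentially. integrable (\<nu> n) (\<lambda>x. exp (1 * x)) \<and> (\<integral>x. exp (1 * x) \<partial>\<nu> n) \<le> \<Phi> 1 + 1"
    by eventually_elim simp
  then obtain N where N: "\<And>n. n \<ge> N \<Longrightarrow> integrable (\<nu> n) (\<lambda>x. exp x) \<and> (\<integral>x. exp x \<partial>\<nu> n) \<le> \<Phi> 1 + 1"
    by (auto simp: eventually_sequentially)
  define \<nu>' where "\<nu>' n = \<nu> (n + N)" for n
  have \<nu>': "real_distribution (\<nu>' n)" "AE x in \<nu>' n. 0 \<le> x" for n
    unfolding \<nu>'_def by (rule \<nu>)+
  have int': "\<forall>\<^sub>F n in sequentially. integrable (\<nu>' n) (\<lambda>x. exp (s * x))" for s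
    unfolding \<nu>'_def using int[of s] by (rule eventually_compose_filterlim) (rule filterlim_add_const_nat_at_top)
  have lim': "(\<lambda>n. \<integral>x. exp (s * x) \<partial>\<nu>' n) \<longlonglongrightarrow> \<Phi> s" for s
    unfolding \<nu>'_def using lim[of s] by (rule LIMSEQ_ignore_initial_segment)
  have tight: "tight \<nu>'"
    unfolding tight_def
  proof (intro conjI allI impI)
    fix e :: real assume e: "0 < e"
    define C where "C = \<bar>\<Phi> 1\<bar> + 1"
    define b where "b = max 0 (ln (2 * C / e))"
    have C: "0 < C" by (simp add: C_def)
    have Cb: "C / exp b < e"
    proof -
      have "2 * C / e \<le> exp b"
      proof -
        have "2 * C / e = exp (ln (2 * C / e))" using C e by simp
        also have "\<dots> \<le> exp b" unfolding b_def by simp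
        finally show ?thesis .
      qed
      then have "2 * C \<le> e * exp b" using e by (simp add: pos_divide_le_eq mult.commute)
      then show ?thesis using C by (simp add: pos_divide_less_eq)
    qed
    have "measure (\<nu>' n) {- 1<..b} > 1 - e" for n
    proof -
      interpret real_distribution "\<nu>' n" by (rule \<nu>')
      have n: "integrable (\<nu>' n) (\<lambda>x. exp x)" "(\<integral>x. exp x \<partial>\<nu>' n) \<le> C"
        using N[of "n + N"] by (auto simp: \<nu>'_def C_def)
      have "prob {x \<in> space (\<nu>' n). exp b \<le> exp x} \<le> (\<integral>x. exp x \<partial>\<nu>' n) / exp b"
        using n(1) by (intro integral_Markov_inequality_measure[of _ _ "{}"]) auto
      also have "\<dots> \<le> C / exp b" using n(2) by (intro divide_right_mono) auto
      also have "\<dots> < e" by (rule Cb)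
      finally have 1: "prob {b..} < e" by (simp add: atLeast_def)
      have "prob (- {- 1<..b}) \<le> prob {b..}"
        using \<nu>'(2)[of n] by (intro finite_measure_mono_AE) (auto elim!: eventually_mono)
      moreover have "prob (- {- 1<..b}) = 1 - prob {- 1<..b}"
        using prob_compl[of "{- 1<..b}"] by (simp add: Compl_eq_Diff_UNIV)
      ultimately show ?thesis using 1 by simp
    qed
    moreover have "- 1 < b" by (simp add: b_def)
    ultimately show "\<exists>a b. a < b \<and> (\<forall>n. 1 - e < measure (\<nu>' n) {a<..b})" by blast
  qed (rule \<nu>')
  have sub: "(AE x in \<kappa>. 0 \<le> x) \<and> integrable \<kappa> (\<lambda>x. exp (s * x)) \<and> (\<integral>x. exp (s * x) \<partial>\<kappa>) = \<Phi> s"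
    if r: "strict_mono r" and \<kappa>: "real_distribution \<kappa>" "weak_conv_m (\<nu>' \<circ> r) \<kappa>" for r \<kappa> s
  proof -
    note * = weak_limit_mgf[of "\<nu>' \<circ> r" \<Phi> \<kappa>, OF _ _ _ _ \<kappa>]
    have nonneg: "AE x in (\<nu>' \<circ> r) n. 0 \<le> x" for n
      unfolding comp_def by (rule \<nu>')
    have h: "\<And>n. real_distribution ((\<nu>' \<circ> r) n)"
      "\<And>s. \<forall>\<^sub>F n in sequentially. integrable ((\<nu>' \<circ> r) n) (\<lambda>x. exp (s * x))"
      "\<And>s. (\<lambda>n. \<integral>x. exp (s * x) \<partial>(\<nu>' \<circ> r) n) \<longlonglongrightarrow> \<Phi> s"
      using \<nu>' eventually_subseq[OF r int'] LIMSEQ_subseq_LIMSEQ[OF lim' r] by (auto simp: comp_def)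
    show ?thesis using *[OF h(1) nonneg h(2,3)] by blast
  qed
  obtain r \<mu> where r: "strict_mono r" "real_distribution \<mu>" "weak_conv_m (\<nu>' \<circ> id \<circ> r) \<mu>"
    using tight_imp_convergent_subsubsequence[OF tight, of id] by (auto simp: strict_mono_def)
  then have \<mu>: "AE x in \<mu>. 0 \<le> x" "\<And>s. integrable \<mu> (\<lambda>x. exp (s * x))" "\<And>s. (\<integral>x. exp (s * x) \<partial>\<mu>) = \<Phi> s"
    using sub[of r \<mu>] by auto
  have "weak_conv_m \<nu>' \<mu>"
  proof (rule tight_subseq_weak_converge[OF \<nu>'(1) r(2) tight])
    fix s \<kappa> assume s: "strict_mono s" and \<kappa>: "real_distribution \<kappa>" "weak_conv_m (\<nu>' \<circ> s) \<kappa>"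
    have "\<kappa> = \<mu>"
    proof (rule laplace_unique[OF \<kappa>(1) _ r(2) \<mu>(1)])
      show "AE x in \<kappa>. 0 \<le> x" using sub[OF s \<kappa>] by blast
      show "(\<integral>x. exp (- real k * x) \<partial>\<kappa>) = (\<integral>x. exp (- real k * x) \<partial>\<mu>)" for k
        using sub[OF s \<kappa>, of "- real k"] \<mu>(3)[of "- real k"] by simp
    qed
    then show "weak_conv_m (\<nu>' \<circ> s) \<mu>" using \<kappa> by simp
  qed
  then have "weak_conv_m \<nu> \<mu>"
    unfolding weak_conv_m_def weak_conv_def \<nu>'_def by (auto intro: LIMSEQ_offset)
  with r(2) \<mu> show ?thesis by (intro that) auto
qed

text \<open>The mean is the derivative at \<open>0\<close>, taken along \<open>1 / Suc n\<close> under the integral.\<close>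
lemma mean_from_mgf:
  assumes \<mu>: "real_distribution \<mu>" and int: "\<And>s. integrable \<mu> (\<lambda>x. exp (s * x))"
    and mgf: "\<And>s. (\<integral>x. exp (s * x) \<partial>\<mu>) = 1 + s * c s" and c: "isCont c 0"
  shows "integrable \<mu> (\<lambda>x. x)" "(\<integral>x. x \<partial>\<mu>) = c 0"
proof -
  interpret real_distribution \<mu> by fact
  define w where "w x = exp (2 * x) + exp (- 2 * x)" for x :: real
  have w: "integrable \<mu> w" unfolding w_def using int[of 2] int[of "- 2"] by simp
  define h where "h n = 1 / real (Suc n)" for n
  have h: "0 < h n" "h n \<le> 1" for n by (auto simp: h_def)
  have h0: "h \<longlonglongrightarrow> 0" unfolding h_def by (rule LIMSEQ_Suc[OF lim_const_over_n])
  have lim: "(\<lambda>n. (exp (h n * x) - 1) / h n) \<longlonglongrightarrow> x" for x :: real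
  proof -
    have "((\<lambda>t. exp (t * x)) has_real_derivative x) (at 0)"
      by (auto intro!: derivative_eq_intros)
    then have "((\<lambda>t. (exp (t * x) - 1) / t) \<longlongrightarrow> x) (at 0)"
      by (simp add: DERIV_def)
    then show ?thesis
      by (rule filterlim_compose) (use h0 h in \<open>auto simp: filterlim_at intro!: always_eventually less_imp_neq[symmetric]\<close>)
  qed
  have bound: "\<bar>(exp (h n * x) - 1) / h n\<bar> \<le> w x" for n x
  proof -
    have "\<bar>exp (x * h n) - 1\<bar> \<le> \<bar>x\<bar> * h n * exp (\<bar>x\<bar> * h n)"
      using h(1)[of n] by (intro exp_diff_le) simp
    then have "\<bar>(exp (h n * x) - 1) / h n\<bar> \<le> \<bar>x\<bar> * exp (\<bar>x\<bar> * h n)"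
      using h(1)[of n] by (simp add: divide_le_eq mult_ac)
    also have "\<dots> \<le> exp \<bar>x\<bar> * exp \<bar>x\<bar>"
    proof (intro mult_mono)
      show "\<bar>x\<bar> \<le> exp \<bar>x\<bar>" using exp_ge_add_one_self[of "\<bar>x\<bar>"] by linarith
      show "exp (\<bar>x\<bar> * h n) \<le> exp \<bar>x\<bar>"
        using h[of n] mult_left_mono[of "h n" 1 "\<bar>x\<bar>"] by simp
    qed auto
    also have "\<dots> \<le> w x"
      by (cases "0 \<le> x") (auto simp: w_def exp_add[symmetric])
    finally show ?thesis .
  qed
  show "integrable \<mu> (\<lambda>x. x)"
    by (rule integrable_dominated_convergence[OF _ _ w AE_I2[OF lim]]) (use bound in auto)
  have "(\<lambda>n. \<integral>x. (exp (h n * x) - 1) / h n \<partial>\<mu>) \<longlonglongrightarrow> (\<integral>x. x \<partial>\<mu>)"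
    by (rule integral_dominated_convergence[OF _ _ w AE_I2[OF lim]]) (use bound in auto)
  moreover have "(\<integral>x. (exp (h n * x) - 1) / h n \<partial>\<mu>) = c (h n)" for n
    using int[of "h n"] h(1)[of n] prob_space by (simp add: mgf)
  moreover have "(\<lambda>n. c (h n)) \<longlonglongrightarrow> c 0"
    using c h0 by (rule isCont_tendsto_compose)
  ultimately show "(\<integral>x. x \<partial>\<mu>) = c 0"
    using LIMSEQ_unique by simp
qed

section \<open>The exponential integral as a principal value\<close>

text \<open>Compare with the integral for the Euler constant: the two integrands differ by \<open>1 / v\<close> on
  \<open>{e..1}\<close> and by the integrand of \<open>ein\<close> on \<open>{0..e}\<close>.\<close>
lemma exp_integral_tail:
  assumes e: "0 < e" "e < 1"
  defines "k \<equiv> \<lambda>v::real. indicator {e..} v * (exp (- v) / v)"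
  shows "integrable lborel k" "integral\<^sup>L lborel k = - euler_mascheroni - ein (- e) - ln e"
proof -
  define G where "G v = indicator {0<..} v * ((indicator {..<1} v - exp (- v)) / v)" for v :: real
  have G: "integrable lborel G" "integral\<^sup>L lborel G = euler_mascheroni"
    using euler_integral by (simp_all only: G_def[abs_def])
  have A: "integrable lborel (\<lambda>v. indicator {0..e} v * ((exp (- 1 * v) - 1) / v))"
    "(\<integral>v. indicator {0..e} v * ((exp (- 1 * v) - 1) / v) \<partial>lborel) = ein (- 1 * e)"
    using e by (intro ein_integral; simp)+
  have dln: "(ln has_real_derivative 1 / x) (at x)" if "e \<le> x" "x \<le> 1" for x
    using that e by (auto intro!: derivative_eq_intros)
  have "continuous_on {e..1} (\<lambda>x::real. 1 / x)"
    using e by (auto intro!: continuous_intros)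
  note B = integral_FTC_Icc[OF less_imp_le[OF e(2)] dln this]
  have eq: "AE v in lborel. k v = indicator {e..1} v * (1 / v) - G v - indicator {0..e} v * ((exp (- 1 * v) - 1) / v)"
    using AE_lborel_singleton[of 0] AE_lborel_singleton[of e] AE_lborel_singleton[of 1]
    by eventually_elim (use e in \<open>auto simp: k_def G_def indicator_def diff_divide_distrib\<close>)
  have k: "k \<in> borel_measurable lborel" unfolding k_def by measurable
  have G': "G \<in> borel_measurable lborel" using G(1) by simp
  show "integrable lborel k"
    using A(1) B(1) G(1) k by (subst integrable_cong_AE[OF _ _ eq]) auto
  have "integral\<^sup>L lborel k = (\<integral>v. indicator {e..1} v * (1 / v) - G v - indicator {0..e} v * ((exp (- 1 * v) - 1) / v) \<partial>lborel)"
    using k G' by (intro integral_cong_AE eq) auto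
  also have "\<dots> = (\<integral>v. indicator {e..1} v * (1 / v) - G v \<partial>lborel) - ein (- 1 * e)"
    unfolding A(2)[symmetric] by (intro Bochner_Integration.integral_diff A(1) Bochner_Integration.integrable_diff B(1) G(1))
  also have "(\<integral>v. indicator {e..1} v * (1 / v) - G v \<partial>lborel) = ln 1 - ln e - euler_mascheroni"
    using Bochner_Integration.integral_diff[OF B(1) G(1)] B(2) G(2) by simp
  finally show "integral\<^sup>L lborel k = - euler_mascheroni - ein (- e) - ln e" by simp
qed

text \<open>The logarithms from the two sides of the pole cancel, and \<open>ein (-e) - ein e\<close> vanishes in the
  limit.\<close>
lemma Ei_eq:
  assumes s: "0 < s"
  shows "Ei s = euler_mascheroni + ln s + ein s"
  unfolding Ei_def
proof (rule tendsto_Lim)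
  have ein_cont: "isCont ein x" for x
    using DERIV_ein by (rule DERIV_isCont)
  have "((\<lambda>e. ein (- e) - ein e) \<longlongrightarrow> ein (- 0) - ein 0) (at_right 0)"
    by (intro tendsto_diff isCont_tendsto_compose[OF ein_cont] tendsto_intros)
  then have "((\<lambda>e. euler_mascheroni + ln s + ein s + (ein (- e) - ein e)) \<longlongrightarrow> euler_mascheroni + ln s + ein s + 0) (at_right 0)"
    by (intro tendsto_add tendsto_const) simp
  then have lim: "((\<lambda>e. euler_mascheroni + ln s + ein s + (ein (- e) - ein e)) \<longlongrightarrow> euler_mascheroni + ln s + ein s) (at_right 0)"
    by simp
  have "\<forall>\<^sub>F e in at_right 0. e \<in> {0<..<min 1 s}"
    by (rule eventually_at_right_real) (use s in simp)
  then have "\<forall>\<^sub>F e in at_right 0. euler_mascheroni + ln s + ein s + (ein (- e) - ein e) =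
      (LINT x:{..s} - {- e<..<e}|lborel. exp x / x)"
  proof eventually_elim
    case (elim e)
    then have e: "0 < e" "e < 1" "e < s" by auto
    define k where "k v = indicator {e..} v * (exp (- v) / v)" for v :: real
    have k: "integrable lborel k" "integral\<^sup>L lborel k = - euler_mascheroni - ein (- e) - ln e"
      using exp_integral_tail[OF e(1,2)] by (simp_all only: k_def[abs_def])
    have refl: "integrable lborel (\<lambda>x. k (0 + (- 1) * x))"
      using k(1) by (rule lborel_integrable_real_affine) simp
    have refl_int: "integral\<^sup>L lborel k = (\<integral>x. k (0 + (- 1) * x) \<partial>lborel)"
      by (subst lborel_integral_real_affine[of "- 1" k 0]) simp_all
    have d: "((\<lambda>x. ein x + ln x) has_real_derivative exp x / x) (at x)" if "e \<le> x" for x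
    proof -
      have "((\<lambda>x. ein x + ln x) has_real_derivative exprel x + 1 / x) (at x)"
        using that e by (intro DERIV_add DERIV_ein) (auto intro!: derivative_eq_intros)
      moreover have "exprel x + 1 / x = exp x / x"
        using exprel_eq[of x] that e by (simp add: field_simps)
      ultimately show ?thesis by simp
    qed
    have B: "integrable lborel (\<lambda>x. indicator {e..s} x * (exp x / x))"
      "(\<integral>x. indicator {e..s} x * (exp x / x) \<partial>lborel) = (ein s + ln s) - (ein e + ln e)"
      using e d by (intro integral_FTC_Icc; auto intro!: continuous_intros)+
    have "(LINT x:{..s} - {- e<..<e}|lborel. exp x / x) =
        (\<integral>x. indicator {e..s} x * (exp x / x) - k (0 + (- 1) * x) \<partial>lborel)"
      unfolding set_lebesgue_integral_def
      by (rule Bochner_Integration.integral_cong) (use e in \<open>auto simp: k_def indicator_def\<close>)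
    also have "\<dots> = (ein s + ln s) - (ein e + ln e) - integral\<^sup>L lborel k"
      using B refl refl_int by simp
    finally show ?case by (simp add: k)
  qed
  from Lim_transform_eventually[OF lim this]
  show "((\<lambda>e. LINT x:{..s} - {- e<..<e}|lborel. exp x / x) \<longlongrightarrow> euler_mascheroni + ln s + ein s) (at_right 0)" .
qed simp

section \<open>The moment generating function of the gaps\<close>

text \<open>The recursion for \<open>\<phi>\<^bsub>n+1\<^esub>(s)\<close> involves \<open>1 - \<phi>\<^bsub>n\<^esub>(s - 1)\<close>. With \<open>l = 1 - s\<close> the sum
  \<open>log_mgf n (s - 1)\<close> telescopes and this becomes \<open>exp (- frullani n l)\<close>, so that each step adds
  one summand to the exponent.\<close>
lemma gap_law_mgf:
  assumes "s < 1"
  shows "integrable (gap_law n) (\<lambda>x. exp (s * x))"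
    "(\<integral>x. exp (s * x) \<partial>gap_law n) = 1 + s / (1 - s) * exp (log_mgf n s)"
proof -
  have "integrable (gap_law n) (\<lambda>x. exp (s * x)) \<and>
      (\<integral>x. exp (s * x) \<partial>gap_law n) = 1 + s / (1 - s) * exp (log_mgf n s)"
    using assms
  proof (induction n arbitrary: s)
    case 0
    have s: "0 < 1 - s" using 0 by simp
    have "(\<integral>\<^sup>+x. ennreal (exp (s * x)) \<partial>expM) = (\<integral>\<^sup>+x. ennreal (exp (- (1 - s) * x)) * indicator {0..} x \<partial>lborel)"
      by (subst nn_integral_expM, measurable, intro nn_integral_cong)
        (auto simp: exponential_density_def indicator_def ennreal_mult[symmetric] exp_add[symmetric] algebra_simps)
    also have "\<dots> = ennreal (1 / (1 - s))"
      using exp_tail(2)[OF s, of 0] by simp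
    finally have eq: "(\<integral>\<^sup>+x. ennreal (exp (s * x)) \<partial>expM) = ennreal (1 / (1 - s))" .
    then have "integrable expM (\<lambda>x. exp (s * x))"
      by (intro integrableI_nonneg) auto
    moreover have "(\<integral>x. exp (s * x) \<partial>expM) = 1 / (1 - s)"
      using eq s by (subst integral_eq_nn_integral) auto
    moreover have "1 / (1 - s) = 1 + s / (1 - s)" using s by (simp add: field_simps)
    ultimately show ?case by (simp add: log_mgf_def)
  next
    case (Suc n)
    interpret renewal_law "gap_law n" by (rule renewal_law_gap_law)
    define l where "l = 1 - s"
    have l: "0 < l" using Suc.prems by (simp add: l_def)
    have lower: "(\<integral>x. exp ((s - 1) * x) \<partial>gap_law n) = 1 - exp (- frullani n l)"
    proof -
      have "log_mgf n (s - 1) = (\<Sum>k<n. frullani k (l + 1))"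
        by (simp add: log_mgf_def l_def algebra_simps)
      also have "\<dots> = frullani 0 l - frullani n l"
        by (simp add: frullani_diff[OF l] sum_lessThan_telescope'[of "\<lambda>k. frullani k l" n])
      finally have "exp (log_mgf n (s - 1)) = (1 + l) / l * exp (- frullani n l)"
        using l by (simp add: frullani_0 exp_diff exp_minus divide_inverse)
      moreover have "(\<integral>x. exp ((s - 1) * x) \<partial>gap_law n) = 1 + (s - 1) / (1 - (s - 1)) * exp (log_mgf n (s - 1))"
        using Suc.IH[of "s - 1"] Suc.prems by simp
      moreover have "(s - 1) / (1 - (s - 1)) = - (l / (1 + l))" by (simp add: l_def minus_divide_left)
      ultimately have "(\<integral>x. exp ((s - 1) * x) \<partial>gap_law n) =
          1 + - (l / (1 + l)) * ((1 + l) / l * exp (- frullani n l))"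
        by (simp only:)
      then show ?thesis using l by simp
    qed
    note IH = Suc.IH[OF Suc.prems]
    have "(\<integral>x. exp (s * x) \<partial>gap_law (Suc n)) =
        ((1 + s / (1 - s) * exp (log_mgf n s)) - (1 - exp (- frullani n l))) / (1 - (1 - exp (- frullani n l)))"
      using thin_law_mgf(3)[OF conjunct1[OF IH] Suc.prems] IH lower by simp
    also have "\<dots> = 1 + s / (1 - s) * (exp (log_mgf n s) * exp (frullani n l))"
    proof -
      have "((1 + x) - (1 - a)) / (1 - (1 - a)) = 1 + x / a" if "a \<noteq> 0" for x a :: real
        using that by (simp add: add_divide_distrib)
      note this[of "exp (- frullani n l)" "s / (1 - s) * exp (log_mgf n s)"]
      moreover have "x / exp (- frullani n l) = x * exp (frullani n l)" for x
        by (simp add: exp_minus divide_inverse)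
      ultimately show ?thesis by (simp only: exp_not_eq_zero not_False_eq_True mult.assoc)
    qed
    also have "exp (log_mgf n s) * exp (frullani n l) = exp (log_mgf (Suc n) s)"
      by (simp add: log_mgf_def l_def exp_add)
    finally show ?case
      using thin_law_mgf(1)[OF conjunct1[OF IH] Suc.prems] by simp
  qed
  then show "integrable (gap_law n) (\<lambda>x. exp (s * x))"
    "(\<integral>x. exp (s * x) \<partial>gap_law n) = 1 + s / (1 - s) * exp (log_mgf n s)" by auto
qed

lemma scaled_mgf_limit:
  "(\<lambda>n. 1 + s / ln (real n) / (1 - s / ln (real n)) * exp (log_mgf n (s / ln (real n))))
    \<longlonglongrightarrow> 1 + s * (exp euler_mascheroni * exp (ein s))"
proof -
  have ln_top: "filterlim (\<lambda>n. ln (real n)) at_top sequentially"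
    by (rule filterlim_compose[OF ln_at_top filterlim_real_sequentially])
  have inv: "(\<lambda>n. inverse (ln (real n))) \<longlonglongrightarrow> 0"
    using ln_top by (rule tendsto_inverse_0_at_top)
  have "(\<lambda>n. (inverse (ln (real n)) + 1) / (1 - s * inverse (ln (real n)))) \<longlonglongrightarrow> (0 + 1) / (1 - s * 0)"
    by (intro tendsto_intros inv) simp
  then have ratio: "(\<lambda>n. (inverse (ln (real n)) + 1) / (1 - s * inverse (ln (real n)))) \<longlonglongrightarrow> 1" by simp
  have "(\<lambda>n. 1 + s * ((inverse (ln (real n)) + 1) / (1 - s * inverse (ln (real n))) *
      exp (log_mgf n (s / ln (real n)) - ln (1 + ln (real n))))) \<longlonglongrightarrow> 1 + s * (1 * exp (euler_mascheroni + ein s))"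
    by (intro tendsto_intros ratio log_mgf_limit)
  then have "(\<lambda>n. 1 + s * ((inverse (ln (real n)) + 1) / (1 - s * inverse (ln (real n))) *
      exp (log_mgf n (s / ln (real n)) - ln (1 + ln (real n))))) \<longlonglongrightarrow> 1 + s * (exp euler_mascheroni * exp (ein s))"
    by (simp add: exp_add)
  then show ?thesis
  proof (rule Lim_transform_eventually)
    have "\<forall>\<^sub>F n in sequentially. 0 < ln (real n)"
      using ln_top by (auto simp: filterlim_at_top_dense)
    then show "\<forall>\<^sub>F n in sequentially. 1 + s * ((inverse (ln (real n)) + 1) / (1 - s * inverse (ln (real n))) *
      exp (log_mgf n (s / ln (real n)) - ln (1 + ln (real n)))) =
      1 + s / ln (real n) / (1 - s / ln (real n)) * exp (log_mgf n (s / ln (real n)))"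
    proof eventually_elim
      case (elim n)
      define L where "L = ln (real n)"
      have L: "0 < L" using elim by (simp add: L_def)
      have "exp (log_mgf n (s / L) - ln (1 + L)) = exp (log_mgf n (s / L)) / (1 + L)"
        using L by (simp add: exp_diff)
      moreover have "(inverse L + 1) / (1 + L) = 1 / L"
      proof -
        have "inverse L + 1 = (1 + L) / L" using L by (simp add: field_simps)
        then show ?thesis using L by simp
      qed
      ultimately have "(inverse L + 1) / (1 - s * inverse L) * exp (log_mgf n (s / L) - ln (1 + L)) =
          1 / L / (1 - s / L) * exp (log_mgf n (s / L))"
        by (metis (no_types, opaque_lifting) divide_inverse times_divide_eq_left times_divide_eq_right mult.commute)
      then show ?case by (simp add: L_def[symmetric])
    qed
  qed
qed

theorem theorem1:
  fixes M :: "'a measure"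
    and E :: "nat \<Rightarrow> nat \<Rightarrow> 'a \<Rightarrow> real"
    and \<eta> :: "'a \<Rightarrow> real \<Rightarrow> nat \<Rightarrow> bool"
  assumes "forest_fire M E \<eta>"
  shows "\<exists>\<mu> :: real measure. real_distribution \<mu> \<and>
      (\<forall>i\<ge>1. weak_conv_m (\<lambda>n. distr M borel (\<lambda>\<omega>. burnout_gap E \<eta> n i \<omega> / ln (real n))) \<mu>) \<and>
      integrable \<mu> (\<lambda>x. x) \<and> (\<integral>x. x \<partial>\<mu>) = exp euler_mascheroni \<and>
      (\<forall>s::real. integrable \<mu> (\<lambda>x. exp (s * x)) \<and>
         (\<integral>x. exp (s * x) \<partial>\<mu>) =
           1 + s * exp euler_mascheroni * exp (\<Sum>m. s ^ Suc m / (real (Suc m) * fact (Suc m)))) \<and>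
      (\<forall>s>0. 1 + s * exp euler_mascheroni * exp (\<Sum>m. s ^ Suc m / (real (Suc m) * fact (Suc m))) =
           1 + exp (Ei s))"
proof -
  interpret forest_fire M E \<eta> by fact
  define \<nu> where "\<nu> n = distr (gap_law n) borel (\<lambda>x. x / ln (real n))" for n
  define c where "c s = exp euler_mascheroni * exp (ein s)" for s
  have law: "distr M borel (\<lambda>\<omega>. burnout_gap E \<eta> n i \<omega> / ln (real n)) = \<nu> n" if "i \<ge> 1" for n i
  proof -
    have "i \<noteq> 0" using that by simp
    then obtain j where i: "i = Suc j" by (cases i) auto
    have [measurable]: "burnout_gap E \<eta> n (Suc j) \<in> borel_measurable M"
      using burnout_time_measurable by (simp add: burnout_gap_def[abs_def])
    show ?thesis
      unfolding \<nu>_def burnout_gap_law[of n j, symmetric] i by (subst distr_distr) (auto simp: comp_def)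
  qed
  have \<nu>: "real_distribution (\<nu> n)" "AE x in \<nu> n. 0 \<le> x" for n
  proof -
    interpret L: renewal_law "gap_law n" by (rule renewal_law_gap_law)
    show "real_distribution (\<nu> n)"
      unfolding \<nu>_def real_distribution_def real_distribution_axioms_def
      by (auto intro!: L.prob_space_distr)
    \<comment> \<open>This includes \<open>n = 0\<close>, as \<open>ln 0 = 0\<close>.\<close>
    have "0 \<le> ln (real n)" by (cases "n = 0") (auto intro: ln_ge_zero)
    then show "AE x in \<nu> n. 0 \<le> x"
      unfolding \<nu>_def using L.pos
      by (subst AE_distr_iff) (auto elim!: eventually_mono intro!: divide_nonneg_nonneg)
  qed
  have mgf: "integrable (\<nu> n) (\<lambda>x. exp (s * x))" "(\<integral>x. exp (s * x) \<partial>\<nu> n) =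
      1 + s / ln (real n) / (1 - s / ln (real n)) * exp (log_mgf n (s / ln (real n)))"
    if "s / ln (real n) < 1" for s n
  proof -
    interpret L: renewal_law "gap_law n" by (rule renewal_law_gap_law)
    show "integrable (\<nu> n) (\<lambda>x. exp (s * x))"
      unfolding \<nu>_def using gap_law_mgf(1)[OF that, of n] by (subst integrable_distr_eq) auto
    show "(\<integral>x. exp (s * x) \<partial>\<nu> n) =
      1 + s / ln (real n) / (1 - s / ln (real n)) * exp (log_mgf n (s / ln (real n)))"
      unfolding \<nu>_def using gap_law_mgf(2)[OF that, of n] by (subst integral_distr) auto
  qed
  have small: "\<forall>\<^sub>F n in sequentially. s / ln (real n) < 1" for s
  proof -
    have "filterlim (\<lambda>n. ln (real n)) at_top sequentially"
      by (rule filterlim_compose[OF ln_at_top filterlim_real_sequentially])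
    then have "\<forall>\<^sub>F n in sequentially. max 0 s < ln (real n)"
      unfolding filterlim_at_top_dense by blast
    then show ?thesis by eventually_elim simp
  qed
  have int: "\<forall>\<^sub>F n in sequentially. integrable (\<nu> n) (\<lambda>x. exp (s * x))" for s
    using small[of s] by eventually_elim (rule mgf)
  have lim: "(\<lambda>n. \<integral>x. exp (s * x) \<partial>\<nu> n) \<longlonglongrightarrow> 1 + s * c s" for s
    unfolding c_def
  proof (rule Lim_transform_eventually[OF scaled_mgf_limit])
    show "\<forall>\<^sub>F n in sequentially. 1 + s / ln (real n) / (1 - s / ln (real n)) * exp (log_mgf n (s / ln (real n))) =
        (\<integral>x. exp (s * x) \<partial>\<nu> n)"
      using small[of s] by eventually_elim (rule mgf(2)[symmetric])
  qed
  obtain \<mu> where \<mu>: "real_distribution \<mu>" "weak_conv_m \<nu> \<mu>"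
    "\<And>s. integrable \<mu> (\<lambda>x. exp (s * x))" "\<And>s. (\<integral>x. exp (s * x) \<partial>\<mu>) = 1 + s * c s"
    using mgf_convergence[OF \<nu> int lim] by blast
  have "isCont c 0"
    unfolding c_def by (intro continuous_intros DERIV_isCont[OF DERIV_ein] isCont_o2[OF _ DERIV_isCont[OF DERIV_ein]])
  note mean = mean_from_mgf[OF \<mu>(1,3,4) this]
  have Ei: "exp (Ei s) = s * c s" if "0 < s" for s
    using that by (simp add: Ei_eq exp_add c_def)
  show ?thesis
  proof (intro exI[of _ \<mu>] conjI allI impI)
    fix i :: nat assume "1 \<le> i"
    then show "weak_conv_m (\<lambda>n. distr M borel (\<lambda>\<omega>. burnout_gap E \<eta> n i \<omega> / ln (real n))) \<mu>"
      using \<mu>(2) by (simp add: law)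
  next
    show "(\<integral>x. x \<partial>\<mu>) = exp euler_mascheroni"
      using mean(2) by (simp add: c_def)
  next
    fix s :: real
    show "(\<integral>x. exp (s * x) \<partial>\<mu>) =
        1 + s * exp euler_mascheroni * exp (\<Sum>m. s ^ Suc m / (real (Suc m) * fact (Suc m)))"
      unfolding ein_def[symmetric] by (simp add: \<mu>(4) c_def mult.assoc)
  next
    fix s :: real assume "0 < s"
    then show "1 + s * exp euler_mascheroni * exp (\<Sum>m. s ^ Suc m / (real (Suc m) * fact (Suc m))) =
        1 + exp (Ei s)"
      unfolding ein_def[symmetric] by (simp add: Ei c_def mult.assoc)
  qed (use \<mu> mean in auto)
qed

end
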